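(* If $P$ is a standard RAP with parameters $k,m,n$ such that $\max(m,n)>(k-1)^2$, then \[ E(P)=\frac{1}{mn}\sum_{i,j}\frac{d_{i,j}(P)}{\binom{m-1}{i}\binom{n-1}{j}}, \] summed over nonnegative integers $i,j$ with $i+j<k$.
   Context: Let $k,m,n$ be positive integers with $\min(m,n)\ge k$. A $k$-assignment in an $m\times n$ matrix is a set of $k$ positions, no two in the same row or column; its cost is the sum of the entries there. A standard RAP $P$ is given by $k,m,n$ and a set $Z$ of positions: entries at positions of $Z$ are $0$, all others are independent exponential random variables with intensity $1$; $E(P)$ is the expected minimal cost of a $k$-assignment. A set of rows and columns covers $Z$ if each position of $Z$ lies in one of its rows or columns; a cover with $s$ rows and columns in total is an $s$-cover; a partial $(k-1)$-cover is a subset of some $(k-1)$-cover of $Z$; $d_{i,j}(P)$ is the number of partial $(k-1)$-covers of $Z$ with exactly $i$ rows and $j$ columns. *)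

theory Defs
  imports "HOL-Probability.Probability"
begin

text \<open>Rows are numbered \<open>0, \<dots>, m - 1\<close> and columns \<open>0, \<dots>, n - 1\<close>.\<close>

definition positions :: "nat \<Rightarrow> nat \<Rightarrow> (nat \<times> nat) set" where
  "positions m n = {..<m} \<times> {..<n}"

definition assignments :: "nat \<Rightarrow> nat \<Rightarrow> nat \<Rightarrow> (nat \<times> nat) set set" where
  "assignments k m n =
     {S. S \<subseteq> positions m n \<and> card S = k \<and> inj_on fst S \<and> inj_on snd S}"

definition min_cost :: "nat \<Rightarrow> nat \<Rightarrow> nat \<Rightarrow> (nat \<times> nat \<Rightarrow> real) \<Rightarrow> real" where
  "min_cost k m n a = Min ((\<lambda>S. \<Sum>p\<in>S. a p) ` assignments k m n)"

text \<open>
  The random cost matrix is a family \<open>A\<close> of random variables on an arbitrary probability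
  space \<open>M\<close>, indexed by positions.
\<close>

definition standard_rap ::
    "'w measure \<Rightarrow> nat \<Rightarrow> nat \<Rightarrow> nat \<Rightarrow> (nat \<times> nat) set \<Rightarrow> (nat \<times> nat \<Rightarrow> 'w \<Rightarrow> real) \<Rightarrow> bool" where
  "standard_rap M k m n Z A \<longleftrightarrow>
     prob_space M \<and> 0 < k \<and> 0 < m \<and> 0 < n \<and> k \<le> min m n \<and> Z \<subseteq> positions m n \<and>
     (\<forall>p\<in>Z. \<forall>\<omega>\<in>space M. A p \<omega> = 0) \<and>
     (\<forall>p\<in>positions m n - Z. distributed M lborel (A p) (exponential_density 1)) \<and>
     prob_space.indep_vars M (\<lambda>_. borel) A (positions m n - Z)"

definition expected_min_cost ::
    "'w measure \<Rightarrow> nat \<Rightarrow> nat \<Rightarrow> nat \<Rightarrow> (nat \<times> nat \<Rightarrow> 'w \<Rightarrow> real) \<Rightarrow> real" where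
  "expected_min_cost M k m n A =
     prob_space.expectation M (\<lambda>\<omega>. min_cost k m n (\<lambda>p. A p \<omega>))"

text \<open>A set of rows and columns is represented by the pair \<open>(R, C)\<close> of its rows and its columns.\<close>

definition covers ::
    "nat \<Rightarrow> nat \<Rightarrow> (nat \<times> nat) set \<Rightarrow> nat \<Rightarrow> (nat set \<times> nat set) set" where
  "covers m n Z s =
     {(R, C). R \<subseteq> {..<m} \<and> C \<subseteq> {..<n} \<and> card R + card C = s \<and>
              (\<forall>(r, c)\<in>Z. r \<in> R \<or> c \<in> C)}"

definition partial_covers ::
    "nat \<Rightarrow> nat \<Rightarrow> (nat \<times> nat) set \<Rightarrow> nat \<Rightarrow> (nat set \<times> nat set) set" where
  "partial_covers m n Z s =
     {(R, C). \<exists>(R', C')\<in>covers m n Z s. R \<subseteq> R' \<and> C \<subseteq> C'}"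

definition partial_cover_count ::
    "nat \<Rightarrow> nat \<Rightarrow> nat \<Rightarrow> (nat \<times> nat) set \<Rightarrow> nat \<Rightarrow> nat \<Rightarrow> nat" where
  "partial_cover_count k m n Z i j =
     card {(R, C). (R, C) \<in> partial_covers m n Z (k - 1) \<and> card R = i \<and> card C = j}"

end

(*
  Let g(S) be the smallest size of a cover of Z whose set of columns is S, and call S closed if
  every larger set of columns T has g(T) > g(S).  Say that S is reached (stage) if an optimal
  |S|-assignment that avoids the rows with zeros outside S uses precisely the columns S.  By
  Hall's theorem such an assignment extends by zeros to an optimal g(S)-assignment of the whole
  matrix, and almost surely exactly one closed set with g(S) = r is reached, for every r between
  the smallest size of a cover and k.  Outside S the matrix has no zeros in the rows that remain,
  so by symmetry the one new column of the next optimal assignment is uniform among the columns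
  outside S, and the next closed set reached is the closure of S together with this column.  Hence
  the reached sets behave like an urn process, and a column c without zeros is used by the optimal
  k-assignment precisely as often as c is drawn while the drawn columns still form a partial
  (k-1)-cover.

  On the other hand, setting an exponential entry p to 0 lowers the expected minimum by the
  probability that p is used, since E min(X, t) = P(X < t).  Summed over the column c this expresses
  E(P) by the problems with one more zero, and the cover formula satisfies the same recursion.
  The recursion ends when there is no (k-1)-cover or when some row contains k zeros and can be
  deleted; if neither happens, Z has at most (k-1)^2 columns with zeros, so c exists.
*)
theory Submission
  imports Defs
begin

section \<open>Matchings\<close>

text \<open>The weight \<open>wt n j\<close> = j! (n-1-j)! / n! is the probability that, in a random
  order of n elements, j given ones come first and another given one follows. So the claimed sum
  adds a row weight times a column weight over all partial covers (R, C). A new zero (i, c) in a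
  zero-free column kills exactly the pairs with c outside C for which adding i to R leaves the
  partial covers. A random order of the rows contains exactly one such exit, so summing over i
  erases the rows and leaves the column urn. This is why both sides satisfy the same recursion.

  The obstacle is that zeros make optimal assignments non-unique: almost surely only their nonzero
  part is determined, and whether a column is used may depend on the choice. Closedness is a strict
  inequality, and its slack of one lets the added zeros miss any one prescribed column outside S.
  Hence almost surely the reached S consists of the columns common to all optimal assignments.

  The recursion never changes the number of columns, and deleting a row lowers k, so the bound on
  the columns is inherited.\<close>

definition matching :: "('r \<times> 'c) set \<Rightarrow> bool" where
  "matching S \<longleftrightarrow> inj_on fst S \<and> inj_on snd S"

text \<open>Arbitrary index sets allow rows to be deleted and the matrix to be transposed.\<close>

definition asgs :: "nat \<Rightarrow> 'r set \<Rightarrow> 'c set \<Rightarrow> ('r \<times> 'c) set set" where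
  "asgs k I J = {S. S \<subseteq> I \<times> J \<and> card S = k \<and> matching S}"

lemma matching_subset: "matching S \<Longrightarrow> T \<subseteq> S \<Longrightarrow> matching T"
  by (auto simp: matching_def intro: inj_on_subset)

lemma matching_row_unique: "matching S \<Longrightarrow> (i, c) \<in> S \<Longrightarrow> (i, d) \<in> S \<Longrightarrow> c = d"
  using inj_onD[of fst S "(i, c)" "(i, d)"] by (simp add: matching_def)

lemma matching_col_unique: "matching S \<Longrightarrow> (i, c) \<in> S \<Longrightarrow> (j, c) \<in> S \<Longrightarrow> i = j"
  using inj_onD[of snd S "(i, c)" "(j, c)"] by (simp add: matching_def)

lemma matching_Diff:
  assumes "matching S" "(i, c) \<in> S"
  shows "matching (S - {(i, c)})" "i \<notin> fst ` (S - {(i, c)})" "c \<notin> snd ` (S - {(i, c)})"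
proof -
  show "matching (S - {(i, c)})" using assms(1) by (rule matching_subset) auto
  show "i \<notin> fst ` (S - {(i, c)})" using matching_row_unique[OF assms(1) _ assms(2)] by force
  show "c \<notin> snd ` (S - {(i, c)})" using matching_col_unique[OF assms(1) _ assms(2)] by force
qed

lemma not_in_fst: "i \<notin> fst ` S \<Longrightarrow> (i, x) \<notin> S"
  by (auto simp: rev_image_eqI)

lemma matching_insert:
  "matching S \<Longrightarrow> i \<notin> fst ` S \<Longrightarrow> c \<notin> snd ` S \<Longrightarrow> matching (insert (i, c) S)"
  by (auto simp: matching_def)

lemma matching_Un:
  "matching S \<Longrightarrow> matching T \<Longrightarrow> fst ` S \<inter> fst ` T = {} \<Longrightarrow> snd ` S \<inter> snd ` T = {} \<Longrightarrow>
    matching (S \<union> T)"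
  unfolding matching_def inj_on_Un by blast

lemma matching_card: "matching S \<Longrightarrow> card (fst ` S) = card S" "matching S \<Longrightarrow> card (snd ` S) = card S"
  by (auto simp: matching_def card_image)

text \<open>Follow the alternating path of \<open>\<sigma>\<close> and \<open>\<tau>\<close> that starts in column \<open>c\<close> and swap its edges.
  It ends either in a column \<open>e\<close> that only \<open>\<sigma>\<close> uses or in a row that only \<open>\<tau>\<close> uses.\<close>

lemma matching_exchange:
  assumes "finite \<sigma>" "finite \<tau>" "matching \<sigma>" "matching \<tau>" "c \<in> snd ` \<tau>" "c \<notin> snd ` \<sigma>"
  obtains \<sigma>' \<tau>' where "matching \<sigma>'" "matching \<tau>'" "\<sigma>' \<union> \<tau>' = \<sigma> \<union> \<tau>" "\<sigma>' \<inter> \<tau>' = \<sigma> \<inter> \<tau>"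
    "snd ` \<sigma>' = insert c (snd ` \<sigma>) \<and> snd ` \<tau>' = snd ` \<tau> - {c} \<or>
     (\<exists>e. e \<in> snd ` \<sigma> \<and> e \<notin> snd ` \<tau> \<and> snd ` \<sigma>' = insert c (snd ` \<sigma> - {e}) \<and>
          snd ` \<tau>' = insert e (snd ` \<tau> - {c}))"
proof -
  have "\<exists>\<sigma>' \<tau>'. matching \<sigma>' \<and> matching \<tau>' \<and> \<sigma>' \<union> \<tau>' = \<sigma> \<union> \<tau> \<and> \<sigma>' \<inter> \<tau>' = \<sigma> \<inter> \<tau> \<and>
    (snd ` \<sigma>' = insert c (snd ` \<sigma>) \<and> snd ` \<tau>' = snd ` \<tau> - {c} \<or>
     (\<exists>e. e \<in> snd ` \<sigma> \<and> e \<notin> snd ` \<tau> \<and> snd ` \<sigma>' = insert c (snd ` \<sigma> - {e}) \<and>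
          snd ` \<tau>' = insert e (snd ` \<tau> - {c})))"
    using assms
  proof (induction "card \<sigma>" arbitrary: \<sigma> \<tau> c rule: less_induct)
    case less
    from less.prems obtain i where ic: "(i, c) \<in> \<tau>" by auto
    define \<tau>1 where "\<tau>1 = \<tau> - {(i, c)}"
    have \<tau>: "\<tau> = insert (i, c) \<tau>1" using ic by (auto simp: \<tau>1_def)
    have m\<tau>1: "matching \<tau>1" and i\<tau>1: "i \<notin> fst ` \<tau>1" and c\<tau>1: "c \<notin> snd ` \<tau>1"
      using matching_Diff[OF less.prems(4) ic] unfolding \<tau>1_def by blast+
    have sndt: "snd ` \<tau>1 = snd ` \<tau> - {c}" using c\<tau>1 \<tau> by auto
    show ?case
    proof (cases "i \<in> fst ` \<sigma>")
      case False
      have "matching (insert (i, c) \<sigma>)" using less.prems False by (intro matching_insert) auto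
      moreover have "insert (i, c) \<sigma> \<inter> \<tau>1 = \<sigma> \<inter> \<tau>"
        using not_in_fst[OF False] not_in_fst[OF i\<tau>1] \<tau> by auto
      moreover have "insert (i, c) \<sigma> \<union> \<tau>1 = \<sigma> \<union> \<tau>" using \<tau> by blast
      moreover have "snd ` insert (i, c) \<sigma> = insert c (snd ` \<sigma>)" by simp
      ultimately show ?thesis using m\<tau>1 sndt by blast
    next
      case True
      then obtain d where id: "(i, d) \<in> \<sigma>" by auto
      define \<sigma>1 where "\<sigma>1 = \<sigma> - {(i, d)}"
      have \<sigma>: "\<sigma> = insert (i, d) \<sigma>1" using id by (auto simp: \<sigma>1_def)
      have m\<sigma>1: "matching \<sigma>1" and i\<sigma>1: "i \<notin> fst ` \<sigma>1" and d\<sigma>1: "d \<notin> snd ` \<sigma>1"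
        using matching_Diff[OF less.prems(3) id] unfolding \<sigma>1_def by blast+
      have snds: "snd ` \<sigma>1 = snd ` \<sigma> - {d}" using d\<sigma>1 \<sigma> by auto
      have cd: "c \<noteq> d" using less.prems(6) id by (auto simp: image_iff)
      have c\<sigma>1: "c \<notin> snd ` \<sigma>1" using less.prems(6) snds by auto
      have int: "\<sigma> \<inter> \<tau> = \<sigma>1 \<inter> \<tau>1" using not_in_fst[OF i\<tau>1] not_in_fst[OF i\<sigma>1] cd \<sigma> \<tau> by auto
      show ?thesis
      proof (cases "d \<in> snd ` \<tau>")
        case False
        have d\<tau>1: "d \<notin> snd ` \<tau>1" using False sndt by auto
        show ?thesis
        proof (intro exI conjI disjI2)
          show "matching (insert (i, c) \<sigma>1)" "matching (insert (i, d) \<tau>1)"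
            using m\<sigma>1 m\<tau>1 i\<sigma>1 i\<tau>1 c\<sigma>1 d\<tau>1 by (auto intro!: matching_insert)
          show "insert (i, c) \<sigma>1 \<union> insert (i, d) \<tau>1 = \<sigma> \<union> \<tau>" using \<sigma> \<tau> by auto
          show "insert (i, c) \<sigma>1 \<inter> insert (i, d) \<tau>1 = \<sigma> \<inter> \<tau>"
            unfolding int using cd not_in_fst[OF i\<sigma>1] not_in_fst[OF i\<tau>1] by auto
          show "d \<in> snd ` \<sigma>" using rev_image_eqI[OF id, of d snd] by simp
          show "d \<notin> snd ` \<tau>" by fact
          show "snd ` insert (i, c) \<sigma>1 = insert c (snd ` \<sigma> - {d})"
            "snd ` insert (i, d) \<tau>1 = insert d (snd ` \<tau> - {c})"
            using snds sndt by simp_all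
        qed
      next
        case True
        have d\<tau>1: "d \<in> snd ` \<tau>1" using True cd sndt by auto
        have card: "card \<sigma>1 < card \<sigma>"
          using less.prems(1) id unfolding \<sigma>1_def by (intro card_Diff1_less) auto
        have fin: "finite \<sigma>1" "finite \<tau>1" using less.prems by (auto simp: \<sigma>1_def \<tau>1_def)
        \<comment> \<open>With both edges of row \<open>i\<close> removed, column \<open>d\<close>
          is used by \<tau>1 but not by \<sigma>1, so the rest of the path starts at
          \<open>d\<close>.\<close>
        from less.hyps[OF card fin m\<sigma>1 m\<tau>1 d\<tau>1 d\<sigma>1] obtain \<sigma>' \<tau>' where IH: "matching \<sigma>'" "matching \<tau>'" "\<sigma>' \<union> \<tau>' = \<sigma>1 \<union> \<tau>1"
          "\<sigma>' \<inter> \<tau>' = \<sigma>1 \<inter> \<tau>1"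
          "snd ` \<sigma>' = insert d (snd ` \<sigma>1) \<and> snd ` \<tau>' = snd ` \<tau>1 - {d} \<or>
           (\<exists>e. e \<in> snd ` \<sigma>1 \<and> e \<notin> snd ` \<tau>1 \<and> snd ` \<sigma>' = insert d (snd ` \<sigma>1 - {e}) \<and>
             snd ` \<tau>' = insert e (snd ` \<tau>1 - {d}))"
          by (elim exE conjE) (rule that)
        have "fst ` \<sigma>' \<union> fst ` \<tau>' = fst ` \<sigma>1 \<union> fst ` \<tau>1" "snd ` \<sigma>' \<union> snd ` \<tau>' = snd ` \<sigma>1 \<union> snd ` \<tau>1"
          using IH(3) by (metis image_Un)+
        then have i': "i \<notin> fst ` \<sigma>'" "i \<notin> fst ` \<tau>'" and c': "c \<notin> snd ` \<sigma>'" "c \<notin> snd ` \<tau>'"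
          using i\<sigma>1 i\<tau>1 c\<sigma>1 c\<tau>1 by blast+
        have d': "d \<notin> snd ` \<tau>'" using IH(5) d\<sigma>1 by auto
        show ?thesis
        proof (intro exI conjI)
          show "matching (insert (i, c) \<sigma>')" "matching (insert (i, d) \<tau>')"
            using IH i' c' d' by (auto intro!: matching_insert)
          show "insert (i, c) \<sigma>' \<union> insert (i, d) \<tau>' = \<sigma> \<union> \<tau>"
            unfolding \<sigma> \<tau> using IH(3) by blast
          show "insert (i, c) \<sigma>' \<inter> insert (i, d) \<tau>' = \<sigma> \<inter> \<tau>"
            unfolding int IH(4)[symmetric]
            using cd not_in_fst[OF i'(1)] not_in_fst[OF i'(2)] by auto
          show "snd ` insert (i, c) \<sigma>' = insert c (snd ` \<sigma>) \<and>
                snd ` insert (i, d) \<tau>' = snd ` \<tau> - {c} \<or>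
              (\<exists>e. e \<in> snd ` \<sigma> \<and> e \<notin> snd ` \<tau> \<and> snd ` insert (i, c) \<sigma>' = insert c (snd ` \<sigma> - {e}) \<and>
                snd ` insert (i, d) \<tau>' = insert e (snd ` \<tau> - {c}))"
            using IH(5)
          proof
            assume "snd ` \<sigma>' = insert d (snd ` \<sigma>1) \<and> snd ` \<tau>' = snd ` \<tau>1 - {d}"
            moreover have "insert c (snd ` \<sigma>) = insert c (insert d (snd ` \<sigma>1))"
              unfolding \<sigma> by simp
            moreover have "snd ` \<tau> - {c} = insert d (snd ` \<tau>1 - {d})"
              using sndt insert_Diff[OF d\<tau>1] by simp
            ultimately show ?thesis by (intro disjI1) simp
          next
            assume "\<exists>e. e \<in> snd ` \<sigma>1 \<and> e \<notin> snd ` \<tau>1 \<and> snd ` \<sigma>' = insert d (snd ` \<sigma>1 - {e}) \<and>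
               snd ` \<tau>' = insert e (snd ` \<tau>1 - {d})"
            then obtain e where e: "e \<in> snd ` \<sigma>1" "e \<notin> snd ` \<tau>1" "snd ` \<sigma>' = insert d (snd ` \<sigma>1 - {e})"
               "snd ` \<tau>' = insert e (snd ` \<tau>1 - {d})" by blast
            have ne: "e \<noteq> c" "e \<noteq> d" using e c\<sigma>1 d\<sigma>1 by auto
            have "snd ` \<sigma> = insert d (snd ` \<sigma>1)" using \<sigma> by simp
            then have a: "e \<in> snd ` \<sigma>" "snd ` insert (i, c) \<sigma>' = insert c (snd ` \<sigma> - {e})"
              using e ne by auto
            have "snd ` \<tau> = insert c (snd ` \<tau>1)" using \<tau> by simp
            then have b: "e \<notin> snd ` \<tau>" "snd ` insert (i, d) \<tau>' = insert e (snd ` \<tau> - {c})"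
              using e(2,4) ne c\<tau>1 d\<tau>1 by auto
            show ?thesis by (intro disjI2 exI[of _ e] conjI a b)
          qed
        qed
      qed
    qed
  qed
  then show thesis by (elim exE conjE) (rule that)
qed

text \<open>Induction on the number of indices: either some proper nonempty subset is tight and the
  problem splits there, or every such subset has a spare neighbour and one value can be given away
  freely. It is applied to rows choosing columns and to columns choosing rows.\<close>

theorem hall:
  fixes N :: "'a \<Rightarrow> 'b set"
  assumes "finite I" "\<And>i. i \<in> I \<Longrightarrow> finite (N i)" "\<And>X. X \<subseteq> I \<Longrightarrow> card X \<le> card (\<Union>i\<in>X. N i)"
  shows "\<exists>f. inj_on f I \<and> (\<forall>i\<in>I. f i \<in> N i)"
  using assms
proof (induction "card I" arbitrary: I N rule: less_induct)
  case less
  note fin = \<open>finite I\<close> less.prems(2) and hall = less.prems(3)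
  have finU: "finite (\<Union>i\<in>X. N i)" if "X \<subseteq> I" for X
    using fin that by (auto intro: finite_subset)
  consider "I = {}" | X where "X \<noteq> {}" "X \<subset> I" "card (\<Union>i\<in>X. N i) = card X"
    | "I \<noteq> {}" "\<And>X. X \<noteq> {} \<Longrightarrow> X \<subset> I \<Longrightarrow> card X < card (\<Union>i\<in>X. N i)"
    using hall by (metis le_neq_implies_less psubset_imp_subset)
  then show ?case
  proof cases
    case 1
    then show ?thesis by simp
  next
    case 2
    have finX: "finite X" using 2 fin by (auto intro: finite_subset)
    have "\<exists>f. inj_on f X \<and> (\<forall>i\<in>X. f i \<in> N i)"
    proof (rule less.hyps)
      show "card X < card I" using fin(1) 2(2) by (rule psubset_card_mono)
      show "card Y \<le> card (\<Union>i\<in>Y. N i)" if "Y \<subseteq> X" for Y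
        using that 2(2) by (intro hall) auto
    qed (use finX fin(2) 2(2) in auto)
    then obtain f where f: "inj_on f X" "\<And>i. i \<in> X \<Longrightarrow> f i \<in> N i" by blast
    \<comment> \<open>Hall's condition survives off the tight set: for \<open>Y\<close> outside
      \<open>X\<close>, the neighbours of \<open>X\<close> account for only \<open>card X\<close> of
      those of the union, so at least \<open>card Y\<close> are new.\<close>
    define N' where "N' i = N i - (\<Union>i\<in>X. N i)" for i
    have "card Y \<le> card (\<Union>i\<in>Y. N' i)" if "Y \<subseteq> I - X" for Y
    proof -
      have finY: "finite Y" using that fin by (auto intro: finite_subset)
      have "card X + card Y = card (X \<union> Y)" using that finX finY by (subst card_Un_disjoint) auto
      also have "\<dots> \<le> card (\<Union>i\<in>X \<union> Y. N i)" using that 2 by (intro hall) auto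
      also have "(\<Union>i\<in>X \<union> Y. N i) = (\<Union>i\<in>X. N i) \<union> (\<Union>i\<in>Y. N' i)" by (auto simp: N'_def)
      also have "card \<dots> \<le> card (\<Union>i\<in>X. N i) + card (\<Union>i\<in>Y. N' i)" by (rule card_Un_le)
      finally show ?thesis using 2 by simp
    qed
    moreover have "card (I - X) < card I"
      using 2 fin by (intro psubset_card_mono) auto
    moreover have "finite (N' i)" if "i \<in> I - X" for i using fin that by (auto simp: N'_def)
    ultimately obtain h where h: "inj_on h (I - X)" "\<And>i. i \<in> I - X \<Longrightarrow> h i \<in> N' i"
      using less.hyps[of "I - X" N'] fin by blast
    have "f i \<noteq> h j" if "i \<in> X" "j \<in> I - X" for i j
      using f(2)[OF that(1)] h(2)[OF that(2)] that by (auto simp: N'_def)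
    then have "inj_on (\<lambda>i. if i \<in> X then f i else h i) I"
      using f(1) h(1) unfolding inj_on_def by (metis DiffI)
    then show ?thesis
      using f h 2 by (intro exI[of _ "\<lambda>i. if i \<in> X then f i else h i"]) (auto simp: N'_def)
  next
    case 3
    then obtain j where j: "j \<in> I" by auto
    have "N j \<noteq> {}" using hall[of "{j}"] j by auto
    then obtain y where y: "y \<in> N j" by auto
    \<comment> \<open>Giving \<open>y\<close> to \<open>j\<close> costs each remaining nonempty
      subset at most the one neighbour it has to spare.\<close>
    define N' where "N' i = N i - {y}" for i
    have "card Y \<le> card (\<Union>i\<in>Y. N' i)" if "Y \<subseteq> I - {j}" for Y
    proof (cases "Y = {}")
      case False
      have "card Y < card (\<Union>i\<in>Y. N i)" using that j False by (intro 3) auto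
      moreover have "(\<Union>i\<in>Y. N' i) = (\<Union>i\<in>Y. N i) - {y}" by (auto simp: N'_def)
      ultimately show ?thesis using finU[of Y] that by (auto simp: card_Diff_singleton_if)
    qed auto
    moreover have "card (I - {j}) < card I" using j fin by (metis card_Diff1_less)
    moreover have "finite (N' i)" if "i \<in> I - {j}" for i using fin that by (auto simp: N'_def)
    ultimately obtain h where h: "inj_on h (I - {j})" "\<And>i. i \<in> I - {j} \<Longrightarrow> h i \<in> N' i"
      using less.hyps[of "I - {j}" N'] fin by blast
    have "h i \<noteq> y" if "i \<in> I - {j}" for i using h(2)[OF that] by (auto simp: N'_def)
    then have "inj_on (h(j := y)) I" using h(1) unfolding inj_on_def by auto
    then show ?thesis
      using h y by (intro exI[of _ "h(j := y)"]) (auto simp: N'_def)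
  qed
qed

section \<open>Optimal assignments and closed sets of columns\<close>

lemma finite_asgs: "finite I \<Longrightarrow> finite J \<Longrightarrow> finite (asgs k I J)"
  by (rule finite_subset[of _ "Pow (I \<times> J)"]) (auto simp: asgs_def)

lemma asgs_finite: "finite I \<Longrightarrow> finite J \<Longrightarrow> S \<in> asgs k I J \<Longrightarrow> finite S"
  by (auto simp: asgs_def intro: finite_subset)

text \<open>Existential because optimal assignments need not be unique; the chain of column sets is
  all that is followed later.\<close>

definition opt_cols ::
    "nat \<Rightarrow> 'r set \<Rightarrow> 'c set \<Rightarrow> ('r \<times> 'c \<Rightarrow> real) \<Rightarrow> 'c set \<Rightarrow> bool" where
  "opt_cols k I J a T \<longleftrightarrow>
    (\<exists>\<sigma>\<in>asgs k I J. snd ` \<sigma> = T \<and> (\<forall>\<tau>\<in>asgs k I J. sum a \<sigma> \<le> sum a \<tau>))"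

lemma ex_opt:
  fixes a :: "'r \<times> 'c \<Rightarrow> real"
  assumes "finite I" "finite J" "asgs k I J \<noteq> {}"
  obtains \<sigma> where "\<sigma> \<in> asgs k I J" "\<And>\<tau>. \<tau> \<in> asgs k I J \<Longrightarrow> sum a \<sigma> \<le> sum a \<tau>"
proof -
  have "Min (sum a ` asgs k I J) \<in> sum a ` asgs k I J"
    using assms by (intro Min_in) (auto simp: finite_asgs)
  then obtain \<sigma> where "\<sigma> \<in> asgs k I J" "sum a \<sigma> = Min (sum a ` asgs k I J)" by auto
  then show thesis using that finite_asgs[OF assms(1,2), of k] by auto
qed

text \<open>Optimal column sets can be nested. Exchanging along a path from a new column of an
  optimal (s+1)-assignment keeps the total cost. If the sizes get swapped, optimality of both parts
  makes the enlarged one optimal with columns \<open>insert c S\<close>. Otherwise the new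
  (s+1)-assignment is again optimal but shares one more column with \<open>S\<close>.\<close>

lemma opt_cols_step:
  fixes a :: "'r \<times> 'c \<Rightarrow> real"
  assumes fin: "finite I" "finite J" and S: "opt_cols s I J a S" and ne: "asgs (Suc s) I J \<noteq> {}"
  shows "\<exists>c\<in>J - S. opt_cols (Suc s) I J a (insert c S)"
proof -
  obtain \<kappa> where \<kappa>: "\<kappa> \<in> asgs s I J" "snd ` \<kappa> = S" "\<And>\<tau>. \<tau> \<in> asgs s I J \<Longrightarrow> sum a \<kappa> \<le> sum a \<tau>"
    using S by (auto simp: opt_cols_def)
  define Q where "Q = {\<tau> \<in> asgs (Suc s) I J. \<forall>\<tau>'\<in>asgs (Suc s) I J. sum a \<tau> \<le> sum a \<tau>'}"
  \<comment> \<open>Maximal overlap with \<open>S\<close> is what excludes the second outcome of the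
    exchange.\<close>
  define f where "f \<tau> = card (snd ` \<tau> \<inter> S)" for \<tau> :: "('r \<times> 'c) set"
  have "finite Q" unfolding Q_def using finite_asgs[OF fin] by simp
  moreover obtain \<tau>0 where "\<tau>0 \<in> asgs (Suc s) I J"
    "\<And>\<tau>. \<tau> \<in> asgs (Suc s) I J \<Longrightarrow> sum a \<tau>0 \<le> sum a \<tau>"
    using ex_opt[OF fin ne, of a] by blast
  then have "Q \<noteq> {}" unfolding Q_def by auto
  ultimately have "Max (f ` Q) \<in> f ` Q" "\<And>\<tau>. \<tau> \<in> Q \<Longrightarrow> f \<tau> \<le> Max (f ` Q)" by auto
  then obtain \<tau> where \<tau>: "\<tau> \<in> Q" and max: "\<And>\<tau>'. \<tau>' \<in> Q \<Longrightarrow> f \<tau>' \<le> f \<tau>" by auto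
  have m: "matching \<kappa>" "matching \<tau>" "card \<kappa> = s" "card \<tau> = Suc s" "\<tau> \<subseteq> I \<times> J" "\<kappa> \<subseteq> I \<times> J"
    using \<kappa>(1) \<tau> by (auto simp: asgs_def Q_def)
  have finS: "finite \<kappa>" "finite \<tau>"
    using finite_subset[OF m(6)] finite_subset[OF m(5)] fin by simp_all
  have "card (snd ` \<kappa>) < card (snd ` \<tau>)" using m by (simp add: matching_card)
  then have "\<not> snd ` \<tau> \<subseteq> snd ` \<kappa>" using finS by (meson card_mono finite_imageI leD)
  then obtain c where c: "c \<in> snd ` \<tau>" "c \<notin> snd ` \<kappa>" by auto
  then have cJ: "c \<in> J - S" using m \<kappa>(2) by auto
  obtain \<sigma>' \<tau>' where
    h: "matching \<sigma>'" "matching \<tau>'" "\<sigma>' \<union> \<tau>' = \<kappa> \<union> \<tau>" "\<sigma>' \<inter> \<tau>' = \<kappa> \<inter> \<tau>"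
    "snd ` \<sigma>' = insert c (snd ` \<kappa>) \<and> snd ` \<tau>' = snd ` \<tau> - {c} \<or>
     (\<exists>e. e \<in> snd ` \<kappa> \<and> e \<notin> snd ` \<tau> \<and> snd ` \<sigma>' = insert c (snd ` \<kappa> - {e}) \<and>
          snd ` \<tau>' = insert e (snd ` \<tau> - {c}))"
    by (rule matching_exchange[OF finS m(1,2) c])
  have "opt_cols (Suc s) I J a (insert c S)"
  proof -
    have sub: "\<sigma>' \<subseteq> I \<times> J" "\<tau>' \<subseteq> I \<times> J" using h(3) m by auto
    then have fin': "finite \<sigma>'" "finite \<tau>'" using fin by (meson finite_SigmaI finite_subset)+
    \<comment> \<open>Union and intersection are preserved by the exchange, hence so is the total
      cost.\<close>
    have sum: "sum a \<sigma>' + sum a \<tau>' = sum a \<kappa> + sum a \<tau>"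
      using sum.union_inter[OF fin', of a] sum.union_inter[OF finS, of a] h(3,4) by simp
    from h(5) show ?thesis
    proof
      assume A: "snd ` \<sigma>' = insert c (snd ` \<kappa>) \<and> snd ` \<tau>' = snd ` \<tau> - {c}"
      have "card \<sigma>' = Suc s" "card \<tau>' = s"
        using A c finS matching_card(2)[OF h(1)] matching_card(2)[OF h(2)] matching_card(2)[OF m(1)]
          matching_card(2)[OF m(2)] m(3,4) by (auto simp: card_Diff_singleton)
      then have "\<sigma>' \<in> asgs (Suc s) I J" "\<tau>' \<in> asgs s I J" using h sub by (auto simp: asgs_def)
      moreover from this have "sum a \<kappa> \<le> sum a \<tau>'" using \<kappa> by auto
      ultimately have "\<sigma>' \<in> Q" using \<tau> sum unfolding Q_def by fastforce
      then show ?thesis unfolding opt_cols_def Q_def using A \<kappa>(2) by auto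
    next
      assume "\<exists>e. e \<in> snd ` \<kappa> \<and> e \<notin> snd ` \<tau> \<and> snd ` \<sigma>' = insert c (snd ` \<kappa> - {e}) \<and>
          snd ` \<tau>' = insert e (snd ` \<tau> - {c})"
      then obtain e where e: "e \<in> snd ` \<kappa>" "e \<notin> snd ` \<tau>" "snd ` \<sigma>' = insert c (snd ` \<kappa> - {e})"
        "snd ` \<tau>' = insert e (snd ` \<tau> - {c})" by blast
      have "card (snd ` \<sigma>') = card (snd ` \<kappa>)" "card (snd ` \<tau>') = card (snd ` \<tau>)"
        unfolding e(3,4) using e(1,2) c finS
        by (simp_all del: card_Diff_insert add: card.insert_remove card_Suc_Diff1)
      then have "\<sigma>' \<in> asgs s I J" "\<tau>' \<in> asgs (Suc s) I J"
        using h(1,2) m sub by (auto simp: asgs_def matching_card)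
      moreover from this have "sum a \<kappa> \<le> sum a \<sigma>'" using \<kappa> by auto
      ultimately have "\<tau>' \<in> Q" using \<tau> sum unfolding Q_def by fastforce
      have "f \<tau>' = Suc (f \<tau>)"
      proof -
        have "snd ` \<tau>' \<inter> S = insert e (snd ` \<tau> \<inter> S)"
          using e(1) c(2) unfolding e(4) \<kappa>(2)[symmetric] by blast
        then show ?thesis using e finS by (simp add: f_def)
      qed
      then show ?thesis using max[OF \<open>\<tau>' \<in> Q\<close>] by simp
    qed
  qed
  then show ?thesis using cJ by blast
qed

text \<open>A competitor has at most \<open>card (R - R')\<close> entries in rows of
  \<open>R\<close>, so at least \<open>q\<close> of its entries avoid \<open>R\<close>, and these
  already cost as much as \<sigma>. The entries of \<zeta> add rows without adding cost.\<close>

lemma opt_cols_extend: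
  fixes a :: "'r \<times> 'c \<Rightarrow> real"
  assumes fin: "finite I" "finite J" and nn: "\<And>p. p \<in> I \<times> J \<Longrightarrow> 0 \<le> a p"
    and \<sigma>: "\<sigma> \<in> asgs q (I - R) J" "\<And>\<tau>. \<tau> \<in> asgs q (I - R) J \<Longrightarrow> sum a \<sigma> \<le> sum a \<tau>"
    and R: "R' \<subseteq> R" "R \<subseteq> I"
    and \<zeta>: "\<zeta> \<subseteq> R \<times> J" "matching \<zeta>" "sum a \<zeta> = 0" "snd ` \<zeta> \<inter> snd ` \<sigma> = {}" "fst ` \<zeta> = R - R'"
  shows "\<sigma> \<union> \<zeta> \<in> asgs (q + card \<zeta>) (I - R') J"
    "\<And>\<tau>. \<tau> \<in> asgs (q + card \<zeta>) (I - R') J \<Longrightarrow> sum a (\<sigma> \<union> \<zeta>) \<le> sum a \<tau>"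
proof -
  have fs: "finite \<sigma>" using \<sigma>(1) fin by (auto simp: asgs_def intro: finite_subset)
  have fz: "finite \<zeta>" using \<zeta>(1) R fin by (meson finite_SigmaI finite_subset)
  have disj: "\<sigma> \<inter> \<zeta> = {}" using \<sigma>(1) \<zeta>(1) by (auto simp: asgs_def)
  have "fst ` \<sigma> \<inter> fst ` \<zeta> = {}" using \<sigma>(1) \<zeta>(1) by (auto simp: asgs_def)
  then have "matching (\<sigma> \<union> \<zeta>)" using \<sigma>(1) \<zeta> by (intro matching_Un) (auto simp: asgs_def)
  moreover have "\<zeta> \<subseteq> (I - R') \<times> J"
  proof
    fix p assume p: "p \<in> \<zeta>"
    then have "fst p \<in> R - R'" using \<zeta>(5) by blast
    then show "p \<in> (I - R') \<times> J" using \<zeta>(1) R p by (auto simp: mem_Times_iff)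
  qed
  moreover have "\<sigma> \<subseteq> (I - R') \<times> J" using \<sigma>(1) R by (auto simp: asgs_def)
  moreover have "card (\<sigma> \<union> \<zeta>) = q + card \<zeta>"
    using disj fs fz \<sigma>(1) by (simp add: card_Un_disjoint asgs_def)
  ultimately show "\<sigma> \<union> \<zeta> \<in> asgs (q + card \<zeta>) (I - R') J" by (auto simp: asgs_def)
  fix \<tau> assume \<tau>: "\<tau> \<in> asgs (q + card \<zeta>) (I - R') J"
  have ft: "finite \<tau>" using \<tau> fin by (auto simp: asgs_def intro: finite_subset)
  define \<tau>0 where "\<tau>0 = {p \<in> \<tau>. fst p \<notin> R}"
  have "matching (\<tau> - \<tau>0)" using \<tau> by (auto simp: asgs_def intro: matching_subset)
  then have "card (\<tau> - \<tau>0) = card (fst ` (\<tau> - \<tau>0))" by (simp only: matching_card)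
  also have "\<dots> \<le> card (R - R')"
    using \<tau> R fin by (intro card_mono) (auto simp: \<tau>0_def asgs_def intro: finite_subset)
  also have "\<dots> = card \<zeta>" using matching_card(1)[OF \<zeta>(2)] \<zeta>(5) by simp
  finally have "q \<le> card \<tau>0"
    using \<tau> ft card_Diff_subset[of \<tau>0 \<tau>] card_mono[of \<tau> \<tau>0] by (auto simp: \<tau>0_def asgs_def)
  then obtain \<tau>1 where \<tau>1: "\<tau>1 \<subseteq> \<tau>0" "card \<tau>1 = q" by (meson obtain_subset_with_card_n)
  then have sub: "\<tau>1 \<subseteq> \<tau>" by (auto simp: \<tau>0_def)
  have "\<tau>1 \<in> asgs q (I - R) J"
    using \<tau>1 \<tau> R by (auto simp: \<tau>0_def asgs_def intro: matching_subset)
  then have "sum a \<sigma> \<le> sum a \<tau>1" by (rule \<sigma>(2))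
  also have "\<dots> \<le> sum a \<tau>" using sub ft \<tau> nn by (intro sum_mono2) (auto simp: asgs_def)
  finally show "sum a (\<sigma> \<union> \<zeta>) \<le> sum a \<tau>" using disj fs fz \<zeta>(3) by (simp add: sum.union_disjoint)
qed

section \<open>Covers with prescribed columns, closed sets and zero matchings\<close>

definition rows_out :: "('r \<times> 'c) set \<Rightarrow> 'c set \<Rightarrow> 'r set" where
  "rows_out Z S = {i. \<exists>c. (i, c) \<in> Z \<and> c \<notin> S}"

text \<open>The size of the smallest cover of \<open>Z\<close> whose set of columns is \<open>S\<close>.\<close>

definition csize :: "('r \<times> 'c) set \<Rightarrow> 'c set \<Rightarrow> nat" where
  "csize Z S = card S + card (rows_out Z S)"

lemma finite_rows_out [simp]: "finite Z \<Longrightarrow> finite (rows_out Z S)"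
  by (rule finite_subset[of _ "fst ` Z"]) (auto simp: rows_out_def rev_image_eqI)

lemma rows_out_subset: "Z \<subseteq> I \<times> J \<Longrightarrow> rows_out Z S \<subseteq> I"
  by (auto simp: rows_out_def)

text \<open>Rows missed by an intersection are those missed by either set, and rows missed by the
  union are missed by both; the rest is inclusion-exclusion. This later shows that joining a closure
  to a partial cover keeps it a partial cover.\<close>

lemma csize_submodular:
  assumes "finite Z" "finite S" "finite T"
  shows "csize Z (S \<union> T) + csize Z (S \<inter> T) \<le> csize Z S + csize Z T"
proof -
  have "card (rows_out Z (S \<union> T)) \<le> card (rows_out Z S \<inter> rows_out Z T)"
    using assms by (intro card_mono finite_Int) (simp, auto simp: rows_out_def)
  moreover have "rows_out Z (S \<inter> T) = rows_out Z S \<union> rows_out Z T" by (auto simp: rows_out_def)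
  ultimately show ?thesis
    using card_Un_Int[of S T] card_Un_Int[of "rows_out Z S" "rows_out Z T"] assms
    by (simp add: csize_def)
qed

lemma csize_insert_le:
  assumes "finite Z" "finite S"
  shows "csize Z (insert c S) \<le> Suc (csize Z S)"
proof -
  have "card (rows_out Z (insert c S)) \<le> card (rows_out Z S)"
    using assms by (intro card_mono) (simp, auto simp: rows_out_def)
  then show ?thesis using assms by (simp add: csize_def card_insert_if)
qed

definition closed_cols :: "('r \<times> 'c) set \<Rightarrow> 'c set \<Rightarrow> 'c set \<Rightarrow> bool" where
  "closed_cols Z J S \<longleftrightarrow> S \<subseteq> J \<and> (\<forall>T. S \<subset> T \<and> T \<subseteq> J \<longrightarrow> csize Z S < csize Z T)"

text \<open>The minimum of \<open>csize\<close> over supersets of \<open>C\<close> behaves like a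
  matroid rank up to a constant; \<open>S\<close> is a minimiser that cannot be enlarged, the
  analogue of the flat spanned by \<open>C\<close>.\<close>

definition is_clos :: "('r \<times> 'c) set \<Rightarrow> 'c set \<Rightarrow> 'c set \<Rightarrow> 'c set \<Rightarrow> bool" where
  "is_clos Z J C S \<longleftrightarrow> closed_cols Z J S \<and> C \<subseteq> S \<and> (\<forall>T. C \<subseteq> T \<and> T \<subseteq> J \<longrightarrow> csize Z S \<le> csize Z T)"

text \<open>Among the supersets of least \<open>csize\<close> take one maximal under inclusion:
  anything larger has strictly larger \<open>csize\<close>.\<close>

lemma ex_clos:
  assumes "finite J" "C \<subseteq> J"
  shows "\<exists>S. is_clos Z J C S"
proof -
  define F where "F = {S. C \<subseteq> S \<and> S \<subseteq> J}"
  have "finite F" using assms(1) by (auto simp: F_def)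
  have "C \<in> F" using assms by (auto simp: F_def)
  define m where "m = Min (csize Z ` F)"
  define F' where "F' = {S \<in> F. csize Z S = m}"
  have m: "m \<in> csize Z ` F" unfolding m_def using \<open>finite F\<close> \<open>C \<in> F\<close> by (intro Min_in) auto
  have le: "m \<le> csize Z S" if "S \<in> F" for S unfolding m_def using \<open>finite F\<close> that by auto
  have "finite F'" "F' \<noteq> {}" using m \<open>finite F\<close> by (auto simp: F'_def)
  then obtain S where S: "S \<in> F'" "\<And>T. T \<in> F' \<Longrightarrow> S \<subseteq> T \<Longrightarrow> S = T"
    using finite_has_maximal[of F'] by auto
  have "csize Z S < csize Z T" if "S \<subset> T" "T \<subseteq> J" for T
  proof -
    have "T \<in> F" "S \<in> F" "csize Z S = m" using S(1) that by (auto simp: F'_def F_def)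
    moreover have "csize Z T \<noteq> m" using S(2)[of T] that \<open>T \<in> F\<close> by (auto simp: F'_def)
    ultimately show ?thesis using le[of T] by simp
  qed
  then show ?thesis
    using S(1) le unfolding is_clos_def closed_cols_def F'_def F_def by (intro exI[of _ S]) auto
qed

text \<open>A fixed choice, so that the closed set following \<open>S\<close> is a function of the
  drawn column.\<close>

definition clos :: "('r \<times> 'c) set \<Rightarrow> 'c set \<Rightarrow> 'c set \<Rightarrow> 'c set" where
  "clos Z J C = (SOME S. is_clos Z J C S)"

lemma is_clos_clos: "finite J \<Longrightarrow> C \<subseteq> J \<Longrightarrow> is_clos Z J C (clos Z J C)"
  unfolding clos_def by (rule someI_ex) (rule ex_clos)

text \<open>A set \<open>X\<close> of uncovered rows could be replaced in the cover by its zero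
  columns outside \<open>S\<close>. Closedness makes this strictly worse even when one further
  column is thrown in, which is exactly the slack needed to forbid the column
  \<open>c\<close>.\<close>

lemma hall_rows:
  assumes fin: "finite I" "finite J" and Z: "Z \<subseteq> I \<times> J" and S: "closed_cols Z J S" and c: "c \<notin> S"
  obtains \<zeta> where "\<zeta> \<subseteq> Z" "matching \<zeta>" "fst ` \<zeta> = rows_out Z S" "snd ` \<zeta> \<inter> insert c S = {}"
proof (cases "J \<subseteq> S")
  case True
  then have "rows_out Z S = {}" using Z by (auto simp: rows_out_def)
  then show ?thesis using that[of "{}"] by (simp add: matching_def)
next
  case False
  \<comment> \<open>The forbidden column has to lie in \<open>J\<close> to produce a larger set of
    columns; if \<open>c\<close> is not in \<open>J\<close>, any column outside \<open>S\<close>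
    takes its place.\<close>
  define d where "d = (if c \<in> J then c else SOME d. d \<in> J - S)"
  have "(SOME d. d \<in> J - S) \<in> J - S" using False by (intro someI_ex[of "\<lambda>d. d \<in> J - S"]) auto
  then have d: "d \<in> J - S" using c unfolding d_def by auto
  have finZ: "finite Z" using fin Z by (meson finite_SigmaI finite_subset)
  define N where "N i = {e. (i, e) \<in> Z \<and> e \<notin> insert d S}" for i
  have SJ: "S \<subseteq> J" using S by (simp add: closed_cols_def)
  have finS: "finite S" using SJ fin by (auto intro: finite_subset)
  have NJ: "N i \<subseteq> J" for i using Z by (auto simp: N_def)
  have "card X \<le> card (\<Union>i\<in>X. N i)" if X: "X \<subseteq> rows_out Z S" for X
  proof -
    \<comment> \<open>This cover drops the rows \<open>X\<close> and pays for \<open>d\<close> and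
      the neighbours of \<open>X\<close>; being strictly larger than the cover of \<open>S\<close>,
      it has at least \<open>card X\<close> neighbours.\<close>
    let ?T = "insert d S \<union> (\<Union>i\<in>X. N i)"
    have finN: "finite (\<Union>i\<in>X. N i)" using NJ fin(2) by (intro finite_subset[OF _ fin(2)]) auto
    have "?T \<subseteq> J" using d SJ NJ by blast
    moreover have "S \<subset> ?T" using d by auto
    ultimately have "csize Z S < csize Z ?T" using S by (simp add: closed_cols_def)
    moreover have "rows_out Z ?T \<subseteq> rows_out Z S - X" by (auto simp: rows_out_def N_def)
    then have "card (rows_out Z ?T) \<le> card (rows_out Z S - X)" using finZ by (intro card_mono) simp_all
    moreover have "card ?T \<le> Suc (card S) + card (\<Union>i\<in>X. N i)"
      using card_Un_le[of "insert d S" "\<Union>i\<in>X. N i"] finS d by simp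
    moreover have "card (rows_out Z S - X) = card (rows_out Z S) - card X" "card X \<le> card (rows_out Z S)"
      using card_Diff_subset[OF finite_subset[OF X] X] card_mono[OF _ X] finZ by simp_all
    ultimately show ?thesis by (simp add: csize_def)
  qed
  moreover have "finite (N i)" for i using NJ fin by (meson finite_subset)
  ultimately obtain f where f: "inj_on f (rows_out Z S)" "\<And>i. i \<in> rows_out Z S \<Longrightarrow> f i \<in> N i"
    using hall[of "rows_out Z S" N] finZ by auto
  define \<zeta> where "\<zeta> = (\<lambda>i. (i, f i)) ` rows_out Z S"
  have "\<zeta> \<subseteq> Z" using f(2) by (auto simp: \<zeta>_def N_def)
  moreover have "matching \<zeta>" using f(1) by (auto simp: \<zeta>_def matching_def inj_on_def)
  moreover have "fst ` \<zeta> = rows_out Z S" by (simp add: \<zeta>_def image_image)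
  moreover have "f i \<notin> insert d S" if "i \<in> rows_out Z S" for i
    using f(2)[OF that] by (simp add: N_def)
  then have "snd ` \<zeta> \<inter> insert d S = {}" unfolding \<zeta>_def by fastforce
  moreover have "c \<notin> snd ` \<zeta>" using calculation(1,4) Z by (auto simp: d_def split: if_splits)
  ultimately show ?thesis using that by auto
qed

text \<open>The dual use of Hall's theorem: removing columns \<open>X\<close> from \<open>S\<close>,
  but none of \<open>C\<close>, cannot lower \<open>csize\<close>, so it uncovers at least
  \<open>card X\<close> rows, each through a zero in \<open>X\<close>.\<close>

lemma hall_cols:
  assumes fin: "finite I" "finite J" and Z: "Z \<subseteq> I \<times> J" and S: "is_clos Z J C S"
  obtains \<zeta> where "\<zeta> \<subseteq> Z" "matching \<zeta>" "snd ` \<zeta> = S - C" "fst ` \<zeta> \<subseteq> rows_out Z C - rows_out Z S"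
proof -
  have finZ: "finite Z" using fin Z by (meson finite_SigmaI finite_subset)
  have CS: "C \<subseteq> S" and SJ: "S \<subseteq> J" using S by (auto simp: is_clos_def closed_cols_def)
  have finS: "finite S" using SJ fin by (auto intro: finite_subset)
  define N where "N d = {i. (i, d) \<in> Z \<and> i \<notin> rows_out Z S}" for d
  have NI: "N d \<subseteq> I" for d using Z by (auto simp: N_def)
  have "card X \<le> card (\<Union>d\<in>X. N d)" if X: "X \<subseteq> S - C" for X
  proof -
    have "C \<subseteq> S - X" "S - X \<subseteq> J" using X SJ CS by auto
    then have "csize Z S \<le> csize Z (S - X)" using S by (simp add: is_clos_def)
    moreover have "rows_out Z (S - X) \<subseteq> rows_out Z S \<union> (\<Union>d\<in>X. N d)" by (auto simp: rows_out_def N_def)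
    then have "card (rows_out Z (S - X)) \<le> card (rows_out Z S \<union> (\<Union>d\<in>X. N d))"
      using finZ finite_subset[OF UN_least fin(1), of X N] NI by (intro card_mono) auto
    moreover have "\<dots> \<le> card (rows_out Z S) + card (\<Union>d\<in>X. N d)" by (rule card_Un_le)
    moreover have XS: "X \<subseteq> S" using X by auto
    have "card (S - X) = card S - card X" "card X \<le> card S"
      using card_Diff_subset[OF finite_subset[OF XS finS] XS] card_mono[OF finS XS] by simp_all
    ultimately show ?thesis by (simp add: csize_def)
  qed
  moreover have "finite (N d)" for d using NI fin by (meson finite_subset)
  ultimately obtain f where f: "inj_on f (S - C)" "\<And>d. d \<in> S - C \<Longrightarrow> f d \<in> N d"
    using hall[of "S - C" N] finS by auto
  define \<zeta> where "\<zeta> = (\<lambda>d. (f d, d)) ` (S - C)"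
  have "\<zeta> \<subseteq> Z" using f(2) by (auto simp: \<zeta>_def N_def)
  moreover have "matching \<zeta>" using f(1) by (auto simp: \<zeta>_def matching_def inj_on_def)
  moreover have "snd ` \<zeta> = S - C" by (simp add: \<zeta>_def image_image)
  moreover have "fst ` \<zeta> \<subseteq> rows_out Z C - rows_out Z S"
    using f(2) by (auto simp: \<zeta>_def N_def) (auto simp: rows_out_def)
  ultimately show ?thesis by (rule that)
qed

definition is_opt :: "nat \<Rightarrow> 'r set \<Rightarrow> 'c set \<Rightarrow> ('r \<times> 'c \<Rightarrow> real) \<Rightarrow> ('r \<times> 'c) set \<Rightarrow> bool" where
  "is_opt k I J a \<sigma> \<longleftrightarrow> \<sigma> \<in> asgs k I J \<and> (\<forall>\<tau>\<in>asgs k I J. sum a \<sigma> \<le> sum a \<tau>)"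

text \<open>Zeros do not contribute to a sum, so equal sums can at best force equality outside
  \<open>Z\<close>.\<close>

definition generic :: "('r \<times> 'c) set \<Rightarrow> ('r \<times> 'c) set \<Rightarrow> ('r \<times> 'c \<Rightarrow> real) \<Rightarrow> bool" where
  "generic Z P a \<longleftrightarrow> (\<forall>\<sigma> \<tau>. \<sigma> \<subseteq> P \<and> \<tau> \<subseteq> P \<and> sum a \<sigma> = sum a \<tau> \<longrightarrow> \<sigma> - Z = \<tau> - Z)"

lemma is_opt_sum_eq: "is_opt k I J a \<sigma> \<Longrightarrow> is_opt k I J a \<tau> \<Longrightarrow> sum a \<sigma> = sum a \<tau>"
  unfolding is_opt_def by (meson order_antisym)

lemma generic_is_opt:
  assumes "generic Z (I \<times> J) a" "is_opt k I J a \<sigma>" "is_opt k I J a \<tau>"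
  shows "\<sigma> - Z = \<tau> - Z"
  using assms is_opt_sum_eq[OF assms(2,3)] unfolding generic_def is_opt_def asgs_def by blast

section \<open>Closed sets reached by a fixed cost matrix\<close>

locale zero_pattern =
  fixes I :: "'r set" and J :: "'c set" and Z :: "('r \<times> 'c) set"
  assumes finI: "finite I" and finJ: "finite J" and Z: "Z \<subseteq> I \<times> J"
begin

lemma finZ [simp]: "finite Z"
  using Z finI finJ by (meson finite_SigmaI finite_subset)

lemma finite_cols: "S \<subseteq> J \<Longrightarrow> finite S"
  using finJ by (rule finite_subset[rotated])

definition stage :: "('r \<times> 'c \<Rightarrow> real) \<Rightarrow> 'c set \<Rightarrow> bool" where
  "stage a S \<longleftrightarrow> opt_cols (card S) (I - rows_out Z S) J a S"

lemma closD:
  assumes "is_clos Z J C S"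
  shows "closed_cols Z J S" "C \<subseteq> S" "S \<subseteq> J" "finite S"
  using assms finite_cols by (auto simp: is_clos_def closed_cols_def)

lemma clos_le: "is_clos Z J C S \<Longrightarrow> C \<subseteq> T \<Longrightarrow> T \<subseteq> J \<Longrightarrow> csize Z S \<le> csize Z T"
  by (simp add: is_clos_def)

text \<open>Dropping a column without zeros uncovers no row and saves one column, against the
  minimality of the closure.\<close>

lemma clos_zero_free:
  assumes S: "is_clos Z J C S" and c: "c \<notin> snd ` Z" "c \<notin> C"
  shows "c \<notin> S"
proof
  assume cS: "c \<in> S"
  have "rows_out Z (S - {c}) = rows_out Z S" using c(1) by (force simp: rows_out_def)
  moreover have "card (S - {c}) < card S" using closD(4)[OF S] cS by (rule card_Diff1_less)
  ultimately have "csize Z (S - {c}) < csize Z S" by (simp add: csize_def)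
  moreover have "C \<subseteq> S - {c}" "S - {c} \<subseteq> J" using closD[OF S] c by auto
  ultimately show False using clos_le[OF S] by (meson leD)
qed

text \<open>At most one more because \<open>insert c S\<close> competes, at least one more because
  \<open>S\<close> is closed. So every draw raises the level by exactly one.\<close>

lemma csize_clos_insert:
  assumes S: "closed_cols Z J S" and c: "c \<in> J - S" and S': "is_clos Z J (insert c S) S'"
  shows "csize Z S' = Suc (csize Z S)"
proof -
  have SJ: "S \<subseteq> J" using S by (simp add: closed_cols_def)
  have "insert c S \<subseteq> J" using SJ c by auto
  then have "csize Z S' \<le> csize Z (insert c S)" by (rule clos_le[OF S' subset_refl])
  also have "\<dots> \<le> Suc (csize Z S)" using finite_cols[OF SJ] by (intro csize_insert_le) auto
  finally have "csize Z S' \<le> Suc (csize Z S)" .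
  moreover have "S \<subset> S'" "S' \<subseteq> J" using closD[OF S'] c by auto
  then have "csize Z S < csize Z S'" using S by (simp add: closed_cols_def)
  ultimately show ?thesis by simp
qed

context
  fixes a :: "'r \<times> 'c \<Rightarrow> real"
  assumes nonneg: "\<And>p. p \<in> I \<times> J \<Longrightarrow> 0 \<le> a p" and zero: "\<And>p. p \<in> Z \<Longrightarrow> a p = 0"
begin

text \<open>The columns of the closure of the empty set can be filled entirely by zeros in the
  remaining rows, at cost 0.\<close>

lemma stage_init:
  assumes S: "is_clos Z J {} S"
  shows "stage a S"
proof -
  obtain \<zeta> where \<zeta>: "\<zeta> \<subseteq> Z" "matching \<zeta>" "snd ` \<zeta> = S - {}"
    "fst ` \<zeta> \<subseteq> rows_out Z {} - rows_out Z S"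
    by (rule hall_cols[OF finI finJ Z S])
  have "\<zeta> \<subseteq> (I - rows_out Z S) \<times> J"
  proof
    fix p assume p: "p \<in> \<zeta>"
    then have "fst p \<notin> rows_out Z S" using \<zeta>(4) by auto
    then show "p \<in> (I - rows_out Z S) \<times> J" using p \<zeta>(1) Z by (auto simp: mem_Times_iff)
  qed
  moreover have "card \<zeta> = card S" using \<zeta>(2,3) matching_card(2)[of \<zeta>] by simp
  ultimately have "\<zeta> \<in> asgs (card S) (I - rows_out Z S) J" using \<zeta>(2) by (simp add: asgs_def)
  moreover have "sum a \<zeta> = 0" using \<zeta>(1) zero by (intro sum.neutral) auto
  moreover have "0 \<le> sum a \<tau>" if "\<tau> \<in> asgs (card S) (I - rows_out Z S) J" for \<tau>
    using that nonneg by (intro sum_nonneg) (auto simp: asgs_def)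
  ultimately show ?thesis using \<zeta>(3) unfolding stage_def opt_cols_def
    by (intro bexI[of _ \<zeta>]) simp_all
qed

text \<open>The columns that closure adds to \<open>insert c S\<close> are filled by zeros in rows
  released from \<open>rows_out\<close>, which \<open>opt_cols_extend\<close> shows to preserve
  optimality.\<close>

lemma stage_step:
  assumes S: "closed_cols Z J S" and c: "c \<in> J - S" and S': "is_clos Z J (insert c S) S'"
    and opt: "opt_cols (Suc (card S)) (I - rows_out Z S) J a (insert c S)"
  shows "stage a S'"
proof -
  obtain \<sigma> where \<sigma>: "\<sigma> \<in> asgs (Suc (card S)) (I - rows_out Z S) J" "snd ` \<sigma> = insert c S"
    "\<And>\<tau>. \<tau> \<in> asgs (Suc (card S)) (I - rows_out Z S) J \<Longrightarrow> sum a \<sigma> \<le> sum a \<tau>"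
    using opt by (auto simp: opt_cols_def)
  obtain \<zeta> where \<zeta>: "\<zeta> \<subseteq> Z" "matching \<zeta>" "snd ` \<zeta> = S' - insert c S"
    "fst ` \<zeta> \<subseteq> rows_out Z (insert c S) - rows_out Z S'"
    by (rule hall_cols[OF finI finJ Z S'])
  have finS: "finite S" and SJ: "S \<subseteq> J" using S finite_cols by (auto simp: closed_cols_def)
  have cS: "insert c S \<subseteq> S'" "finite S'" using closD[OF S'] by auto
  have R: "rows_out Z S' \<subseteq> rows_out Z S" "rows_out Z S \<subseteq> I"
    using cS Z by (auto simp: rows_out_def)
  have "fst ` \<zeta> \<subseteq> rows_out Z S - rows_out Z S'" using \<zeta>(4) by (auto simp: rows_out_def)
  moreover have card\<zeta>: "card \<zeta> = card S' - Suc (card S)" "Suc (card S) \<le> card S'"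
    using matching_card(2)[OF \<zeta>(2)] \<zeta>(3) cS finS c card_mono[OF cS(2,1)]
    by (simp_all add: card_Diff_subset)
  \<comment> \<open>Since \<open>csize\<close> rises by exactly one, there are as many released rows
    as added columns, so the zeros fill all the released rows.\<close>
  then have "card (fst ` \<zeta>) = card (rows_out Z S - rows_out Z S')"
    using csize_clos_insert[OF S c S'] R matching_card(1)[OF \<zeta>(2)]
    by (simp add: csize_def card_Diff_subset)
  ultimately have fst\<zeta>: "fst ` \<zeta> = rows_out Z S - rows_out Z S'" by (intro card_subset_eq) auto
  have "\<zeta> \<subseteq> rows_out Z S \<times> J"
  proof
    fix p assume p: "p \<in> \<zeta>"
    then have "fst p \<in> rows_out Z S" using fst\<zeta> by auto
    then show "p \<in> rows_out Z S \<times> J" using p \<zeta>(1) Z by (auto simp: mem_Times_iff)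
  qed
  moreover have "sum a \<zeta> = 0" using \<zeta>(1) zero by (intro sum.neutral) auto
  moreover have "snd ` \<zeta> \<inter> snd ` \<sigma> = {}" using \<zeta>(3) \<sigma>(2) by auto
  ultimately have "\<sigma> \<union> \<zeta> \<in> asgs (Suc (card S) + card \<zeta>) (I - rows_out Z S') J"
    "\<And>\<tau>. \<tau> \<in> asgs (Suc (card S) + card \<zeta>) (I - rows_out Z S') J \<Longrightarrow> sum a (\<sigma> \<union> \<zeta>) \<le> sum a \<tau>"
    using opt_cols_extend[OF finI finJ nonneg \<sigma>(1,3) R _ \<zeta>(2) _ _ fst\<zeta>] by blast+
  moreover have "Suc (card S) + card \<zeta> = card S'" using card\<zeta> by simp
  moreover have "snd ` (\<sigma> \<union> \<zeta>) = S'" unfolding image_Un \<sigma>(2) \<zeta>(3) using cS by auto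
  ultimately show ?thesis unfolding stage_def opt_cols_def by auto
qed

text \<open>Zeros fill the rows of \<open>rows_out Z S\<close>; \<open>hall_rows\<close> lets them
  miss \<open>c\<close>. Thus no column outside \<open>S\<close> is forced, and nonzero entries
  occur only in columns of \<open>S\<close>.\<close>

lemma stage_opt:
  assumes S: "closed_cols Z J S" and st: "stage a S" and c: "c \<notin> S"
  obtains \<sigma> where "is_opt (csize Z S) I J a \<sigma>" "c \<notin> snd ` \<sigma>" "snd ` (\<sigma> - Z) \<subseteq> S"
proof -
  obtain \<sigma> where \<sigma>: "\<sigma> \<in> asgs (card S) (I - rows_out Z S) J" "snd ` \<sigma> = S"
    "\<And>\<tau>. \<tau> \<in> asgs (card S) (I - rows_out Z S) J \<Longrightarrow> sum a \<sigma> \<le> sum a \<tau>"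
    using st by (auto simp: opt_cols_def stage_def)
  obtain \<zeta> where \<zeta>: "\<zeta> \<subseteq> Z" "matching \<zeta>" "fst ` \<zeta> = rows_out Z S" "snd ` \<zeta> \<inter> insert c S = {}"
    by (rule hall_rows[OF finI finJ Z S c])
  have "\<zeta> \<subseteq> rows_out Z S \<times> J"
  proof
    fix p assume p: "p \<in> \<zeta>"
    then have "fst p \<in> rows_out Z S" using \<zeta>(3) by auto
    then show "p \<in> rows_out Z S \<times> J" using p \<zeta>(1) Z by (auto simp: mem_Times_iff)
  qed
  moreover have "sum a \<zeta> = 0" using \<zeta>(1) zero by (intro sum.neutral) auto
  moreover have "snd ` \<zeta> \<inter> snd ` \<sigma> = {}" using \<zeta>(4) \<sigma>(2) by auto
  moreover have "fst ` \<zeta> = rows_out Z S - {}" using \<zeta>(3) by simp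
  ultimately have "\<sigma> \<union> \<zeta> \<in> asgs (card S + card \<zeta>) (I - {}) J"
    "\<And>\<tau>. \<tau> \<in> asgs (card S + card \<zeta>) (I - {}) J \<Longrightarrow> sum a (\<sigma> \<union> \<zeta>) \<le> sum a \<tau>"
    using opt_cols_extend[OF finI finJ nonneg \<sigma>(1,3) empty_subsetI rows_out_subset[OF Z] _ \<zeta>(2)]
    by blast+
  moreover have "card S + card \<zeta> = csize Z S"
    using matching_card(1)[OF \<zeta>(2)] \<zeta>(3) by (simp add: csize_def)
  ultimately have "is_opt (csize Z S) I J a (\<sigma> \<union> \<zeta>)" by (simp add: is_opt_def)
  moreover have "c \<notin> snd ` (\<sigma> \<union> \<zeta>)" using \<zeta>(4) \<sigma>(2) c by auto
  moreover have "snd ` (\<sigma> \<union> \<zeta> - Z) \<subseteq> S" using \<zeta>(1) \<sigma>(2) by auto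
  ultimately show ?thesis by (rule that)
qed

text \<open>By genericity \<tau> has the nonzero part of an optimum from \<open>stage_opt\<close>,
  so its entries outside the columns \<open>S\<close> are zeros and lie in
  \<open>rows_out Z S\<close>. This bounds their number, and the other entries suffice to fill all
  of \<open>S\<close>.\<close>

lemma stage_cols_used:
  assumes S: "closed_cols Z J S" and st: "stage a S" and gen: "generic Z (I \<times> J) a"
    and \<tau>: "is_opt (csize Z S) I J a \<tau>"
  shows "S \<subseteq> snd ` \<tau>"
\<comment> \<open>If \<open>S\<close> is the whole column type, there is no column to hand to
  \<open>stage_opt\<close>, and counting alone decides.\<close>
proof (cases "S = UNIV")
  case True
  have "finite S" using S finite_cols by (auto simp: closed_cols_def)
  moreover have "card (snd ` \<tau>) = csize Z S"
    using \<tau> matching_card(2)[of \<tau>] by (auto simp: is_opt_def asgs_def)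
  ultimately have "card S \<le> card (snd ` \<tau>)" by (simp add: csize_def)
  then have "snd ` \<tau> = S" using True \<open>finite S\<close> by (metis card_seteq subset_UNIV)
  then show ?thesis by simp
next
  case False
  then obtain c where c: "c \<notin> S" by auto
  obtain \<sigma> where \<sigma>: "is_opt (csize Z S) I J a \<sigma>" "c \<notin> snd ` \<sigma>" "snd ` (\<sigma> - Z) \<subseteq> S"
    by (rule stage_opt[OF S st c])
  have eq: "\<tau> - Z = \<sigma> - Z" using generic_is_opt[OF gen \<tau> \<sigma>(1)] .
  have \<tau>': "\<tau> \<in> asgs (csize Z S) I J" using \<tau> by (simp add: is_opt_def)
  then have m: "matching \<tau>" "card \<tau> = csize Z S" by (simp_all add: asgs_def)
  have f\<tau>: "finite \<tau>" by (rule asgs_finite[OF finI finJ \<tau>'])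
  have finS: "finite S" using S finite_cols by (auto simp: closed_cols_def)
  define \<tau>1 where "\<tau>1 = {p \<in> \<tau>. snd p \<notin> S}"
  have "\<tau>1 \<subseteq> Z" using eq \<sigma>(3) by (auto simp: \<tau>1_def)
  then have "fst ` \<tau>1 \<subseteq> rows_out Z S" by (force simp: \<tau>1_def rows_out_def)
  moreover have "matching \<tau>1" using m(1) by (rule matching_subset) (auto simp: \<tau>1_def)
  ultimately have "card \<tau>1 \<le> card (rows_out Z S)"
    using matching_card(1)[of \<tau>1] card_mono[of "rows_out Z S" "fst ` \<tau>1"] by simp
  moreover have "card (\<tau> - \<tau>1) = card \<tau> - card \<tau>1"
    using f\<tau> by (intro card_Diff_subset) (auto simp: \<tau>1_def)
  moreover have "card (snd ` (\<tau> - \<tau>1)) = card (\<tau> - \<tau>1)"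
    using matching_subset[OF m(1), of "\<tau> - \<tau>1"] by (intro matching_card) auto
  ultimately have "card S \<le> card (snd ` (\<tau> - \<tau>1))" using m(2) by (simp add: csize_def)
  moreover have "snd ` (\<tau> - \<tau>1) \<subseteq> S" by (auto simp: \<tau>1_def)
  ultimately have "snd ` (\<tau> - \<tau>1) = S" using finS by (metis card_seteq)
  then show ?thesis by auto
qed

text \<open>A column in \<open>T\<close> but not in \<open>S\<close> would be avoided by one optimum
  because of \<open>S\<close> and used by every optimum because of \<open>T\<close>.\<close>

lemma stage_unique:
  assumes S: "closed_cols Z J S" "stage a S" and T: "closed_cols Z J T" "stage a T"
    and eq: "csize Z S = csize Z T" and gen: "generic Z (I \<times> J) a"
  shows "S = T"
proof (rule ccontr)
  assume "S \<noteq> T"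
  have "\<not> T \<subset> S"
  proof
    assume "T \<subset> S"
    then have "csize Z T < csize Z S" using S(1) T(1) by (simp add: closed_cols_def)
    then show False using eq by simp
  qed
  then have "\<not> T \<subseteq> S" using \<open>S \<noteq> T\<close> by (simp add: psubset_eq)
  then obtain c where c: "c \<in> T" "c \<notin> S" by (meson subsetI)
  obtain \<sigma> where \<sigma>: "is_opt (csize Z S) I J a \<sigma>" "c \<notin> snd ` \<sigma>" "snd ` (\<sigma> - Z) \<subseteq> S"
    by (rule stage_opt[OF S c(2)])
  then have "is_opt (csize Z T) I J a \<sigma>" using eq by simp
  then have "T \<subseteq> snd ` \<sigma>" by (rule stage_cols_used[OF T gen])
  then show False using c(1) \<sigma>(2) by auto
qed

end

end

section \<open>The urn and the cover formula\<close>

text \<open>In a uniformly random order of \<open>n\<close> elements, the probability that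
  \<open>j\<close> given elements come first, in any order, and another given element comes
  next.\<close>

definition wt :: "nat \<Rightarrow> nat \<Rightarrow> real" where
  "wt n j = 1 / (real n * real ((n - 1) choose j))"

text \<open>The right side is the probability that the first \<open>j\<close> elements form a given
  set. Here it is split by the element that follows, in \<open>wt_down\<close> by the last element
  of the set.\<close>

lemma wt_up: "j < n \<Longrightarrow> real (n - j) * wt n j = 1 / real (n choose j)"
proof -
  assume j: "j < n"
  have "real (n - j) * real (n choose j) = real n * real ((n - 1) choose j)"
    using binomial_absorb_comp[of n j] by (metis of_nat_mult)
  then show ?thesis using j by (simp add: wt_def field_simps)
qed

lemma wt_down: "0 < j \<Longrightarrow> j \<le> n \<Longrightarrow> real j * wt n (j - 1) = 1 / real (n choose j)"
proof -
  assume j: "0 < j" "j \<le> n"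
  then obtain i m where im: "j = Suc i" "n = Suc m" by (metis Suc_pred' le_0_eq not0_implies_Suc not_gr0)
  have E: "real (Suc m) * real (m choose i) = real (Suc m choose Suc i) * real (Suc i)"
    using Suc_times_binomial_eq[of m i] by (metis of_nat_mult)
  have "real j * wt n (j - 1) = real (Suc i) / (real (Suc m) * real (m choose i))"
    unfolding im wt_def by simp
  then show ?thesis unfolding E im by (simp del: binomial_Suc_Suc of_nat_Suc)
qed

text \<open>Forgetting one element of a random order: it came either after or before the
  distinguished one, so the initial set had \<open>j\<close> or \<open>j + 1\<close>
  elements.\<close>

lemma wt_split:
  assumes "Suc j < n"
  shows "wt n j + wt n (Suc j) = wt (n - 1) j"
proof -
  have n: "real n > 1" "real (n - 1) = real n - 1" "real (n - 1 - j) = real n - 1 - real j"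
    using assms by (auto simp: of_nat_diff)
  have pos: "real ((n - 1) choose j) > 0" "real ((n - 1) choose Suc j) > 0" using assms by simp_all
  have 1: "(real n - 1 - real j) * wt (n - 1) j = 1 / real ((n - 1) choose j)"
    using wt_up[of j "n - 1"] assms unfolding n(3) by simp
  have 2: "(1 + real j) * wt (n - 1) j = 1 / real ((n - 1) choose Suc j)"
    using wt_down[of "Suc j" "n - 1"] assms by simp
  have "real n * (wt n j + wt n (Suc j)) = 1 / real ((n - 1) choose j) + 1 / real ((n - 1) choose Suc j)"
    using n by (simp add: wt_def field_simps)
  also have "\<dots> = real n * wt (n - 1) j" unfolding 1[symmetric] 2[symmetric] by (simp add: algebra_simps)
  finally show ?thesis using n by simp
qed

text \<open>Draw the elements of \<open>U\<close> and one further element in random order. For down-closed \<open>D\<close>, this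
  is the probability that the set drawn before the further element satisfies \<open>D\<close>, given that the
  draw begins with the elements of \<open>C\<close>.\<close>

definition urn :: "'c set \<Rightarrow> ('c set \<Rightarrow> bool) \<Rightarrow> 'c set \<Rightarrow> real" where
  "urn U D C = (\<Sum>X | C \<subseteq> X \<and> X \<subseteq> U \<and> D X. wt (card U + 1 - card C) (card X - card C))"

text \<open>An element that never affects \<open>D\<close> may be ignored: pair each
  \<open>X\<close> without \<open>c\<close> with \<open>insert c X\<close> and merge the two weights
  by \<open>wt_split\<close>.\<close>

lemma urn_loop:
  assumes U: "finite U" and c: "c \<in> U" "c \<notin> C" "C \<subseteq> U"
    and D: "\<And>X. C \<subseteq> X \<Longrightarrow> X \<subseteq> U \<Longrightarrow> D (insert c X) \<longleftrightarrow> D X"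
  shows "urn U D (insert c C) = urn U D C"
proof -
  let ?n = "card U + 1 - card C"
  define A where "A = {X. C \<subseteq> X \<and> X \<subseteq> U \<and> D X \<and> c \<notin> X}"
  have finC: "finite C" using U c by (auto intro: finite_subset)
  have finA: "finite A" by (rule finite_subset[of _ "Pow U"]) (use U in \<open>auto simp: A_def\<close>)
  have inj: "inj_on (insert c) A" by (auto simp: inj_on_def A_def)
  have B: "{X. insert c C \<subseteq> X \<and> X \<subseteq> U \<and> D X} = insert c ` A"
  proof (intro equalityI subsetI)
    fix X assume X: "X \<in> {X. insert c C \<subseteq> X \<and> X \<subseteq> U \<and> D X}"
    then have "X = insert c (X - {c})" by auto
    moreover have "D (X - {c})" using D[of "X - {c}"] X c by (auto simp: insert_absorb)
    then have "X - {c} \<in> A" using X c by (auto simp: A_def)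
    ultimately show "X \<in> insert c ` A" by (rule image_eqI)
  qed (use c D in \<open>auto simp: A_def\<close>)
  have eq: "{X. C \<subseteq> X \<and> X \<subseteq> U \<and> D X} = A \<union> {X. insert c C \<subseteq> X \<and> X \<subseteq> U \<and> D X}"
    using c by (auto simp: A_def)
  have cards: "Suc (card X - card C) < ?n" "card (insert c X) = Suc (card X)" "card C \<le> card X"
    if "X \<in> A" for X
  proof -
    have "finite X" using that U by (auto simp: A_def intro: finite_subset)
    then show "card (insert c X) = Suc (card X)" using that by (auto simp: A_def)
    show le: "card C \<le> card X" using that \<open>finite X\<close> by (auto simp: A_def intro: card_mono)
    have "card (insert c X) \<le> card U" using that U c by (intro card_mono) (auto simp: A_def)
    then show "Suc (card X - card C) < ?n" using \<open>card (insert c X) = Suc (card X)\<close> le by linarith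
  qed
  have "urn U D C = (\<Sum>X\<in>A. wt ?n (card X - card C)) + (\<Sum>X\<in>insert c ` A. wt ?n (card X - card C))"
    unfolding urn_def eq B using finA by (intro sum.union_disjoint) (auto simp: A_def)
  also have "\<dots> = (\<Sum>X\<in>A. wt ?n (card X - card C) + wt ?n (Suc (card X - card C)))"
    using cards by (simp add: sum.reindex[OF inj] sum.distrib Suc_diff_le)
  also have "\<dots> = (\<Sum>X\<in>A. wt (?n - 1) (card X - card C))"
    using cards by (intro sum.cong wt_split) auto
  also have "\<dots> = (\<Sum>X\<in>insert c ` A. wt (?n - 1) (card X - card (insert c C)))"
    using cards finC c by (simp add: sum.reindex[OF inj])
  also have "\<dots> = urn U D (insert c C)"
    unfolding urn_def B using finC c by simp
  finally show ?thesis by simp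
qed

text \<open>Inserting the elements of \<open>S\<close> one by one: each is invisible to
  \<open>D\<close>, since \<open>D X\<close> passes up to \<open>X \<union> S\<close> and back down
  to everything below. This is how passing to a closure leaves the urn probability
  unchanged.\<close>

lemma urn_loops:
  assumes U: "finite U" and S: "C \<subseteq> S" "S \<subseteq> U"
    and D: "\<And>X. C \<subseteq> X \<Longrightarrow> X \<subseteq> U \<Longrightarrow> D X \<Longrightarrow> D (X \<union> S)"
    and down: "\<And>X Y. Y \<subseteq> X \<Longrightarrow> D X \<Longrightarrow> D Y"
  shows "urn U D S = urn U D C"
proof -
  have "urn U D (C \<union> T) = urn U D C" if "finite T" "T \<subseteq> S" for T
    using that
  proof (induction T rule: finite_induct)
    case (insert c T)
    show ?case
    proof (cases "c \<in> C \<union> T")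
      case False
      have "urn U D (insert c (C \<union> T)) = urn U D (C \<union> T)"
      proof (rule urn_loop)
        show "D (insert c X) \<longleftrightarrow> D X" if "C \<union> T \<subseteq> X" "X \<subseteq> U" for X
          using D[of X] down[of "insert c X" "X \<union> S"] down[of X "insert c X"] that insert.prems by auto
      qed (use U S insert.prems False in auto)
      then show ?thesis using insert by simp
    qed (use insert in \<open>simp add: insert_absorb\<close>)
  qed auto
  from this[of S] show ?thesis using S U by (auto simp: Un_absorb1 intro: finite_subset)
qed

text \<open>Condition on the next draw: the further element gives the 1, since \<open>D C\<close>
  holds, and any other \<open>c\<close> moves the urn to \<open>insert c C\<close>. In the double
  sum each \<open>X\<close> occurs once for every element of \<open>X - C\<close>, and
  \<open>wt_down\<close> turns this multiplicity into the weight for one more element.\<close>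

lemma urn_rec:
  fixes U :: "'c set"
  assumes U: "finite U" and C: "C \<subseteq> U" and D: "D C"
  shows "real (card U + 1 - card C) * urn U D C = 1 + (\<Sum>c\<in>U - C. urn U D (insert c C))"
proof -
  let ?n = "card U + 1 - card C"
  define F where "F = {X. C \<subseteq> X \<and> X \<subseteq> U \<and> D X}"
  have finF: "finite F" by (rule finite_subset[of _ "Pow U"]) (use U in \<open>auto simp: F_def\<close>)
  have finC: "finite C" using U C by (auto intro: finite_subset)
  have CF: "C \<in> F" using C D by (auto simp: F_def)
  have X: "finite X" "C \<subseteq> X" "X \<subseteq> U" "card (X - C) = card X - card C" "card X \<le> card U"
    if "X \<in> F" for X
    using that U finC finite_subset[of X U] card_mono[of U X]
    by (auto simp: F_def card_Diff_subset)
  have "(\<Sum>c\<in>U - C. urn U D (insert c C)) =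
      (\<Sum>c\<in>U - C. \<Sum>X\<in>F. if c \<in> X then wt (?n - 1) (card X - card C - 1) else 0)"
  proof (rule sum.cong)
    fix c assume c: "c \<in> U - C"
    have "{X. insert c C \<subseteq> X \<and> X \<subseteq> U \<and> D X} = {X \<in> F. c \<in> X}" by (auto simp: F_def)
    moreover have "card U + 1 - card (insert c C) = ?n - 1"
      "\<And>X :: 'c set. card X - card (insert c C) = card X - card C - 1" using c finC by simp_all
    ultimately show "urn U D (insert c C) =
        (\<Sum>X\<in>F. if c \<in> X then wt (?n - 1) (card X - card C - 1) else 0)"
      using finF by (simp only: urn_def sum.inter_filter cong: if_cong)
  qed simp
  also have "\<dots> = (\<Sum>X\<in>F. \<Sum>c\<in>U - C. if c \<in> X then wt (?n - 1) (card X - card C - 1) else 0)"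
    by (rule sum.swap)
  also have "\<dots> = (\<Sum>X\<in>F. real (card X - card C) * wt (?n - 1) (card X - card C - 1))"
  proof (rule sum.cong)
    fix Y assume Y: "Y \<in> F"
    have "{c \<in> U - C. c \<in> Y} = Y - C" using X[OF Y] by auto
    then show "(\<Sum>c\<in>U - C. if c \<in> Y then wt (?n - 1) (card Y - card C - 1) else 0) =
      real (card Y - card C) * wt (?n - 1) (card Y - card C - 1)"
      using U X[OF Y] by (simp flip: sum.inter_filter)
  qed simp
  also have "\<dots> = (\<Sum>X\<in>F - {C}. real (card X - card C) * wt (?n - 1) (card X - card C - 1))"
    using finF CF by (simp add: sum.remove[of F C])
  also have "\<dots> = (\<Sum>X\<in>F - {C}. real ?n * wt ?n (card X - card C))"
  proof (rule sum.cong)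
    fix Y assume Y: "Y \<in> F - {C}"
    then have "0 < card Y - card C" using X[of Y] by (metis DiffE card_gt_0_iff Diff_eq_empty_iff finite_Diff insertI1 subset_antisym)
    moreover have "card Y - card C \<le> ?n - 1" using X[of Y] Y by auto
    ultimately have "real (card Y - card C) * wt (?n - 1) (card Y - card C - 1) =
      1 / real ((?n - 1) choose (card Y - card C))" by (rule wt_down)
    also have "\<dots> = real ?n * wt ?n (card Y - card C)"
      using card_mono[OF U C] by (simp add: wt_def)
    finally show "real (card Y - card C) * wt (?n - 1) (card Y - card C - 1) =
      real ?n * wt ?n (card Y - card C)" .
  qed simp
  also have "\<dots> = real ?n * urn U D C - 1"
  proof -
    have "urn U D C = wt ?n 0 + (\<Sum>X\<in>F - {C}. wt ?n (card X - card C))"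
      using finF CF unfolding urn_def F_def[symmetric] by (simp add: sum.remove[of F C])
    moreover have "real ?n * wt ?n 0 = 1" using card_mono[OF U C] by (simp add: wt_def)
    ultimately show ?thesis by (simp only: sum_distrib_left[symmetric] distrib_left)
  qed
  finally show ?thesis by simp
qed

text \<open>Draw \<open>I\<close> in random order. The inner sum is the probability that
  \<open>D\<close> is lost exactly when \<open>i\<close> is drawn. If \<open>D {}\<close> holds,
  this happens exactly once, because \<open>small\<close> excludes \<open>D I\<close>. In the
  calculation, what each set in \<open>D\<close> gains from elements outside it cancels what it
  loses from elements inside, except for the empty set.\<close>

lemma down_closed_boundary:
  fixes I :: "'r set"
  assumes I: "finite I" and down: "\<And>R S. R \<subseteq> S \<Longrightarrow> D S \<Longrightarrow> D R" and small: "\<And>R. R \<subseteq> I \<Longrightarrow> D R \<Longrightarrow> card R < card I"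
  shows "(\<Sum>i\<in>I. \<Sum>R | R \<subseteq> I \<and> i \<notin> R \<and> D R \<and> \<not> D (insert i R). wt (card I) (card R)) = of_bool (D {})"
proof -
  let ?m = "card I"
  define F where "F = {R. R \<subseteq> I \<and> D R}"
  have finF: "finite F" by (rule finite_subset[of _ "Pow I"]) (use I in \<open>auto simp: F_def\<close>)
  have R: "finite R" "R \<subseteq> I" "card R < ?m" if "R \<in> F" for R
    using that I small finite_subset[of R I] by (auto simp: F_def)
  have "(\<Sum>R | R \<subseteq> I \<and> i \<notin> R \<and> D R \<and> \<not> D (insert i R). wt ?m (card R)) =
    (\<Sum>R\<in>F. if i \<notin> R then wt ?m (card R) else 0) - (\<Sum>R\<in>F. if i \<in> R then wt ?m (card R - 1) else 0)"
    if i: "i \<in> I" for i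
  proof -
    define A where "A = {R \<in> F. i \<notin> R}"
    define A' where "A' = {R \<in> A. D (insert i R)}"
    define B where "B = {R \<in> F. i \<in> R}"
    have inj: "inj_on (\<lambda>R. R - {i}) B" by (auto simp: inj_on_def B_def)
    \<comment> \<open>Sets \<open>R\<close> with \<open>insert i R\<close> still in \<open>D\<close>
      are recorded by that larger set, so that both parts become sums over \<open>F\<close>.\<close>
    have "(\<lambda>R. R - {i}) ` B = A'"
    proof (intro equalityI subsetI)
      fix R assume "R \<in> A'"
      then have "insert i R \<in> B" "R = insert i R - {i}" using i by (auto simp: A_def A'_def B_def F_def)
      then show "R \<in> (\<lambda>R. R - {i}) ` B" by blast
    next
      fix R assume "R \<in> (\<lambda>R. R - {i}) ` B"
      then obtain S where S: "S \<in> B" "R = S - {i}" by auto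
      moreover have "D (S - {i})" using down[of "S - {i}" S] S by (auto simp: B_def F_def)
      ultimately show "R \<in> A'" by (auto simp: A_def A'_def B_def F_def insert_absorb)
    qed
    then have "(\<Sum>R\<in>A'. wt ?m (card R)) = (\<Sum>R\<in>B. wt ?m (card (R - {i})))"
      using sum.reindex[OF inj, of "\<lambda>R. wt ?m (card R)"] by simp
    also have "\<dots> = (\<Sum>R\<in>B. wt ?m (card R - 1))"
      using R by (intro sum.cong) (auto simp: B_def)
    finally have 1: "(\<Sum>R\<in>A'. wt ?m (card R)) = (\<Sum>R\<in>B. wt ?m (card R - 1))" .
    have "{R. R \<subseteq> I \<and> i \<notin> R \<and> D R \<and> \<not> D (insert i R)} = A - A'"
      by (auto simp: A_def A'_def F_def)
    moreover have "finite A" "A' \<subseteq> A" using finF by (auto simp: A_def A'_def)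
    ultimately have "(\<Sum>R | R \<subseteq> I \<and> i \<notin> R \<and> D R \<and> \<not> D (insert i R). wt ?m (card R)) =
      (\<Sum>R\<in>A. wt ?m (card R)) - (\<Sum>R\<in>B. wt ?m (card R - 1))"
      by (simp add: sum_diff 1)
    then show ?thesis using finF by (simp add: A_def B_def sum.inter_filter cong: if_cong)
  qed
  then have "(\<Sum>i\<in>I. \<Sum>R | R \<subseteq> I \<and> i \<notin> R \<and> D R \<and> \<not> D (insert i R). wt ?m (card R)) =
     (\<Sum>i\<in>I. \<Sum>R\<in>F. if i \<notin> R then wt ?m (card R) else 0) -
     (\<Sum>i\<in>I. \<Sum>R\<in>F. if i \<in> R then wt ?m (card R - 1) else 0)"
    by (simp add: sum_subtractf)
  also have "(\<Sum>i\<in>I. \<Sum>R\<in>F. if i \<notin> R then wt ?m (card R) else 0) =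
     (\<Sum>R\<in>F. \<Sum>i\<in>I. if i \<notin> R then wt ?m (card R) else 0)" by (rule sum.swap)
  also have "(\<Sum>i\<in>I. \<Sum>R\<in>F. if i \<in> R then wt ?m (card R - 1) else 0) =
     (\<Sum>R\<in>F. \<Sum>i\<in>I. if i \<in> R then wt ?m (card R - 1) else 0)" by (rule sum.swap)
  also have "(\<Sum>R\<in>F. \<Sum>i\<in>I. if i \<notin> R then wt ?m (card R) else 0) -
      (\<Sum>R\<in>F. \<Sum>i\<in>I. if i \<in> R then wt ?m (card R - 1) else 0) =
    (\<Sum>R\<in>F. (\<Sum>i\<in>I. if i \<notin> R then wt ?m (card R) else 0) -
      (\<Sum>i\<in>I. if i \<in> R then wt ?m (card R - 1) else 0))"
    by (rule sum_subtractf[symmetric])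
  also have "\<dots> = (\<Sum>R\<in>F. of_bool (R = {}))"
  proof (rule sum.cong)
    fix R assume RF: "R \<in> F"
    have "{i \<in> I. i \<notin> R} = I - R" "{i \<in> I. i \<in> R} = R" using R[OF RF] by auto
    then have "(\<Sum>i\<in>I. if i \<notin> R then wt ?m (card R) else 0) = real (?m - card R) * wt ?m (card R)"
      "(\<Sum>i\<in>I. if i \<in> R then wt ?m (card R - 1) else 0) = real (card R) * wt ?m (card R - 1)"
      using I R[OF RF] by (simp_all add: card_Diff_subset flip: sum.inter_filter)
    moreover have "real (card R) * wt ?m (card R - 1) = (if R = {} then 0 else 1 / real (?m choose card R))"
      using wt_down[of "card R" ?m] R[OF RF] by (auto simp: card_gt_0_iff)
    ultimately show "(\<Sum>i\<in>I. if i \<notin> R then wt ?m (card R) else 0) -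
      (\<Sum>i\<in>I. if i \<in> R then wt ?m (card R - 1) else 0) = of_bool (R = {})"
      using wt_up[of "card R" ?m] R[OF RF] by auto
  qed simp
  also have "\<dots> = of_bool (D {})" using finF by (auto simp: F_def)
  finally show ?thesis .
qed

section \<open>The cover formula and its two recursions\<close>

definition cover :: "'r set \<Rightarrow> 'c set \<Rightarrow> ('r \<times> 'c) set \<Rightarrow> nat \<Rightarrow> 'r set \<Rightarrow> 'c set \<Rightarrow> bool" where
  "cover I J Z s R C \<longleftrightarrow> R \<subseteq> I \<and> C \<subseteq> J \<and> card R + card C = s \<and> (\<forall>(r, c)\<in>Z. r \<in> R \<or> c \<in> C)"

definition pcover :: "'r set \<Rightarrow> 'c set \<Rightarrow> ('r \<times> 'c) set \<Rightarrow> nat \<Rightarrow> 'r set \<Rightarrow> 'c set \<Rightarrow> bool" where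
  "pcover I J Z s R C \<longleftrightarrow> (\<exists>R' C'. cover I J Z s R' C' \<and> R \<subseteq> R' \<and> C \<subseteq> C')"

text \<open>The sum of the theorem with the prefactor and the binomials absorbed into
  \<open>wt\<close>, over individual partial covers instead of over their sizes.\<close>

definition cformula :: "'r set \<Rightarrow> 'c set \<Rightarrow> ('r \<times> 'c) set \<Rightarrow> nat \<Rightarrow> real" where
  "cformula I J Z s =
    (\<Sum>C\<in>Pow J. \<Sum>R | R \<subseteq> I \<and> pcover I J Z s R C. wt (card I) (card R) * wt (card J) (card C))"

lemma pcover_mono: "pcover I J Z s R C \<Longrightarrow> R' \<subseteq> R \<Longrightarrow> C' \<subseteq> C \<Longrightarrow> pcover I J Z s R' C'"
  unfolding pcover_def by (meson subset_trans)

lemma pcover_card: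
  assumes "finite I" "finite J" "pcover I J Z s R C"
  shows "card R + card C \<le> s"
proof -
  obtain R' C' where *: "cover I J Z s R' C'" "R \<subseteq> R'" "C \<subseteq> C'" using assms(3) by (auto simp: pcover_def)
  then have "finite R'" "finite C'" using assms by (auto simp: cover_def intro: finite_subset)
  then have "card R \<le> card R'" "card C \<le> card C'" using * by (auto intro: card_mono)
  then show ?thesis using * by (simp add: cover_def)
qed

text \<open>A cover with fewer than \<open>s\<close> members can be padded by arbitrary rows, for
  which \<open>s \<le> card I\<close> leaves room; conversely the rows of a cover contain those
  missed by its columns.\<close>

lemma (in zero_pattern) pcover_iff_csize:
  assumes s: "s \<le> card I" and C: "C \<subseteq> J"
  shows "pcover I J Z s {} C \<longleftrightarrow> (\<exists>T. C \<subseteq> T \<and> T \<subseteq> J \<and> csize Z T \<le> s)"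
proof
  assume "pcover I J Z s {} C"
  then obtain R' C' where *: "cover I J Z s R' C'" "C \<subseteq> C'" by (auto simp: pcover_def)
  have "rows_out Z C' \<subseteq> R'" using *(1) by (auto simp: cover_def rows_out_def)
  moreover have "finite R'" using *(1) finI by (auto simp: cover_def intro: finite_subset)
  ultimately have "card (rows_out Z C') \<le> card R'" by (rule card_mono[rotated])
  then have "csize Z C' \<le> s" using *(1) by (simp add: csize_def cover_def)
  then show "\<exists>T. C \<subseteq> T \<and> T \<subseteq> J \<and> csize Z T \<le> s" using * by (auto simp: cover_def)
next
  assume "\<exists>T. C \<subseteq> T \<and> T \<subseteq> J \<and> csize Z T \<le> s"
  then obtain T where T: "C \<subseteq> T" "T \<subseteq> J" "csize Z T \<le> s" by auto
  have "card (rows_out Z T) \<le> s - card T" "s - card T \<le> card I" using T s by (auto simp: csize_def)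
  then obtain R where R: "rows_out Z T \<subseteq> R" "R \<subseteq> I" "card R = s - card T"
    using exists_subset_between[OF _ _ rows_out_subset[OF Z] finI] by blast
  have "card T \<le> s" using T(3) by (simp add: csize_def)
  then have "cover I J Z s R T" using R T by (auto simp: cover_def rows_out_def)
  then show "pcover I J Z s {} C" using T unfolding pcover_def by blast
qed

text \<open>The new zero destroys (R, C) iff \<open>c\<close> is not in \<open>C\<close>,
  \<open>i\<close> is not in \<open>R\<close>, and \<open>insert i R\<close> with \<open>C\<close>
  is no longer a partial cover. For fixed \<open>C\<close>, summing over \<open>i\<close> is then an
  instance of \<open>down_closed_boundary\<close>.\<close>

lemma cformula_column:
  fixes I :: "'r set" and J :: "'c set"
  assumes fin: "finite I" "finite J" and c: "c \<in> J" "c \<notin> snd ` Z" and s: "s < card I"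
  shows "(\<Sum>i\<in>I. cformula I J Z s - cformula I J (insert (i, c) Z) s) =
    urn (J - {c}) (pcover I J Z s {}) {}"
proof -
  let ?m = "card I" and ?n = "card J"
  let ?P = "pcover I J Z s"
  have key: "?P R C \<and> \<not> pcover I J (insert (i, c) Z) s R C \<longleftrightarrow>
      c \<notin> C \<and> i \<notin> R \<and> ?P R C \<and> \<not> ?P (insert i R) C" if i: "i \<in> I" for i R C
  proof
    assume *: "?P R C \<and> \<not> pcover I J (insert (i, c) Z) s R C"
    then obtain R' C' where RC: "cover I J Z s R' C'" "R \<subseteq> R'" "C \<subseteq> C'" by (auto simp: pcover_def)
    have no: False if "cover I J Z s R' C'" "R \<subseteq> R'" "C \<subseteq> C'" "i \<in> R' \<or> c \<in> C'" for R' C'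
    proof -
      have "cover I J (insert (i, c) Z) s R' C'" using that by (auto simp: cover_def)
      then show False using that * unfolding pcover_def by blast
    qed
    have "c \<notin> C" "i \<notin> R" using no[OF RC] RC by auto
    moreover have "\<not> ?P (insert i R) C" unfolding pcover_def using no by blast
    ultimately show "c \<notin> C \<and> i \<notin> R \<and> ?P R C \<and> \<not> ?P (insert i R) C" using * by simp
  next
    assume *: "c \<notin> C \<and> i \<notin> R \<and> ?P R C \<and> \<not> ?P (insert i R) C"
    have "\<not> pcover I J (insert (i, c) Z) s R C"
    proof
      assume "pcover I J (insert (i, c) Z) s R C"
      then obtain R' C' where RC: "cover I J (insert (i, c) Z) s R' C'" "R \<subseteq> R'" "C \<subseteq> C'"
        by (auto simp: pcover_def)
      have fR: "finite R'" "finite C'" using RC(1) fin by (auto simp: cover_def intro: finite_subset)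
      show False
      proof (cases "i \<in> R'")
        case True
        then have "cover I J Z s R' C'" "insert i R \<subseteq> R'" using RC by (auto simp: cover_def)
        then show False using * RC(3) unfolding pcover_def by blast
      next
        case False
        \<comment> \<open>A cover that catches (i, c) by its column may trade \<open>c\<close> for
          the row \<open>i\<close>: column \<open>c\<close> has no zeros in \<open>Z\<close>, so
          nothing else is uncovered and the size stays \<open>s\<close>.\<close>
        then have "c \<in> C'" using RC(1) by (auto simp: cover_def)
        then have "card (insert i R') + card (C' - {c}) = s"
          using RC(1) fR False card_Suc_Diff1[of C' c] by (simp add: cover_def)
        then have "cover I J Z s (insert i R') (C' - {c})"
          using RC(1) i c(2) by (force simp: cover_def)
        moreover have "insert i R \<subseteq> insert i R'" "C \<subseteq> C' - {c}" using RC * by auto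
        ultimately show False using * unfolding pcover_def by blast
      qed
    qed
    then show "?P R C \<and> \<not> pcover I J (insert (i, c) Z) s R C" using * by simp
  qed
  have mono: "?P R C" if "pcover I J (insert (i, c) Z) s R C" for i R C
    using that unfolding pcover_def cover_def by blast
  have finR: "finite {R. R \<subseteq> I \<and> Q R}" for Q using fin(1) by simp
  have "cformula I J Z s - cformula I J (insert (i, c) Z) s =
    (\<Sum>C\<in>Pow (J - {c}). wt ?n (card C) *
       (\<Sum>R | R \<subseteq> I \<and> i \<notin> R \<and> ?P R C \<and> \<not> ?P (insert i R) C. wt ?m (card R)))" if i: "i \<in> I" for i
  proof -
    have "cformula I J Z s - cformula I J (insert (i, c) Z) s =
      (\<Sum>C\<in>Pow J. (\<Sum>R | R \<subseteq> I \<and> ?P R C. wt ?m (card R) * wt ?n (card C)) -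
        (\<Sum>R | R \<subseteq> I \<and> pcover I J (insert (i, c) Z) s R C. wt ?m (card R) * wt ?n (card C)))"
      unfolding cformula_def by (rule sum_subtractf[symmetric])
    also have "\<dots> = (\<Sum>C\<in>Pow J. \<Sum>R | R \<subseteq> I \<and> c \<notin> C \<and> i \<notin> R \<and> ?P R C \<and> \<not> ?P (insert i R) C.
        wt ?m (card R) * wt ?n (card C))"
    proof (rule sum.cong)
      fix C
      have "{R. R \<subseteq> I \<and> c \<notin> C \<and> i \<notin> R \<and> ?P R C \<and> \<not> ?P (insert i R) C} =
        {R. R \<subseteq> I \<and> ?P R C} - {R. R \<subseteq> I \<and> pcover I J (insert (i, c) Z) s R C}"
        using key[OF i, of _ C] by blast
      moreover have "{R. R \<subseteq> I \<and> pcover I J (insert (i, c) Z) s R C} \<subseteq> {R. R \<subseteq> I \<and> ?P R C}"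
        using mono by blast
      ultimately show "(\<Sum>R | R \<subseteq> I \<and> ?P R C. wt ?m (card R) * wt ?n (card C)) -
        (\<Sum>R | R \<subseteq> I \<and> pcover I J (insert (i, c) Z) s R C. wt ?m (card R) * wt ?n (card C)) =
        (\<Sum>R | R \<subseteq> I \<and> c \<notin> C \<and> i \<notin> R \<and> ?P R C \<and> \<not> ?P (insert i R) C.
          wt ?m (card R) * wt ?n (card C))"
        using finR by (simp add: sum_diff)
    qed simp
    also have "\<dots> = (\<Sum>C\<in>Pow (J - {c}). \<Sum>R | R \<subseteq> I \<and> c \<notin> C \<and> i \<notin> R \<and> ?P R C \<and> \<not> ?P (insert i R) C.
        wt ?m (card R) * wt ?n (card C))"
      using fin by (intro sum.mono_neutral_right) (auto intro!: sum.neutral)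
    also have "\<dots> = (\<Sum>C\<in>Pow (J - {c}). wt ?n (card C) *
       (\<Sum>R | R \<subseteq> I \<and> i \<notin> R \<and> ?P R C \<and> \<not> ?P (insert i R) C. wt ?m (card R)))"
      unfolding sum_distrib_left by (intro sum.cong) (auto simp: mult.commute)
    finally show ?thesis .
  qed
  then have "(\<Sum>i\<in>I. cformula I J Z s - cformula I J (insert (i, c) Z) s) =
    (\<Sum>i\<in>I. \<Sum>C\<in>Pow (J - {c}). wt ?n (card C) *
       (\<Sum>R | R \<subseteq> I \<and> i \<notin> R \<and> ?P R C \<and> \<not> ?P (insert i R) C. wt ?m (card R)))" by simp
  also have "\<dots> = (\<Sum>C\<in>Pow (J - {c}). wt ?n (card C) *
       (\<Sum>i\<in>I. \<Sum>R | R \<subseteq> I \<and> i \<notin> R \<and> ?P R C \<and> \<not> ?P (insert i R) C. wt ?m (card R)))"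
    unfolding sum_distrib_left by (rule sum.swap)
  also have "\<dots> = (\<Sum>C\<in>Pow (J - {c}). wt ?n (card C) * of_bool (?P {} C))"
  proof (intro sum.cong refl arg_cong2[where f = "(*)"])
    fix C
    show "(\<Sum>i\<in>I. \<Sum>R | R \<subseteq> I \<and> i \<notin> R \<and> ?P R C \<and> \<not> ?P (insert i R) C. wt ?m (card R)) =
      of_bool (?P {} C)"
    proof (rule down_closed_boundary[OF fin(1)])
      show "?P R C" if "R \<subseteq> S" "?P S C" for R S using pcover_mono[OF that(2,1)] by simp
      show "card R < ?m" if "?P R C" for R using pcover_card[OF fin that] s by simp
    qed
  qed
  also have "\<dots> = urn (J - {c}) (?P {}) {}"
  proof -
    \<comment> \<open>The column \<open>c\<close> is the further element of the urn, so the weights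
      on \<open>J - {c}\<close> are those for \<open>card J\<close> elements.\<close>
    have "card (J - {c}) + 1 = ?n" using c(1) fin by (simp add: card_gt_0_iff Suc_leI card_Diff_singleton)
         (metis Suc_pred card_gt_0_iff empty_iff)
    then show ?thesis
      unfolding urn_def using fin by (auto simp: sum.inter_filter[symmetric] Pow_def of_bool_def mult.commute if_distrib cong: if_cong intro!: sum.cong)
  qed
  finally show ?thesis .
qed

text \<open>A row with more than \<open>Suc s\<close> zeros lies in every cover of size
  \<open>Suc s\<close>. So partial covers come in pairs, with and without \<open>i\<close>, and
  \<open>wt_split\<close> merges each pair into one of the smaller matrix.\<close>

lemma cformula_row:
  fixes I :: "'r set" and J :: "'c set"
  assumes fin: "finite I" "finite J" and i: "i \<in> I" and full: "Suc s < card {c. (i, c) \<in> Z}"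
    and s: "Suc s < card I"
  shows "cformula I J Z (Suc s) = cformula (I - {i}) J {p \<in> Z. fst p \<noteq> i} s"
proof -
  let ?m = "card I" and ?n = "card J" and ?Z = "{p \<in> Z. fst p \<noteq> i}"
  have cov: "i \<in> R" if "cover I J Z (Suc s) R C" for R C
  proof (rule ccontr)
    assume "i \<notin> R"
    then have "{c. (i, c) \<in> Z} \<subseteq> C" using that by (auto simp: cover_def)
    then have "card {c. (i, c) \<in> Z} \<le> card C"
      using that fin by (intro card_mono) (auto simp: cover_def intro: finite_subset)
    then show False using that full by (simp add: cover_def)
  qed
  have pc: "pcover I J Z (Suc s) R C \<longleftrightarrow> pcover (I - {i}) J ?Z s (R - {i}) C" for R C
  proof
    assume "pcover I J Z (Suc s) R C"
    then obtain R' C' where RC: "cover I J Z (Suc s) R' C'" "R \<subseteq> R'" "C \<subseteq> C'" by (auto simp: pcover_def)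
    have "finite R'" using RC(1) fin by (auto simp: cover_def intro: finite_subset)
    then have "cover (I - {i}) J ?Z s (R' - {i}) C'"
      using RC(1) cov[OF RC(1)] card_Suc_Diff1[of R' i] by (auto simp: cover_def)
    then show "pcover (I - {i}) J ?Z s (R - {i}) C" using RC unfolding pcover_def by blast
  next
    assume "pcover (I - {i}) J ?Z s (R - {i}) C"
    then obtain R' C' where RC: "cover (I - {i}) J ?Z s R' C'" "R - {i} \<subseteq> R'" "C \<subseteq> C'"
      by (auto simp: pcover_def)
    have "finite R'" "i \<notin> R'" using RC(1) fin by (auto simp: cover_def intro: finite_subset)
    then have "cover I J Z (Suc s) (insert i R') C'" using RC(1) i by (auto simp: cover_def)
    then show "pcover I J Z (Suc s) R C" using RC unfolding pcover_def by blast
  qed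
  have "(\<Sum>R | R \<subseteq> I \<and> pcover I J Z (Suc s) R C. wt ?m (card R) * wt ?n (card C)) =
    (\<Sum>R | R \<subseteq> I - {i} \<and> pcover (I - {i}) J ?Z s R C. wt (card (I - {i})) (card R) * wt ?n (card C))"
    for C
  proof -
    define A where "A = {R. R \<subseteq> I - {i} \<and> pcover (I - {i}) J ?Z s R C}"
    have finA: "finite A" unfolding A_def using fin by simp
    have inj: "inj_on (insert i) A" by (auto simp: inj_on_def A_def)
    have "{R. R \<subseteq> I \<and> pcover I J Z (Suc s) R C} = A \<union> insert i ` A"
    proof (intro equalityI subsetI)
      fix R assume "R \<in> {R. R \<subseteq> I \<and> pcover I J Z (Suc s) R C}"
      then have "R - {i} \<in> A" by (auto simp: A_def pc)
      moreover have "R = R - {i} \<or> R = insert i (R - {i})" by auto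
      ultimately show "R \<in> A \<union> insert i ` A" by (metis UnI1 UnI2 imageI)
    qed (use i in \<open>auto simp: A_def pc intro: pcover_mono\<close>)
    moreover have "A \<inter> insert i ` A = {}" by (auto simp: A_def)
    ultimately have "(\<Sum>R | R \<subseteq> I \<and> pcover I J Z (Suc s) R C. wt ?m (card R) * wt ?n (card C)) =
      (\<Sum>R\<in>A. wt ?m (card R) * wt ?n (card C)) + (\<Sum>R\<in>insert i ` A. wt ?m (card R) * wt ?n (card C))"
      using finA by (simp add: sum.union_disjoint)
    also have "\<dots> = (\<Sum>R\<in>A. (wt ?m (card R) + wt ?m (Suc (card R))) * wt ?n (card C))"
    proof -
      have "card (insert i R) = Suc (card R)" if "R \<in> A" for R
        using that fin by (subst card_insert_disjoint) (auto simp: A_def intro: finite_subset)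
      then show ?thesis by (simp add: sum.reindex[OF inj] sum.distrib distrib_right)
    qed
    also have "\<dots> = (\<Sum>R\<in>A. wt (card (I - {i})) (card R) * wt ?n (card C))"
    proof (rule sum.cong)
      fix R assume "R \<in> A"
      then have "card R \<le> s" using pcover_card[of "I - {i}" J ?Z s R C] fin by (simp add: A_def)
      then show "(wt ?m (card R) + wt ?m (Suc (card R))) * wt ?n (card C) =
        wt (card (I - {i})) (card R) * wt ?n (card C)"
        using s i fin by (subst wt_split) (auto simp: card_Diff_singleton)
    qed simp
    finally show ?thesis by (simp only: A_def)
  qed
  then show ?thesis by (simp add: cformula_def)
qed

section \<open>Independent exponential variables\<close>

definition expm :: "real measure" where
  "expm = density lborel (exponential_density 1)"

lemma sets_expm [simp, measurable_cong]: "sets expm = sets borel"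
  by (simp add: expm_def)

lemma space_expm [simp]: "space expm = UNIV"
  by (simp add: expm_def)

lemma prob_space_expm: "prob_space expm"
  unfolding expm_def by (rule prob_space_exponential_density) simp

lemma AE_expm_pos: "AE x in expm. 0 < x"
  unfolding expm_def using AE_lborel_singleton[of "0::real"]
  by (subst AE_density) (auto elim!: eventually_mono simp: exponential_density_def)

lemma AE_expm_neq: "AE x in expm. x \<noteq> c"
  unfolding expm_def using AE_lborel_singleton[of c]
  by (subst AE_density) (auto elim!: eventually_mono)

lemma expm_tail:
  assumes "0 \<le> t"
  shows "emeasure expm {t..} = ennreal (exp (- t))"
proof -
  have "emeasure expm {t..} = (\<integral>\<^sup>+x. ennreal (exponential_density 1 x) * indicator {t..} x \<partial>lborel)"
    unfolding expm_def by (subst emeasure_density) auto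
  also have "\<dots> = (\<integral>\<^sup>+x. ennreal (exp (- x)) * indicator {t..} x \<partial>lborel)"
    using assms by (intro nn_integral_cong) (auto simp: indicator_def exponential_density_def)
  also have "\<dots> = 0 - (- exp (- t))"
  proof (rule nn_integral_FTC_atLeast)
    show "((\<lambda>x. - exp (- x)) \<longlongrightarrow> (0::real)) at_top" by real_asymp
  qed (auto intro!: derivative_eq_intros)
  finally show ?thesis by simp
qed

text \<open>\<open>ennreal\<close> cuts off negative values, so this is the mean of the positive
  part of \<open>x - t\<close>; at \<open>t = 0\<close> it is the mean of the variable.\<close>

lemma expm_excess:
  assumes "0 \<le> t"
  shows "(\<integral>\<^sup>+x. ennreal (x - t) \<partial>expm) = ennreal (exp (- t))"
proof -
  have "(\<integral>\<^sup>+x. ennreal (x - t) \<partial>expm) =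
    (\<integral>\<^sup>+x. ennreal (exponential_density 1 x) * ennreal (x - t) \<partial>lborel)"
    unfolding expm_def by (subst nn_integral_density) auto
  also have "\<dots> = (\<integral>\<^sup>+x. ennreal ((x - t) * exp (- x)) * indicator {t..} x \<partial>lborel)"
    using assms by (intro nn_integral_cong)
      (auto simp: indicator_def exponential_density_def ennreal_mult[symmetric] ennreal_neg mult.commute)
  also have "\<dots> = ennreal (0 - (- (t - t + 1) * exp (- t)))"
  proof (rule nn_integral_FTC_atLeast[where F = "\<lambda>x. - (x - t + 1) * exp (- x)"])
    show "((\<lambda>x. - (x - t + 1) * exp (- x)) \<longlongrightarrow> (0::real)) at_top" by real_asymp
  qed (auto intro!: derivative_eq_intros simp: algebra_simps)
  finally show ?thesis by simp
qed

text \<open>For nonnegative \<open>t\<close> write x as its excess over \<open>t\<close> plus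
  \<open>min x t\<close>. The mean is 1, and the mean excess exp(-t) equals the tail probability.
  The \<open>max 0\<close> covers negative \<open>t\<close>, where both sides vanish.\<close>

lemma expm_min: "(\<integral>\<^sup>+x. ennreal (min x (max 0 t)) \<partial>expm) = emeasure expm {..<t}"
proof (cases "0 \<le> t")
  case True
  interpret prob_space expm by (rule prob_space_expm)
  have "ennreal (exp (- t)) + (\<integral>\<^sup>+x. ennreal (min x t) \<partial>expm) =
    (\<integral>\<^sup>+x. ennreal (x - t) + ennreal (min x t) \<partial>expm)"
    using expm_excess[OF True] by (subst nn_integral_add) auto
  also have "\<dots> = (\<integral>\<^sup>+x. ennreal (x - 0) \<partial>expm)"
    using AE_expm_pos
  proof (intro nn_integral_cong_AE, eventually_elim)
    fix x :: real assume "0 < x"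
    then show "ennreal (x - t) + ennreal (min x t) = ennreal (x - 0)"
      using True by (cases "t \<le> x") (auto simp: ennreal_plus[symmetric] ennreal_neg simp del: ennreal_plus)
  qed
  also have "\<dots> = 1" using expm_excess[of 0] by simp
  also have "1 = emeasure expm ({t..} \<union> {..<t})"
  proof -
    have "{t..} \<union> {..<t} = UNIV" by auto
    then show ?thesis using emeasure_space_1 by simp
  qed
  also have "\<dots> = ennreal (exp (- t)) + emeasure expm {..<t}"
    using expm_tail[OF True] by (subst plus_emeasure[symmetric]) auto
  finally have "(\<integral>\<^sup>+x. ennreal (min x t) \<partial>expm) = emeasure expm {..<t}"
    by (simp add: ennreal_add_left_cancel)
  then show ?thesis using True by simp
next
  case False
  have "(\<integral>\<^sup>+x. ennreal (min x 0) \<partial>expm) = 0"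
    by (simp add: ennreal_neg)
  moreover have "AE x in expm. \<not> x < t" using AE_expm_pos by eventually_elim (use False in simp)
  then have "emeasure expm {..<t} = 0"
    using AE_iff_measurable[of "{..<t}" expm "\<lambda>x. \<not> x < t"] by (simp add: lessThan_def)
  ultimately show ?thesis using False by simp
qed

definition exp_space :: "'i set \<Rightarrow> ('i \<Rightarrow> real) measure" where
  "exp_space N = PiM N (\<lambda>_. expm)"

lemma prob_space_exp_space: "prob_space (exp_space N)"
  unfolding exp_space_def by (intro prob_space_PiM prob_space_expm)

lemma measurable_exp_coord:
  assumes "p \<in> N"
  shows "(\<lambda>w. w p) \<in> borel_measurable (exp_space N)"
proof -
  have "(\<lambda>w. w p) \<in> measurable (exp_space N) expm"
    unfolding exp_space_def using assms by (rule measurable_component_singleton)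
  then show ?thesis by (simp cong: measurable_cong_sets)
qed

lemma AE_exp_pos:
  assumes "finite N"
  shows "AE w in exp_space N. \<forall>p\<in>N. 0 < w p"
  unfolding exp_space_def
  by (intro AE_finite_allI[OF assms] AE_PiM_component[where M="\<lambda>_. expm" and P="\<lambda>x. 0 < x"] prob_space_expm AE_expm_pos)

lemma exp_space_resample:
  assumes "p \<in> N"
  shows "distr (expm \<Otimes>\<^sub>M exp_space N) (exp_space N) (\<lambda>(x, w). w(p := x)) = exp_space N"
  using distr_pair_PiM_eq_PiM[of N "\<lambda>_. expm" p] assms prob_space_expm
  by (simp add: exp_space_def insert_absorb)

lemma measurable_resample:
  assumes "p \<in> N"
  shows "(\<lambda>(x, w). w(p := x)) \<in> measurable (expm \<Otimes>\<^sub>M exp_space N) (exp_space N)"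
  unfolding exp_space_def case_prod_beta
  by (rule measurable_fun_upd[where J = N]) (use assms in auto)

lemma exp_space_permute:
  assumes "inj_on \<pi> N" "\<pi> ` N \<subseteq> N"
  shows "distr (exp_space N) (exp_space N) (\<lambda>w. \<lambda>n\<in>N. w (\<pi> n)) = exp_space N"
  using distr_PiM_reindex[of N "\<lambda>_. expm" \<pi> N] assms prob_space_expm
  by (simp add: exp_space_def image_subset_iff_funcset)

lemma measurable_permute:
  assumes "\<pi> ` N \<subseteq> N"
  shows "(\<lambda>w. \<lambda>n\<in>N. w (\<pi> n)) \<in> measurable (exp_space N) (exp_space N)"
  unfolding exp_space_def using assms by (intro measurable_restrict measurable_component_singleton) auto

text \<open>Fubini for a single coordinate: \<open>p\<close> is overwritten by an independent copy,
  so the index set need not be split.\<close>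

lemma nn_integral_resample:
  assumes p: "p \<in> N" and f: "f \<in> borel_measurable (exp_space N)"
  shows "(\<integral>\<^sup>+w. f w \<partial>exp_space N) = (\<integral>\<^sup>+w. (\<integral>\<^sup>+x. f (w(p := x)) \<partial>expm) \<partial>exp_space N)"
proof -
  interpret E: prob_space expm by (rule prob_space_expm)
  interpret O: prob_space "exp_space N" by (rule prob_space_exp_space)
  interpret P: pair_sigma_finite expm "exp_space N" ..
  have f': "f \<in> borel_measurable (distr (expm \<Otimes>\<^sub>M exp_space N) (exp_space N) (\<lambda>(x, w). w(p := x)))"
    using f by simp
  have m: "(\<lambda>(x, w). f (w(p := x))) \<in> borel_measurable (expm \<Otimes>\<^sub>M exp_space N)"
    using measurable_compose[OF measurable_resample[OF p] f] by (simp add: case_prod_beta)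
  have "(\<integral>\<^sup>+w. f w \<partial>exp_space N) =
    (\<integral>\<^sup>+z. (\<lambda>(x, w). f (w(p := x))) z \<partial>(expm \<Otimes>\<^sub>M exp_space N))"
    by (subst exp_space_resample[OF p, symmetric], subst nn_integral_distr[OF measurable_resample[OF p] f'])
       (simp only: case_prod_beta')
  also have "\<dots> = (\<integral>\<^sup>+w. (\<integral>\<^sup>+x. f (w(p := x)) \<partial>expm) \<partial>exp_space N)"
    using P.nn_integral_snd[OF m] by simp
  finally show ?thesis .
qed

lemma AE_resample:
  assumes p: "p \<in> N" and P: "{w \<in> space (exp_space N). \<not> P w} \<in> sets (exp_space N)"
    and ae: "\<And>w. AE x in expm. P (w(p := x))"
  shows "AE w in exp_space N. P w"
proof -
  let ?A = "{w \<in> space (exp_space N). \<not> P w}"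
  have "emeasure (exp_space N) ?A = (\<integral>\<^sup>+w. indicator ?A w \<partial>exp_space N)" using P by simp
  also have "\<dots> = (\<integral>\<^sup>+w. (\<integral>\<^sup>+x. indicator ?A (w(p := x)) \<partial>expm) \<partial>exp_space N)"
    using P by (intro nn_integral_resample[OF p]) auto
  also have "\<dots> = (\<integral>\<^sup>+w. (\<integral>\<^sup>+x. 0 \<partial>expm) \<partial>exp_space N)"
  proof (rule nn_integral_cong)
    fix w
    show "(\<integral>\<^sup>+x. indicator ?A (w(p := x)) \<partial>expm) = (\<integral>\<^sup>+x. 0 \<partial>expm)"
      using ae[of w] by (intro nn_integral_cong_AE) (auto elim!: eventually_mono)
  qed
  finally have "emeasure (exp_space N) ?A = 0" by simp
  then show ?thesis using P by (subst AE_iff_measurable[OF _ refl]) auto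
qed

text \<open>With the other coordinates fixed, \<theta> is a constant and \<open>expm_min\<close>
  applies to coordinate \<open>p\<close>.\<close>

lemma exp_space_min:
  assumes p: "p \<in> N" and \<theta>: "\<theta> \<in> borel_measurable (exp_space N)"
    and indep: "\<And>w x. \<theta> (w(p := x)) = \<theta> w"
  shows "(\<integral>\<^sup>+w. ennreal (min (w p) (max 0 (\<theta> w))) \<partial>exp_space N) =
    emeasure (exp_space N) {w \<in> space (exp_space N). w p < \<theta> w}"
proof -
  note [measurable] = \<theta> measurable_exp_coord[OF p]
  let ?A = "{w \<in> space (exp_space N). w p < \<theta> w}"
  have A: "?A \<in> sets (exp_space N)" by measurable
  have sp: "w(p := x) \<in> space (exp_space N)" if "w \<in> space (exp_space N)" for w x
    using that p by (auto simp: exp_space_def space_PiM PiE_def extensional_def)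
  have "(\<integral>\<^sup>+w. ennreal (min (w p) (max 0 (\<theta> w))) \<partial>exp_space N) =
    (\<integral>\<^sup>+w. (\<integral>\<^sup>+x. ennreal (min x (max 0 (\<theta> w))) \<partial>expm) \<partial>exp_space N)"
    by (subst nn_integral_resample[OF p]) (simp_all add: indep)
  also have "\<dots> = (\<integral>\<^sup>+w. (\<integral>\<^sup>+x. indicator ?A (w(p := x)) \<partial>expm) \<partial>exp_space N)"
  proof (rule nn_integral_cong)
    fix w assume w: "w \<in> space (exp_space N)"
    have "indicator ?A (w(p := x)) = (indicator {..<\<theta> w} x :: ennreal)" for x
      using sp[OF w, of x] by (simp add: indicator_def indep)
    then show "(\<integral>\<^sup>+x. ennreal (min x (max 0 (\<theta> w))) \<partial>expm) = (\<integral>\<^sup>+x. indicator ?A (w(p := x)) \<partial>expm)"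
      by (simp add: expm_min)
  qed
  also have "\<dots> = (\<integral>\<^sup>+w. indicator ?A w \<partial>exp_space N)"
    using A by (intro nn_integral_resample[OF p, symmetric]) auto
  finally show ?thesis using A by simp
qed

text \<open>If \<open>F\<close> and \<open>G\<close> differ, some coordinate occurs in only one of
  the sums; given the others, equality pins it to a single value, a null event.\<close>

lemma AE_sums_distinct:
  fixes N :: "'i set"
  assumes N: "finite N"
  shows "AE w in exp_space N. \<forall>F\<in>Pow N. \<forall>G\<in>Pow N. sum w F = sum w G \<longrightarrow> F = G"
proof -
  have main: "AE w in exp_space N. sum w F \<noteq> sum w G" if FG: "F \<subseteq> N" "G \<subseteq> N" "p \<in> F - G" for F G p
  proof (rule AE_resample)
    show p: "p \<in> N" using FG by auto
    have fin: "finite F" "finite G" using FG N by (auto intro: finite_subset)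
    have [measurable]: "(\<lambda>w. sum w F) \<in> borel_measurable (exp_space N)"
      "(\<lambda>w. sum w G) \<in> borel_measurable (exp_space N)"
      using FG by (auto intro!: borel_measurable_sum measurable_exp_coord)
    show "{w \<in> space (exp_space N). \<not> sum w F \<noteq> sum w G} \<in> sets (exp_space N)" by simp
    fix w :: "'i \<Rightarrow> real"
    show "AE x in expm. sum (w(p := x)) F \<noteq> sum (w(p := x)) G"
      using AE_expm_neq[of "sum w G - sum w (F - {p})"]
    proof eventually_elim
      case (elim x)
      have "sum (w(p := x)) F = x + sum w (F - {p})"
        using fin FG by (subst sum.remove[of F p]) (auto intro!: sum.cong)
      moreover have "sum (w(p := x)) G = sum w G" using FG by (intro sum.cong) auto
      ultimately show ?case using elim by linarith
    qed
  qed
  have "AE w in exp_space N. sum w F = sum w G \<longrightarrow> F = G" if FG: "F \<in> Pow N" "G \<in> Pow N" for F G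
  proof (cases "F = G")
    case False
    then obtain p where "p \<in> F - G \<or> p \<in> G - F" by auto
    then have "AE w in exp_space N. sum w F \<noteq> sum w G"
    proof
      assume "p \<in> G - F"
      then have "AE w in exp_space N. sum w G \<noteq> sum w F" using main FG by simp
      then show ?thesis by eventually_elim simp
    qed (use main FG in simp)
    then show ?thesis by eventually_elim simp
  qed simp
  then show ?thesis using N by (intro AE_finite_allI) auto
qed

section \<open>Random cost matrices\<close>

text \<open>One sample \<open>w\<close> serves all zero sets: setting an entry to 0 means enlarging
  \<open>Z\<close> and leaves the probability space alone.\<close>

definition cost_mat :: "'i set \<Rightarrow> ('i \<Rightarrow> real) \<Rightarrow> 'i \<Rightarrow> real" where
  "cost_mat Z w p = (if p \<in> Z then 0 else w p)"

definition mincost :: "nat \<Rightarrow> 'r set \<Rightarrow> 'c set \<Rightarrow> ('r \<times> 'c \<Rightarrow> real) \<Rightarrow> real" where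
  "mincost k I J a = Min (sum a ` asgs k I J)"

lemma asgs_nonempty:
  assumes "finite I" "finite J" "k \<le> card I" "k \<le> card J"
  shows "asgs k I J \<noteq> {}"
proof -
  obtain I' J' where *: "I' \<subseteq> I" "card I' = k" "J' \<subseteq> J" "card J' = k"
    using assms by (meson obtain_subset_with_card_n)
  then have "finite I'" "finite J'" using assms by (auto intro: finite_subset)
  then obtain f where f: "bij_betw f I' J'" using * by (metis finite_same_card_bij)
  have "(\<lambda>i. (i, f i)) ` I' \<in> asgs k I J"
    using f * unfolding asgs_def matching_def
    by (auto simp: bij_betw_def inj_on_def card_image image_iff)
  then show ?thesis by auto
qed

lemma mincost_eqI: "finite I \<Longrightarrow> finite J \<Longrightarrow> is_opt k I J a \<sigma> \<Longrightarrow> mincost k I J a = sum a \<sigma>"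
  unfolding mincost_def is_opt_def using finite_asgs[of I J k]
  by (intro Min_eqI) auto

lemma ex_is_opt:
  assumes "finite I" "finite J" "k \<le> card I" "k \<le> card J"
  obtains \<sigma> where "is_opt k I J a \<sigma>"
  using ex_opt[OF assms(1,2) asgs_nonempty[OF assms], of a] unfolding is_opt_def by metis

lemma sum_cost_mat: "finite S \<Longrightarrow> sum (cost_mat Z w) S = sum w (S - Z)"
  by (simp add: cost_mat_def sum.If_cases Diff_eq)

lemma pred_le_real:
  fixes f g :: "'a \<Rightarrow> real"
  assumes [measurable]: "f \<in> borel_measurable M" "g \<in> borel_measurable M"
  shows "Measurable.pred M (\<lambda>x. f x \<le> g x)"
  by measurable

text \<open>\<open>N\<close> may exceed the set of nonzero positions, so the same space remains in
  use after zeros are inserted or a row is deleted.\<close>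

locale random_pattern = zero_pattern +
  fixes N and k :: nat
  assumes finN: "finite N" and N: "I \<times> J - Z \<subseteq> N" and k: "k \<le> card I" "k \<le> card J"
begin

sublocale Om: prob_space "exp_space N"
  by (rule prob_space_exp_space)

lemma measurable_cost [measurable]:
  assumes "S \<subseteq> I \<times> J"
  shows "(\<lambda>w. sum (cost_mat Z w) S) \<in> borel_measurable (exp_space N)"
proof -
  have "(\<lambda>w. cost_mat Z w p) \<in> borel_measurable (exp_space N)" if "p \<in> S" for p
    using that assms N measurable_exp_coord[of p N] by (cases "p \<in> Z") (auto simp: cost_mat_def)
  then show ?thesis by (rule borel_measurable_sum)
qed

lemma measurable_cost_asgs:
  assumes "\<sigma> \<in> asgs q I' J" "I' \<subseteq> I"
  shows "(\<lambda>w. sum (cost_mat Z w) \<sigma>) \<in> borel_measurable (exp_space N)"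
  using assms by (intro measurable_cost) (auto simp: asgs_def)

lemma measurable_opt_cols:
  assumes "I' \<subseteq> I"
  shows "Measurable.pred (exp_space N) (\<lambda>w. opt_cols q I' J (cost_mat Z w) T)"
proof -
  have fin: "finite (asgs q I' J)" using assms finI finJ by (intro finite_asgs) (auto intro: finite_subset)
  show ?thesis unfolding opt_cols_def using fin
    by (intro pred_intros_finite pred_intros_logic pred_le_real measurable_cost_asgs[OF _ assms]) auto
qed

lemma measurable_stage: "Measurable.pred (exp_space N) (\<lambda>w. stage (cost_mat Z w) S)"
  unfolding stage_def by (rule measurable_opt_cols) auto

lemma measurable_is_opt: "Measurable.pred (exp_space N) (\<lambda>w. is_opt k I J (cost_mat Z w) \<sigma>)"
proof (cases "\<sigma> \<in> asgs k I J")
  case True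
  show ?thesis unfolding is_opt_def using True finite_asgs[OF finI finJ]
    by (intro pred_intros_finite pred_intros_logic pred_le_real measurable_cost_asgs[OF _ subset_refl])
       auto
qed (simp add: is_opt_def)

lemma measurable_mincost: "(\<lambda>w. mincost k I J (cost_mat Z w)) \<in> borel_measurable (exp_space N)"
  unfolding mincost_def using finite_asgs[OF finI finJ] measurable_cost_asgs[OF _ subset_refl]
  by (intro borel_measurable_Min) auto

lemma AE_cost_mat: "AE w in exp_space N. (\<forall>p\<in>I \<times> J. 0 \<le> cost_mat Z w p) \<and> generic Z (I \<times> J) (cost_mat Z w)"
  using AE_exp_pos[OF finN] AE_sums_distinct[OF finN]
proof eventually_elim
  case (elim w)
  have "0 \<le> cost_mat Z w p" if "p \<in> I \<times> J" for p
    using elim(1) that N by (cases "p \<in> Z") (auto simp: cost_mat_def intro: less_imp_le)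
  moreover have "\<sigma> - Z = \<tau> - Z"
    if "\<sigma> \<subseteq> I \<times> J" "\<tau> \<subseteq> I \<times> J" "sum (cost_mat Z w) \<sigma> = sum (cost_mat Z w) \<tau>" for \<sigma> \<tau>
  proof -
    have "finite \<sigma>" "finite \<tau>" using that finI finJ by (meson finite_SigmaI finite_subset)+
    then have "sum w (\<sigma> - Z) = sum w (\<tau> - Z)" using that(3) by (simp add: sum_cost_mat)
    moreover have "\<sigma> - Z \<in> Pow N" "\<tau> - Z \<in> Pow N" using that N by auto
    ultimately show ?thesis using elim(2) by blast
  qed
  ultimately show ?case by (auto simp: generic_def)
qed

lemma integrable_mincost: "integrable (exp_space N) (\<lambda>w. mincost k I J (cost_mat Z w))"
proof -
  have int: "integrable (exp_space N) (\<lambda>w. w p)" if "p \<in> N" for p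
  proof (rule integrableI_nonneg)
    show "(\<lambda>w. w p) \<in> borel_measurable (exp_space N)" using that by (rule measurable_exp_coord)
    show "AE w in exp_space N. 0 \<le> w p"
      using AE_exp_pos[OF finN] by eventually_elim (use that in \<open>auto intro: less_imp_le\<close>)
    have "(\<integral>\<^sup>+w. ennreal (w p) \<partial>exp_space N) = (\<integral>\<^sup>+w. (\<integral>\<^sup>+x. ennreal (x - 0) \<partial>expm) \<partial>exp_space N)"
      using that measurable_exp_coord[OF that] by (subst nn_integral_resample[OF that]) auto
    also have "\<dots> = 1" using expm_excess[of 0] Om.emeasure_space_1 by simp
    finally show "(\<integral>\<^sup>+w. ennreal (w p) \<partial>exp_space N) < \<infinity>" by simp
  qed
  have "integrable (exp_space N) (\<lambda>w. \<Sum>p\<in>N. w p)" using int by (rule Bochner_Integration.integrable_sum)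
  then show ?thesis
  proof (rule Bochner_Integration.integrable_bound[OF _ measurable_mincost])
    show "AE w in exp_space N. norm (mincost k I J (cost_mat Z w)) \<le> norm (\<Sum>p\<in>N. w p)"
      using AE_exp_pos[OF finN] AE_cost_mat
    proof eventually_elim
      case (elim w)
      obtain \<sigma> where \<sigma>: "is_opt k I J (cost_mat Z w) \<sigma>" using finI finJ k by (rule ex_is_opt)
      then have sub: "\<sigma> \<subseteq> I \<times> J" by (simp add: is_opt_def asgs_def)
      then have "finite \<sigma>" using finI finJ by (meson finite_SigmaI finite_subset)
      then have "sum (cost_mat Z w) \<sigma> = sum w (\<sigma> - Z)" by (rule sum_cost_mat)
      also have "\<dots> \<le> sum w N" using elim(1) sub N finN by (intro sum_mono2) (auto intro: less_imp_le)
      finally have "mincost k I J (cost_mat Z w) \<le> sum w N" using mincost_eqI[OF finI finJ \<sigma>] by simp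
      moreover have "0 \<le> mincost k I J (cost_mat Z w)"
        unfolding mincost_eqI[OF finI finJ \<sigma>] using elim(2) sub by (intro sum_nonneg) auto
      ultimately show ?case by simp
    qed
  qed
qed

lemma random_insert: "p \<in> I \<times> J \<Longrightarrow> random_pattern I J (insert p Z) N k"
  using Z N finI finJ finN k by unfold_locales auto

text \<open>With \<open>x = w p\<close> the minimal cost is \<open>min \<alpha> (x + \<beta>)\<close>, where \<open>\<alpha>\<close> and \<open>\<beta>\<close> do not involve \<open>x\<close>.
  Replacing \<open>x\<close> by \<open>0\<close> lowers it by \<open>min x (max 0 (\<alpha> - \<beta>))\<close>, and \<open>p\<close> is used iff \<open>x < \<alpha> - \<beta>\<close>.\<close>

lemma expectation_zero_entry:
  assumes p: "p \<in> I \<times> J - Z"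
  shows "Om.expectation (\<lambda>w. mincost k I J (cost_mat Z w)) -
      Om.expectation (\<lambda>w. mincost k I J (cost_mat (insert p Z) w)) =
    Om.prob {w \<in> space (exp_space N). \<forall>\<sigma>. is_opt k I J (cost_mat Z w) \<sigma> \<longrightarrow> p \<in> \<sigma>}"
proof -
  interpret Y: random_pattern I J "insert p Z" N k using p by (intro random_insert) auto
  define A where "A = {\<sigma> \<in> asgs k I J. p \<notin> \<sigma>}"
  define B where "B = {\<sigma> \<in> asgs k I J. p \<in> \<sigma>}"
  define \<alpha> where "\<alpha> w = Min ((\<lambda>\<sigma>. sum (cost_mat (insert p Z) w) \<sigma>) ` A)" for w
  define \<beta> where "\<beta> w = Min ((\<lambda>\<sigma>. sum (cost_mat (insert p Z) w) \<sigma>) ` B)" for w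
  let ?d = "\<lambda>w. mincost k I J (cost_mat Z w) - mincost k I J (cost_mat (insert p Z) w)"
  let ?U = "{w \<in> space (exp_space N). \<forall>\<sigma>. is_opt k I J (cost_mat Z w) \<sigma> \<longrightarrow> p \<in> \<sigma>}"
  have pN: "p \<in> N" using p N by auto
  have AB: "asgs k I J = A \<union> B" "finite A" "finite B"
    using finite_asgs[OF finI finJ, of k] by (auto simp: A_def B_def)
  have sA: "sum (cost_mat Z w) \<sigma> = sum (cost_mat (insert p Z) w) \<sigma>" if "\<sigma> \<in> A" for \<sigma> w
    using that by (intro sum.cong) (auto simp: A_def cost_mat_def)
  have sB: "sum (cost_mat Z w) \<sigma> = w p + sum (cost_mat (insert p Z) w) \<sigma>" if "\<sigma> \<in> B" for \<sigma> w
  proof -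
    have "finite \<sigma>" "p \<in> \<sigma>" using that asgs_finite[OF finI finJ] by (auto simp: B_def)
    moreover have "sum (cost_mat Z w) (\<sigma> - {p}) = sum (cost_mat (insert p Z) w) (\<sigma> - {p})"
      by (intro sum.cong) (auto simp: cost_mat_def)
    ultimately show ?thesis using p by (simp add: sum.remove[of \<sigma> p] cost_mat_def)
  qed
  have "(\<integral>w. ?d w \<partial>exp_space N) = Om.prob ?U"
  proof -
    \<comment> \<open>The formula for the minimum requires both classes to be nonempty. If every
      assignment uses \<open>p\<close>, the difference is \<open>w p\<close>, of mean 1; if none
      does, it is 0.\<close>
    consider "A = {}" | "A \<noteq> {}" "B = {}" | "A \<noteq> {}" "B \<noteq> {}" by blast
    then show ?thesis
    proof cases
      case 1
      have B: "B \<noteq> {}" "asgs k I J = B" using 1 AB asgs_nonempty[OF finI finJ k] by auto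
      have d: "?d w = w p" for w
      proof -
        have "mincost k I J (cost_mat Z w) = Min ((\<lambda>\<sigma>. w p + sum (cost_mat (insert p Z) w) \<sigma>) ` B)"
          unfolding mincost_def B(2) using sB by (intro arg_cong[where f = Min] image_cong) auto
        also have "\<dots> = w p + \<beta> w"
          using Min_add_commute[OF AB(3) B(1), of "\<lambda>\<sigma>. sum (cost_mat (insert p Z) w) \<sigma>" "w p"]
          by (simp add: \<beta>_def add.commute)
        finally show ?thesis unfolding mincost_def B(2) \<beta>_def by simp
      qed
      have "(\<integral>w. w p \<partial>exp_space N) = enn2real (\<integral>\<^sup>+w. ennreal (w p) \<partial>exp_space N)"
        using AE_exp_pos[OF finN] pN measurable_exp_coord[OF pN]
        by (intro integral_eq_nn_integral) (auto elim!: eventually_mono intro: less_imp_le)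
      also have "(\<integral>\<^sup>+w. ennreal (w p) \<partial>exp_space N) = (\<integral>\<^sup>+w. (\<integral>\<^sup>+x. ennreal (x - 0) \<partial>expm) \<partial>exp_space N)"
        using measurable_exp_coord[OF pN] by (subst nn_integral_resample[OF pN]) auto
      also have "\<dots> = 1" using expm_excess[of 0] Om.emeasure_space_1 by simp
      finally have "(\<integral>w. ?d w \<partial>exp_space N) = 1" using d by simp
      moreover have "p \<in> \<sigma>" if "is_opt k I J (cost_mat Z w) \<sigma>" for w \<sigma>
      proof -
        have "\<sigma> \<in> B" using that unfolding B(2)[symmetric] by (simp add: is_opt_def)
        then show ?thesis by (simp add: B_def)
      qed
      then have "?U = space (exp_space N)" by auto
      ultimately show ?thesis using Om.prob_space by simp
    next
      case 2
      have d: "?d w = 0" for w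
      proof -
        have "sum (cost_mat Z w) ` A = sum (cost_mat (insert p Z) w) ` A" using sA by (intro image_cong) auto
        then show ?thesis unfolding mincost_def AB(1) 2(2) by simp
      qed
      have U: "?U = {}"
      proof -
        have "\<exists>\<sigma>. is_opt k I J (cost_mat Z w) \<sigma> \<and> p \<notin> \<sigma>" for w
        proof -
          obtain \<sigma> where "is_opt k I J (cost_mat Z w) \<sigma>" using finI finJ k by (rule ex_is_opt)
          then show ?thesis using 2(2) by (auto simp: is_opt_def B_def)
        qed
        then show ?thesis by blast
      qed
      show ?thesis unfolding U by (simp add: d)
    next
      case 3
      have \<alpha>le: "\<alpha> w \<le> sum (cost_mat Z w) \<sigma>" if "\<sigma> \<in> A" for \<sigma> w
        unfolding \<alpha>_def using AB(2) that sA by auto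
      have \<alpha>in: "\<exists>\<sigma>\<in>A. \<alpha> w = sum (cost_mat Z w) \<sigma>" for w
      proof -
        have "\<alpha> w \<in> (\<lambda>\<sigma>. sum (cost_mat (insert p Z) w) \<sigma>) ` A"
          unfolding \<alpha>_def using AB(2) 3 by (intro Min_in) auto
        then show ?thesis using sA by auto
      qed
      have \<beta>le: "w p + \<beta> w \<le> sum (cost_mat Z w) \<sigma>" if "\<sigma> \<in> B" for \<sigma> w
        unfolding \<beta>_def using AB(3) that sB by auto
      have \<beta>in: "\<exists>\<sigma>\<in>B. w p + \<beta> w = sum (cost_mat Z w) \<sigma>" for w
      proof -
        have "\<beta> w \<in> (\<lambda>\<sigma>. sum (cost_mat (insert p Z) w) \<sigma>) ` B"
          unfolding \<beta>_def using AB(3) 3 by (intro Min_in) auto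
        then show ?thesis using sB by auto
      qed
      have m: "mincost k I J (cost_mat Z w) = min (\<alpha> w) (w p + \<beta> w)" for w
        unfolding mincost_def AB(1)
      proof (rule Min_eqI)
        show "min (\<alpha> w) (w p + \<beta> w) \<in> sum (cost_mat Z w) ` (A \<union> B)"
          using \<alpha>in[of w] \<beta>in[of w] by (auto simp: min_def)
      qed (use AB \<alpha>le \<beta>le in \<open>auto simp: min_le_iff_disj\<close>)
      have m0: "mincost k I J (cost_mat (insert p Z) w) = min (\<alpha> w) (\<beta> w)" for w
        unfolding mincost_def AB(1) image_Un \<alpha>_def \<beta>_def using AB 3 by (subst Min_Un) auto
      have [measurable]: "\<alpha> \<in> borel_measurable (exp_space N)" "\<beta> \<in> borel_measurable (exp_space N)"
        unfolding \<alpha>_def \<beta>_def using AB(2,3) Y.measurable_cost_asgs[OF _ subset_refl]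
        by (auto intro!: borel_measurable_Min simp: A_def B_def)
      have [measurable]: "(\<lambda>w. w p) \<in> borel_measurable (exp_space N)" using pN by (rule measurable_exp_coord)
      define \<theta> where "\<theta> w = \<alpha> w - \<beta> w" for w
      have mat_upd: "cost_mat (insert p Z) (w(p := x)) = cost_mat (insert p Z) w" for w x
        by (auto simp: cost_mat_def fun_eq_iff)
      have "Om.prob ?U = Om.prob {w \<in> space (exp_space N). w p < \<theta> w}"
      proof -
        have "(\<forall>\<sigma>. is_opt k I J (cost_mat Z w) \<sigma> \<longrightarrow> p \<in> \<sigma>) \<longleftrightarrow> w p < \<theta> w" for w
        proof
          assume *: "\<forall>\<sigma>. is_opt k I J (cost_mat Z w) \<sigma> \<longrightarrow> p \<in> \<sigma>"
          show "w p < \<theta> w"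
          proof (rule ccontr)
            assume "\<not> w p < \<theta> w"
            then have le: "\<alpha> w \<le> w p + \<beta> w" by (simp add: \<theta>_def)
            obtain \<sigma> where \<sigma>: "\<sigma> \<in> A" "\<alpha> w = sum (cost_mat Z w) \<sigma>" using \<alpha>in by blast
            have "is_opt k I J (cost_mat Z w) \<sigma>"
              unfolding is_opt_def AB(1)
            proof (intro conjI ballI)
              show "\<sigma> \<in> A \<union> B" using \<sigma>(1) by simp
              fix \<tau> assume "\<tau> \<in> A \<union> B"
              then show "sum (cost_mat Z w) \<sigma> \<le> sum (cost_mat Z w) \<tau>"
              proof
                assume "\<tau> \<in> A"
                then show ?thesis using \<alpha>le[of \<tau> w] \<sigma>(2) by simp
              next
                assume "\<tau> \<in> B"
                then show ?thesis using \<beta>le[of \<tau> w] \<sigma>(2) le by simp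
              qed
            qed
            then show False using * \<sigma>(1) by (auto simp: A_def)
          qed
        next
          assume *: "w p < \<theta> w"
          obtain \<tau> where \<tau>: "\<tau> \<in> B" "w p + \<beta> w = sum (cost_mat Z w) \<tau>" using \<beta>in by blast
          show "\<forall>\<sigma>. is_opt k I J (cost_mat Z w) \<sigma> \<longrightarrow> p \<in> \<sigma>"
          proof (intro allI impI, rule ccontr)
            fix \<sigma> assume \<sigma>: "is_opt k I J (cost_mat Z w) \<sigma>" "p \<notin> \<sigma>"
            then have "\<sigma> \<in> A" by (auto simp: A_def is_opt_def)
            then have "\<alpha> w \<le> sum (cost_mat Z w) \<sigma>" by (rule \<alpha>le)
            also have "\<dots> \<le> sum (cost_mat Z w) \<tau>" using \<sigma>(1) \<tau>(1) AB(1) by (auto simp: is_opt_def)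
            finally show False using * \<tau>(2) by (simp add: \<theta>_def)
          qed
        qed
        then show ?thesis by simp
      qed
      moreover have "(\<integral>w. ?d w \<partial>exp_space N) = (\<integral>w. min (w p) (max 0 (\<theta> w)) \<partial>exp_space N)"
      proof (rule integral_cong_AE)
        show "AE w in exp_space N. ?d w = min (w p) (max 0 (\<theta> w))"
          using AE_exp_pos[OF finN]
        proof eventually_elim
          case (elim w)
          then have "0 < w p" using pN by auto
          then show ?case unfolding m m0 \<theta>_def by (auto simp: min_def max_def)
        qed
      qed (use measurable_mincost Y.measurable_mincost in \<open>auto simp: \<theta>_def\<close>)
      moreover have "\<dots> = enn2real (\<integral>\<^sup>+w. ennreal (min (w p) (max 0 (\<theta> w))) \<partial>exp_space N)"
      proof (rule integral_eq_nn_integral)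
        show "AE w in exp_space N. 0 \<le> min (w p) (max 0 (\<theta> w))"
          using AE_exp_pos[OF finN] by eventually_elim (use pN in \<open>auto intro: less_imp_le\<close>)
      qed (auto simp: \<theta>_def)
      moreover have "(\<integral>\<^sup>+w. ennreal (min (w p) (max 0 (\<theta> w))) \<partial>exp_space N) =
          emeasure (exp_space N) {w \<in> space (exp_space N). w p < \<theta> w}"
      proof (rule exp_space_min[OF pN])
        show "\<theta> (w(p := x)) = \<theta> w" for w x unfolding \<theta>_def \<alpha>_def \<beta>_def mat_upd ..
      qed (simp add: \<theta>_def)
      ultimately show ?thesis by (simp add: measure_def)
    qed
  qed
  then show ?thesis using integrable_mincost Y.integrable_mincost by (simp add: Bochner_Integration.integral_diff)
qed

end

section \<open>Exchangeability of the columns outside a reached set\<close>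

lemma asgs_relabel:
  assumes t: "bij_betw t J J" and \<sigma>: "\<sigma> \<in> asgs k I J"
  shows "map_prod id t ` \<sigma> \<in> asgs k I J" "sum a (map_prod id t ` \<sigma>) = sum (\<lambda>(i, d). a (i, t d)) \<sigma>"
    "snd ` map_prod id t ` \<sigma> = t ` snd ` \<sigma>"
proof -
  have sub: "\<sigma> \<subseteq> I \<times> J" and m: "matching \<sigma>" "card \<sigma> = k" using \<sigma> by (auto simp: asgs_def)
  have "snd ` \<sigma> \<subseteq> J" using sub by auto
  then have injt: "inj_on t (snd ` \<sigma>)" by (rule inj_on_subset[OF bij_betw_imp_inj_on[OF t]])
  have injf: "inj_on fst \<sigma>" "inj_on snd \<sigma>" using m(1) by (simp_all add: matching_def)
  have inj: "inj_on (map_prod id t) \<sigma>"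
  proof (rule inj_onI)
    fix p q assume pq: "p \<in> \<sigma>" "q \<in> \<sigma>" "map_prod id t p = map_prod id t q"
    have "fst p = fst q" using arg_cong[OF pq(3), of fst] by (simp only: fst_map_prod id_apply)
    then show "p = q" using inj_onD[OF injf(1) _ pq(1,2)] by simp
  qed
  show im: "snd ` map_prod id t ` \<sigma> = t ` snd ` \<sigma>" by (simp only: image_image snd_map_prod)
  have "inj_on (fst \<circ> map_prod id t) \<sigma>" using injf(1) by (simp add: comp_def)
  then have "inj_on fst (map_prod id t ` \<sigma>)" by (rule inj_on_imageI)
  moreover have "inj_on (t \<circ> snd) \<sigma>" using injf(2) injt by (rule comp_inj_on)
  then have "inj_on (snd \<circ> map_prod id t) \<sigma>" by (simp add: comp_def)
  then have "inj_on snd (map_prod id t ` \<sigma>)" by (rule inj_on_imageI)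
  moreover have "map_prod id t ` \<sigma> \<subseteq> I \<times> J" using sub t by (auto simp: bij_betw_def)
  ultimately show "map_prod id t ` \<sigma> \<in> asgs k I J"
    using m card_image[OF inj] by (simp add: asgs_def matching_def)
  show "sum a (map_prod id t ` \<sigma>) = sum (\<lambda>(i, d). a (i, t d)) \<sigma>"
    by (subst sum.reindex[OF inj]) (auto intro!: sum.cong)
qed

lemma opt_cols_relabel:
  assumes t: "bij_betw t J J" "\<And>d. t (t d) = d"
    and opt: "opt_cols k I J (\<lambda>(i, d). a (i, t d)) T"
  shows "opt_cols k I J a (t ` T)"
proof -
  obtain \<sigma> where \<sigma>: "\<sigma> \<in> asgs k I J" "snd ` \<sigma> = T"
    "\<And>\<tau>. \<tau> \<in> asgs k I J \<Longrightarrow> sum (\<lambda>(i, d). a (i, t d)) \<sigma> \<le> sum (\<lambda>(i, d). a (i, t d)) \<tau>"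
    using opt by (auto simp: opt_cols_def)
  have "sum a (map_prod id t ` \<sigma>) \<le> sum a \<tau>" if \<tau>: "\<tau> \<in> asgs k I J" for \<tau>
  proof -
    have "sum (\<lambda>(i, d). a (i, t d)) (map_prod id t ` \<tau>) = sum (\<lambda>(i, d). a (i, t (t d))) \<tau>"
      using asgs_relabel(2)[OF t(1) \<tau>, of "\<lambda>(i, d). a (i, t d)"] by simp
    also have "\<dots> = sum a \<tau>" using t(2) by (simp add: case_prod_beta')
    finally show ?thesis
      using \<sigma>(3)[OF asgs_relabel(1)[OF t(1) \<tau>]] asgs_relabel(2)[OF t(1) \<sigma>(1), of a] by simp
  qed
  then show ?thesis
    unfolding opt_cols_def
    using asgs_relabel(1,3)[OF t(1) \<sigma>(1)] \<sigma>(2) by (intro bexI[of _ "map_prod id t ` \<sigma>"]) auto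
qed

lemma opt_cols_cong:
  assumes "\<And>p. p \<in> I \<times> J \<Longrightarrow> a p = b p"
  shows "opt_cols k I J a T = opt_cols k I J b T"
proof -
  have "sum a \<sigma> = sum b \<sigma>" if "\<sigma> \<in> asgs k I J" for \<sigma>
    using that assms by (intro sum.cong) (auto simp: asgs_def)
  then show ?thesis unfolding opt_cols_def by auto
qed

context random_pattern
begin

text \<open>The event that \<open>S\<close> is reached and \<open>c\<close> is a possible next
  column.\<close>

definition hit :: "('a \<times> 'b \<Rightarrow> real) \<Rightarrow> 'b set \<Rightarrow> 'b \<Rightarrow> bool" where
  "hit a S c \<longleftrightarrow> stage a S \<and> opt_cols (Suc (card S)) (I - rows_out Z S) J a (insert c S)"

lemma measurable_hit: "Measurable.pred (exp_space N) (\<lambda>w. hit (cost_mat Z w) S c)"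
  unfolding hit_def
  by (intro pred_intros_logic measurable_stage measurable_opt_cols) auto

text \<open>The event depends only on rows outside \<open>rows_out Z S\<close>, where columns
  \<open>c\<close> and \<open>c'\<close> have no zeros; interchanging their entries there preserves
  both the zero pattern and the law. Equality follows by symmetry.\<close>

lemma hit_swap:
  assumes c: "c \<in> J - S" "c' \<in> J - S" and S: "S \<subseteq> J"
  shows "Om.prob {w \<in> space (exp_space N). hit (cost_mat Z w) S c} \<le>
    Om.prob {w \<in> space (exp_space N). hit (cost_mat Z w) S c'}"
proof -
  let ?I = "I - rows_out Z S"
  define t where "t d = (if d = c then c' else if d = c' then c else d)" for d
  \<comment> \<open>The swap is confined to these rows: elsewhere it could move a random entry onto
    a zero.\<close>
  define \<pi> where "\<pi> = (\<lambda>(i, d). if i \<in> ?I then (i, t d) else (i, d))"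
  define \<Phi> where "\<Phi> w = (\<lambda>n\<in>N. w (\<pi> n))" for w :: "'a \<times> 'b \<Rightarrow> real"
  have tt: "t (t d) = d" for d by (simp add: t_def)
  have tJ: "t d \<in> J \<longleftrightarrow> d \<in> J" for d using c by (auto simp: t_def)
  have bij: "bij_betw t J J" using tt tJ by (intro bij_betw_byWitness[where f' = t]) auto
  have tS: "t d = d" if "d \<in> S" for d using that c by (auto simp: t_def)
  have tim: "t ` S = S" "t ` insert c S = insert c' S"
    using tS by (force simp: image_iff, force simp: image_iff t_def)
  have free: "(i, c) \<notin> Z" "(i, c') \<notin> Z" if "i \<in> ?I" for i using that c by (auto simp: rows_out_def)
  have \<pi>\<pi>: "\<pi> (\<pi> p) = p" for p by (cases p) (auto simp: \<pi>_def tt)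
  have \<pi>N: "\<pi> p \<in> N" if "p \<in> N" for p
  proof (cases p)
    case (Pair i d)
    show ?thesis
    proof (cases "i \<in> ?I \<and> (d = c \<or> d = c')")
      case True
      then have "(i, t d) \<in> I \<times> J - Z" using free[of i] c by (auto simp: t_def)
      then show ?thesis using N True Pair by (auto simp: \<pi>_def)
    next
      case False
      then have "\<pi> p = p" using Pair by (auto simp: \<pi>_def t_def)
      then show ?thesis using that by simp
    qed
  qed
  have inj: "inj_on \<pi> N" using \<pi>\<pi> by (metis inj_onI)
  have mat: "cost_mat Z (\<Phi> w) p = (\<lambda>(i, d). cost_mat Z w (i, t d)) p" if p: "p \<in> ?I \<times> J" for p w
  proof -
    obtain i d where id: "p = (i, d)" "i \<in> ?I" "d \<in> J" using p by auto
    have "(i, t d) \<in> Z \<longleftrightarrow> (i, d) \<in> Z" using free[OF id(2)] by (auto simp: t_def)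
    moreover have "(i, d) \<in> N" if "(i, d) \<notin> Z" using that N id by auto
    ultimately show ?thesis using id by (auto simp: cost_mat_def \<Phi>_def \<pi>_def)
  qed
  have step: "opt_cols q ?I J (cost_mat Z w) (t ` T)" if "opt_cols q ?I J (cost_mat Z (\<Phi> w)) T" for q T w
  proof (rule opt_cols_relabel[OF bij tt])
    have "opt_cols q ?I J (cost_mat Z (\<Phi> w)) T = opt_cols q ?I J (\<lambda>(i, d). cost_mat Z w (i, t d)) T"
      by (rule opt_cols_cong) (rule mat)
    then show "opt_cols q ?I J (\<lambda>(i, d). cost_mat Z w (i, t d)) T" using that by simp
  qed
  have imp: "hit (cost_mat Z w) S c'" if "hit (cost_mat Z (\<Phi> w)) S c" for w
    using that step[of _ w S] step[of _ w "insert c S"] unfolding hit_def stage_def tim by auto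
  have meas\<Phi>: "\<Phi> \<in> measurable (exp_space N) (exp_space N)"
    unfolding \<Phi>_def using \<pi>N by (intro measurable_permute) auto
  let ?A = "\<lambda>c. {w \<in> space (exp_space N). hit (cost_mat Z w) S c}"
  have A: "?A c \<in> sets (exp_space N)" for c using measurable_hit by (simp add: pred_def)
  have "Om.prob (?A c) = measure (distr (exp_space N) (exp_space N) \<Phi>) (?A c)"
    unfolding \<Phi>_def using exp_space_permute[OF inj] \<pi>N by (simp add: image_subset_iff)
  also have "\<dots> = Om.prob (\<Phi> -` ?A c \<inter> space (exp_space N))"
    by (rule measure_distr[OF meas\<Phi> A])
  also have "\<dots> \<le> Om.prob (?A c')"
    using imp A by (intro Om.finite_measure_mono) auto
  finally show ?thesis .
qed

text \<open>The entry of \<sigma> in column \<open>c\<close> is not in \<open>Z\<close>, as its row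
  is outside \<open>rows_out Z S\<close>. Genericity puts it into \<tau>, whose only column outside
  \<open>S\<close> is \<open>c'\<close>.\<close>

lemma hit_unique:
  assumes gen: "generic Z (I \<times> J) a" and c: "c \<in> J - S" "c' \<in> J - S" and hit: "hit a S c" "hit a S c'"
  shows "c = c'"
proof -
  let ?I = "I - rows_out Z S"
  obtain \<sigma> where \<sigma>: "is_opt (Suc (card S)) ?I J a \<sigma>" "snd ` \<sigma> = insert c S"
    using hit(1) unfolding hit_def opt_cols_def is_opt_def by blast
  obtain \<tau> where \<tau>: "is_opt (Suc (card S)) ?I J a \<tau>" "snd ` \<tau> = insert c' S"
    using hit(2) unfolding hit_def opt_cols_def is_opt_def by blast
  have "\<sigma> \<subseteq> ?I \<times> J" "\<tau> \<subseteq> ?I \<times> J" using \<sigma>(1) \<tau>(1) by (auto simp: is_opt_def asgs_def)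
  moreover from this have "\<sigma> \<subseteq> I \<times> J" "\<tau> \<subseteq> I \<times> J" by auto
  moreover have "sum a \<sigma> = sum a \<tau>" using \<sigma>(1) \<tau>(1) by (rule is_opt_sum_eq)
  ultimately have eq: "\<sigma> - Z = \<tau> - Z" "\<sigma> \<subseteq> ?I \<times> J" using gen unfolding generic_def by blast+
  obtain i where i: "(i, c) \<in> \<sigma>" using \<sigma>(2) by force
  then have "(i, c) \<notin> Z" using eq(2) c(1) by (auto simp: rows_out_def)
  then have "(i, c) \<in> \<tau>" using i eq(1) by auto
  then have "c \<in> insert c' S" using \<tau>(2) by force
  then show ?thesis using c by auto
qed

lemma ex_hit:
  assumes S: "closed_cols Z J S" and st: "stage a S" and small: "csize Z S < k"
  obtains c where "c \<in> J - S" "hit a S c"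
proof -
  have "card (I - rows_out Z S) = card I - card (rows_out Z S)"
    using rows_out_subset[OF Z] by (intro card_Diff_subset) auto
  \<comment> \<open>\<open>csize Z S < k \<le> card I\<close> leaves more than \<open>card S\<close>
    rows after deleting those of \<open>rows_out Z S\<close>.\<close>
  then have "Suc (card S) \<le> card (I - rows_out Z S)" "Suc (card S) \<le> card J"
    using small k by (auto simp: csize_def)
  then have "asgs (Suc (card S)) (I - rows_out Z S) J \<noteq> {}"
    using finI finJ by (intro asgs_nonempty) auto
  then show ?thesis
    using opt_cols_step[OF _ finJ st[unfolded stage_def]] finI that st unfolding hit_def by auto
qed

text \<open>Almost surely exactly one column follows a reached set, and \<open>hit_swap\<close>
  makes the candidates equally likely.\<close>

lemma prob_hit:
  assumes S: "closed_cols Z J S" and small: "csize Z S < k" and c: "c \<in> J - S"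
  shows "Om.prob {w \<in> space (exp_space N). hit (cost_mat Z w) S c} =
    Om.prob {w \<in> space (exp_space N). stage (cost_mat Z w) S} / real (card J - card S)"
proof -
  have SJ: "S \<subseteq> J" using S by (simp add: closed_cols_def)
  have "Om.prob {w \<in> space (exp_space N). stage (cost_mat Z w) S} =
    (\<Sum>d\<in>J - S. Om.prob {w \<in> space (exp_space N). hit (cost_mat Z w) S d})"
  proof (rule Om.prob_sum)
    show "AE w in exp_space N. (\<forall>d\<in>J - S. hit (cost_mat Z w) S d \<longrightarrow> stage (cost_mat Z w) S) \<and>
      (stage (cost_mat Z w) S \<longrightarrow> (\<exists>!d. d \<in> J - S \<and> hit (cost_mat Z w) S d))"
      using AE_cost_mat
    proof eventually_elim
      case (elim w)
      have "\<exists>!d. d \<in> J - S \<and> hit (cost_mat Z w) S d" if st: "stage (cost_mat Z w) S"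
      proof -
        obtain d where "d \<in> J - S" "hit (cost_mat Z w) S d" using S st small by (rule ex_hit)
        then show ?thesis using hit_unique elim by blast
      qed
      then show ?case by (auto simp: hit_def)
    qed
  qed (use finJ measurable_hit measurable_stage in \<open>simp_all add: pred_def\<close>)
  also have "\<dots> = (\<Sum>d\<in>J - S. Om.prob {w \<in> space (exp_space N). hit (cost_mat Z w) S c})"
    using hit_swap[OF _ c SJ] hit_swap[OF c _ SJ] by (intro sum.cong) (auto intro!: antisym)
  also have "\<dots> = real (card J - card S) * Om.prob {w \<in> space (exp_space N). hit (cost_mat Z w) S c}"
    using card_Diff_subset[OF finite_cols[OF SJ] SJ] by simp
  finally have "Om.prob {w \<in> space (exp_space N). stage (cost_mat Z w) S} =
    real (card J - card S) * Om.prob {w \<in> space (exp_space N). hit (cost_mat Z w) S c}" .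
  moreover have "card S < card J" using c SJ finJ by (intro psubset_card_mono) auto
  ultimately show ?thesis by simp
qed

end

section \<open>The reached closed sets as an urn process\<close>

lemma cost_mat_Z: "p \<in> Z \<Longrightarrow> cost_mat Z w p = 0"
  by (simp add: cost_mat_def)

context random_pattern
begin

definition flats :: "nat \<Rightarrow> 'b set set" where
  "flats r = {S. closed_cols Z J S \<and> csize Z S = r}"

definition prob_stage :: "'b set \<Rightarrow> real" where
  "prob_stage S = Om.prob {w \<in> space (exp_space N). stage (cost_mat Z w) S}"

lemma finite_flats: "finite (flats r)"
  by (rule finite_subset[of _ "Pow J"]) (use finJ in \<open>auto simp: flats_def closed_cols_def\<close>)

lemma flats_subset: "S \<in> flats r \<Longrightarrow> S \<subseteq> J"
  by (simp add: flats_def closed_cols_def)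

lemma clos_insert_flat:
  assumes "S \<in> flats r" "c \<in> J - S"
  shows "is_clos Z J (insert c S) (clos Z J (insert c S))" "clos Z J (insert c S) \<in> flats (Suc r)"
proof -
  have "insert c S \<subseteq> J" using assms flats_subset by auto
  then show c: "is_clos Z J (insert c S) (clos Z J (insert c S))" using finJ by (intro is_clos_clos) auto
  have "closed_cols Z J S" using assms by (simp add: flats_def)
  then show "clos Z J (insert c S) \<in> flats (Suc r)"
    using csize_clos_insert[OF _ assms(2) c] closD(1)[OF c] assms(1) by (simp add: flats_def)
qed

lemma hit_clos:
  assumes nonneg: "\<forall>p\<in>I \<times> J. 0 \<le> cost_mat Z w p" and S: "S \<in> flats r" and c: "c \<in> J - S"
    and hit: "hit (cost_mat Z w) S c"
  shows "stage (cost_mat Z w) (clos Z J (insert c S))"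
proof (rule stage_step)
  show "closed_cols Z J S" using S by (simp add: flats_def)
  show "is_clos Z J (insert c S) (clos Z J (insert c S))" by (rule clos_insert_flat[OF S c])
qed (use nonneg c hit in \<open>auto simp: hit_def cost_mat_Z\<close>)

lemma ex_stage:
  assumes nonneg: "\<forall>p\<in>I \<times> J. 0 \<le> cost_mat Z w p" and r: "csize Z (clos Z J {}) \<le> r" "r \<le> k"
  shows "\<exists>S\<in>flats r. stage (cost_mat Z w) S"
  using r
proof (induction r rule: dec_induct)
  case base
  have c: "is_clos Z J {} (clos Z J {})" using finJ by (intro is_clos_clos) auto
  moreover have "stage (cost_mat Z w) (clos Z J {})"
    by (rule stage_init[OF _ _ c]) (use nonneg in \<open>auto simp: cost_mat_Z\<close>)
  ultimately show ?case by (auto simp: flats_def dest: closD)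
next
  case (step r)
  then obtain S where S: "S \<in> flats r" "stage (cost_mat Z w) S" by auto
  then obtain c where c: "c \<in> J - S" "hit (cost_mat Z w) S c"
    using ex_hit[of S "cost_mat Z w"] step.prems by (auto simp: flats_def)
  then show ?case using hit_clos[OF nonneg S(1) c] clos_insert_flat(2)[OF S(1) c(1)] by blast
qed

lemma stage_flat_unique:
  assumes "\<forall>p\<in>I \<times> J. 0 \<le> cost_mat Z w p" "generic Z (I \<times> J) (cost_mat Z w)"
    and "S \<in> flats r" "stage (cost_mat Z w) S" "T \<in> flats r" "stage (cost_mat Z w) T"
  shows "S = T"
  by (rule stage_unique[where a = "cost_mat Z w"])
     (use assms in \<open>auto simp: flats_def cost_mat_Z\<close>)

text \<open>The transition rule of the chain: almost surely, reaching \<open>S'\<close> comes from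
  exactly one pair of a set reached one level below and a column drawn there.\<close>

lemma prob_stage_Suc:
  assumes r: "csize Z (clos Z J {}) \<le> r" "r < k" and S': "S' \<in> flats (Suc r)"
  shows "prob_stage S' =
    (\<Sum>(S, c) | (S, c) \<in> Sigma (flats r) (\<lambda>S. J - S) \<and> clos Z J (insert c S) = S'.
      prob_stage S / real (card J - card S))"
proof -
  let ?X = "{(S, c). (S, c) \<in> Sigma (flats r) (\<lambda>S. J - S) \<and> clos Z J (insert c S) = S'}"
  have finX: "finite ?X"
    by (rule finite_subset[of _ "Sigma (flats r) (\<lambda>S. J - S)"]) (use finite_flats finJ in auto)
  have "prob_stage S' =
    (\<Sum>x\<in>?X. Om.prob {w \<in> space (exp_space N). hit (cost_mat Z w) (fst x) (snd x)})"
    unfolding prob_stage_def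
  proof (rule Om.prob_sum[OF finX])
    show "AE w in exp_space N. (\<forall>x\<in>?X. hit (cost_mat Z w) (fst x) (snd x) \<longrightarrow> stage (cost_mat Z w) S') \<and>
      (stage (cost_mat Z w) S' \<longrightarrow> (\<exists>!x. x \<in> ?X \<and> hit (cost_mat Z w) (fst x) (snd x)))"
      using AE_cost_mat
    proof eventually_elim
      case (elim w)
      have "\<exists>!x. x \<in> ?X \<and> hit (cost_mat Z w) (fst x) (snd x)" if st: "stage (cost_mat Z w) S'"
      proof -
        have "\<exists>S\<in>flats r. stage (cost_mat Z w) S" using elim r by (intro ex_stage) auto
        then obtain S where S: "S \<in> flats r" "stage (cost_mat Z w) S" by auto
        then obtain c where c: "c \<in> J - S" "hit (cost_mat Z w) S c"
          using ex_hit[of S "cost_mat Z w"] r(2) by (auto simp: flats_def)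
        have "clos Z J (insert c S) = S'"
        proof (rule stage_flat_unique)
          show "stage (cost_mat Z w) (clos Z J (insert c S))" using hit_clos[OF _ S(1) c] elim by simp
        qed (use elim st S' clos_insert_flat(2)[OF S(1) c(1)] in auto)
        then have mem: "(S, c) \<in> ?X" using S(1) c(1) by simp
        have uniq: "(T, d) = (S, c)" if T: "(T, d) \<in> ?X" "hit (cost_mat Z w) T d" for T d
        proof -
          have "T = S"
            using stage_flat_unique[of w T r S] elim S T by (auto simp: hit_def)
          then show ?thesis using hit_unique[of "cost_mat Z w" d S c] elim T c by auto
        qed
        show ?thesis
        proof (rule ex1I)
          show "(S, c) \<in> ?X \<and> hit (cost_mat Z w) (fst (S, c)) (snd (S, c))" using mem c(2) by simp
          show "x = (S, c)" if "x \<in> ?X \<and> hit (cost_mat Z w) (fst x) (snd x)" for x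
            using uniq[of "fst x" "snd x"] that by simp
        qed
      qed
      moreover have "stage (cost_mat Z w) S'" if "x \<in> ?X" "hit (cost_mat Z w) (fst x) (snd x)" for x
        using hit_clos[of w "fst x" r "snd x"] elim that by (cases x) simp
      ultimately show ?case by blast
    qed
  qed (use measurable_hit measurable_stage in \<open>simp_all add: pred_def\<close>)
  also have "\<dots> = (\<Sum>(S, c)\<in>?X. prob_stage S / real (card J - card S))"
    using r(2) by (intro sum.cong) (auto simp: prob_hit prob_stage_def flats_def)
  finally show ?thesis .
qed

text \<open>The hypothesis says that \<open>v\<close> is harmonic for uniform draws followed by
  closure, so its mean over the reached set does not change with the level.\<close>

lemma sum_flats_Suc:
  assumes r: "csize Z (clos Z J {}) \<le> r" "r < k"
    and v: "\<And>S. S \<in> flats r \<Longrightarrow> real (card J - card S) * v S = (\<Sum>c\<in>J - S. v (clos Z J (insert c S)))"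
  shows "(\<Sum>S\<in>flats (Suc r). prob_stage S * v S) = (\<Sum>S\<in>flats r. prob_stage S * v S)"
proof -
  let ?X = "Sigma (flats r) (\<lambda>S. J - S)"
  let ?g = "\<lambda>(S, c). clos Z J (insert c S)"
  let ?h = "\<lambda>x. (case x of (S, c) \<Rightarrow> prob_stage S / real (card J - card S)) * v (?g x)"
  have "(\<Sum>S'\<in>flats (Suc r). prob_stage S' * v S') =
    (\<Sum>S'\<in>flats (Suc r). \<Sum>x | x \<in> ?X \<and> ?g x = S'. ?h x)"
  proof (rule sum.cong)
    fix S' assume S': "S' \<in> flats (Suc r)"
    have "prob_stage S' * v S' =
      (\<Sum>x | x \<in> ?X \<and> ?g x = S'. (case x of (S, c) \<Rightarrow> prob_stage S / real (card J - card S)) * v S')"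
      unfolding prob_stage_Suc[OF r S'] sum_distrib_right by (intro sum.cong) auto
    then show "prob_stage S' * v S' = (\<Sum>x | x \<in> ?X \<and> ?g x = S'. ?h x)" by simp
  qed simp
  also have "\<dots> = (\<Sum>x\<in>?X. ?h x)"
    using finite_flats finJ clos_insert_flat(2) by (intro sum.group) auto
  also have "\<dots> = (\<Sum>S\<in>flats r. \<Sum>c\<in>J - S. prob_stage S / real (card J - card S) * v (clos Z J (insert c S)))"
    using finite_flats finJ by (subst sum.Sigma) (auto simp: case_prod_beta')
  also have "\<dots> = (\<Sum>S\<in>flats r. prob_stage S * v S)"
  proof (rule sum.cong)
    fix S assume S: "S \<in> flats r"
    have "card (rows_out Z S) + card S = r" using S by (simp add: flats_def csize_def)
    then have "card S < card J" using r(2) k by linarith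
    then show "(\<Sum>c\<in>J - S. prob_stage S / real (card J - card S) * v (clos Z J (insert c S))) = prob_stage S * v S"
      unfolding sum_distrib_left[symmetric] v[OF S, symmetric] by simp
  qed simp
  finally show ?thesis .
qed

text \<open>The mean of \<open>v\<close> is carried from the lowest level, where the reached set is
  the closure of the empty set, to level \<open>k\<close>, where \<open>v\<close> is the indicator
  of \<open>c0\<close> being outside the reached set.\<close>

lemma prob_unused:
  assumes c0: "c0 \<in> J" "c0 \<notin> snd ` Z" and pc: "pcover I J Z (k - 1) {} {}" and k0: "0 < k"
  shows "Om.prob {w \<in> space (exp_space N). \<exists>\<sigma>. is_opt k I J (cost_mat Z w) \<sigma> \<and> c0 \<notin> snd ` \<sigma>} =
    1 - urn (J - {c0}) (pcover I J Z (k - 1) {}) {}"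
proof -
  let ?U = "J - {c0}" and ?D = "pcover I J Z (k - 1) {}"
  \<comment> \<open>The conditional probability, given that \<open>S\<close> is reached, that
    \<open>c0\<close> stays outside the reached sets up to level \<open>k\<close>.\<close>
  define v where "v S = (if c0 \<in> S then 0 else 1 - urn ?U ?D S)" for S
  have D_iff: "?D C \<longleftrightarrow> (\<exists>T. C \<subseteq> T \<and> T \<subseteq> J \<and> csize Z T \<le> k - 1)" if "C \<subseteq> J" for C
    using that k(1) by (intro pcover_iff_csize) auto
  have down: "?D Y" if "Y \<subseteq> X" "?D X" for X Y using pcover_mono[OF that(2) subset_refl that(1)] .
  have finU: "finite ?U" using finJ by simp
  have cardU: "card ?U + 1 = card J" using c0 finJ by (metis Suc_eq_plus1 card_Suc_Diff1)
  have urn_clos: "urn ?U ?D S = urn ?U ?D C" if S: "is_clos Z J C S" and C: "c0 \<notin> C" for C S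
  proof (rule urn_loops[OF finU])
    have c0S: "c0 \<notin> S" by (rule clos_zero_free[OF S c0(2) C])
    show "C \<subseteq> S" "S \<subseteq> ?U" using closD[OF S] c0S by auto
    \<comment> \<open>By submodularity, joining the closure \<open>S\<close> to \<open>T\<close>
      raises \<open>csize\<close> by at most \<open>csize Z S - csize Z (T \<inter> S)\<close>,
      which is not positive by minimality of \<open>S\<close>.\<close>
    show "?D (X \<union> S)" if X: "C \<subseteq> X" "X \<subseteq> ?U" "?D X" for X
    proof -
      have XJ: "X \<subseteq> J" using X by auto
      then obtain T where T: "X \<subseteq> T" "T \<subseteq> J" "csize Z T \<le> k - 1" using X(3) D_iff by auto
      have "C \<subseteq> T \<inter> S" "T \<inter> S \<subseteq> J" using T X closD[OF S] by auto
      then have "csize Z S \<le> csize Z (T \<inter> S)" by (rule clos_le[OF S])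
      moreover have "csize Z (T \<union> S) + csize Z (T \<inter> S) \<le> csize Z T + csize Z S"
        using finite_cols[OF T(2)] closD[OF S] by (intro csize_submodular) auto
      ultimately have "csize Z (T \<union> S) \<le> k - 1" using T(3) by linarith
      moreover have "X \<union> S \<subseteq> T \<union> S" "T \<union> S \<subseteq> J" "X \<union> S \<subseteq> J" using T closD[OF S] XJ by auto
      ultimately show ?thesis using D_iff[of "X \<union> S"] by blast
    qed
  qed (rule down)
  have vrec: "real (card J - card S) * v S = (\<Sum>c\<in>J - S. v (clos Z J (insert c S)))"
    if S: "S \<in> flats r" and r: "r < k" for r S
  proof (cases "c0 \<in> S")
    case True
    have "v (clos Z J (insert c S)) = 0" if "c \<in> J - S" for c
      using closD(2)[OF clos_insert_flat(1)[OF S that]] True by (auto simp: v_def)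
    then show ?thesis using True by (simp add: v_def)
  next
    case False
    have SJ: "S \<subseteq> ?U" using flats_subset[OF S] False by auto
    have "csize Z S \<le> k - 1" using S r by (simp add: flats_def)
    then have DS: "?D S" using D_iff[OF flats_subset[OF S]] flats_subset[OF S] by blast
    have vc: "v (clos Z J (insert c S)) = 1 - urn ?U ?D (insert c S)" if "c \<in> ?U - S" for c
    proof -
      have cl: "is_clos Z J (insert c S) (clos Z J (insert c S))"
        using that by (intro clos_insert_flat(1)[OF S]) auto
      have "c0 \<notin> insert c S" using that False by auto
      then show ?thesis using clos_zero_free[OF cl c0(2)] urn_clos[OF cl] by (simp add: v_def)
    qed
    have vc0: "v (clos Z J (insert c0 S)) = 0"
      using closD(2)[OF clos_insert_flat(1)[OF S, of c0]] c0(1) False by (auto simp: v_def)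
    \<comment> \<open>The draw of \<open>c0\<close> itself contributes 0; this is the further
      element of the urn and matches the 1 in \<open>urn_rec\<close>.\<close>
    have "J - S = insert c0 (?U - S)" using c0(1) False by auto
    then have "(\<Sum>c\<in>J - S. v (clos Z J (insert c S))) = (\<Sum>c\<in>?U - S. v (clos Z J (insert c S)))"
      using finU vc0 by simp
    also have "\<dots> = (\<Sum>c\<in>?U - S. 1 - urn ?U ?D (insert c S))" using vc by (rule sum.cong[OF refl])
    also have "\<dots> = real (card (?U - S)) - (real (card J - card S) * urn ?U ?D S - 1)"
      using urn_rec[where D = ?D, OF finU SJ DS] unfolding cardU by (simp add: sum_subtractf)
    also have "card (?U - S) = card ?U - card S"
      using SJ finU by (intro card_Diff_subset) (auto intro: finite_subset)
    also have "real (card ?U - card S) = real (card J - card S) - 1"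
      using cardU card_mono[OF finU SJ] by (simp add: of_nat_diff)
    finally show ?thesis using False by (simp add: v_def algebra_simps)
  qed
  let ?\<nu> = "csize Z (clos Z J {})"
  have cl0: "is_clos Z J {} (clos Z J {})" using finJ by (intro is_clos_clos) auto
  have \<nu>: "?\<nu> \<le> k - 1"
  proof -
    obtain T where "T \<subseteq> J" "csize Z T \<le> k - 1" using pc D_iff[of "{}"] by auto
    then show ?thesis using clos_le[OF cl0, of T] by simp
  qed
  have chain: "(\<Sum>S\<in>flats r. prob_stage S * v S) = (\<Sum>S\<in>flats ?\<nu>. prob_stage S * v S)"
    if "?\<nu> \<le> r" "r \<le> k" for r
    using that
  proof (induction r rule: dec_induct)
    case (step r)
    then show ?case using sum_flats_Suc[of r v] vrec[of _ r] by auto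
  qed simp
  have "(\<Sum>S\<in>flats ?\<nu>. prob_stage S * v S) = v (clos Z J {})"
  proof -
    have cf: "clos Z J {} \<in> flats ?\<nu>" using closD(1)[OF cl0] by (simp add: flats_def)
    have st: "AE w in exp_space N. stage (cost_mat Z w) (clos Z J {})"
      using AE_cost_mat by eventually_elim (rule stage_init[OF _ _ cl0], auto simp: cost_mat_Z)
    have one: "prob_stage (clos Z J {}) = 1"
      unfolding prob_stage_def using st measurable_stage by (subst Om.prob_Collect_eq_1) (auto simp: pred_def)
    have zero: "prob_stage S = 0" if "S \<in> flats ?\<nu> - {clos Z J {}}" for S
      unfolding prob_stage_def
    proof (rule Om.prob_eq_0_AE)
      show "AE w in exp_space N. \<not> stage (cost_mat Z w) S"
        using AE_cost_mat st
        by eventually_elim (use stage_flat_unique[OF _ _ _ _ cf] that in auto)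
    qed
    show ?thesis using cf finite_flats zero one by (simp add: sum.remove[of _ "clos Z J {}"])
  qed
  also have "\<dots> = 1 - urn ?U ?D {}"
    using clos_zero_free[OF cl0 c0(2)] urn_clos[OF cl0] by (simp add: v_def)
  finally have start: "(\<Sum>S\<in>flats ?\<nu>. prob_stage S * v S) = 1 - urn ?U ?D {}" .
  \<comment> \<open>Supersets of a closed set of level \<open>k\<close> have \<open>csize\<close> at
    least \<open>k\<close>, so none is a partial (k-1)-cover and the urn sum is empty.\<close>
  have vk: "v S = (if c0 \<in> S then 0 else 1)" if S: "S \<in> flats k" for S
  proof -
    have "\<not> ?D X" if "S \<subseteq> X" "X \<subseteq> ?U" for X
    proof
      assume "?D X"
      moreover have "X \<subseteq> J" using that by auto
      ultimately obtain T where T: "X \<subseteq> T" "T \<subseteq> J" "csize Z T \<le> k - 1" using D_iff[of X] by auto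
      have "csize Z S \<le> csize Z T"
      proof (cases "S = T")
        case False
        then have "S \<subset> T" using T(1) that(1) by auto
        moreover have "closed_cols Z J S" using S by (simp add: flats_def)
        ultimately have "csize Z S < csize Z T" using T(2) by (simp add: closed_cols_def)
        then show ?thesis by simp
      qed simp
      then show False using T(3) S k0 by (simp add: flats_def)
    qed
    then have "{X. S \<subseteq> X \<and> X \<subseteq> ?U \<and> ?D X} = {}" by blast
    then have "urn ?U ?D S = 0" unfolding urn_def by (simp only: sum.empty)
    then show ?thesis by (simp add: v_def)
  qed
  let ?F = "{S \<in> flats k. c0 \<notin> S}"
  \<comment> \<open>Some optimum misses \<open>c0\<close> iff the reached set of level
    \<open>k\<close> does: \<open>stage_opt\<close> gives one direction and
    \<open>stage_cols_used\<close> the other.\<close>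
  have "Om.prob {w \<in> space (exp_space N). \<exists>\<sigma>. is_opt k I J (cost_mat Z w) \<sigma> \<and> c0 \<notin> snd ` \<sigma>} =
    (\<Sum>S\<in>?F. prob_stage S)"
    unfolding prob_stage_def
  proof (rule Om.prob_sum)
    show "AE w in exp_space N.
      (\<forall>S\<in>?F. stage (cost_mat Z w) S \<longrightarrow> (\<exists>\<sigma>. is_opt k I J (cost_mat Z w) \<sigma> \<and> c0 \<notin> snd ` \<sigma>)) \<and>
      ((\<exists>\<sigma>. is_opt k I J (cost_mat Z w) \<sigma> \<and> c0 \<notin> snd ` \<sigma>) \<longrightarrow> (\<exists>!S. S \<in> ?F \<and> stage (cost_mat Z w) S))"
      using AE_cost_mat
    proof eventually_elim
      case (elim w)
      have nn: "\<And>p. p \<in> I \<times> J \<Longrightarrow> 0 \<le> cost_mat Z w p" using elim by blast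
      have zz: "\<And>p. p \<in> Z \<Longrightarrow> cost_mat Z w p = 0" by (simp add: cost_mat_def)
      have 1: "\<exists>\<sigma>. is_opt k I J (cost_mat Z w) \<sigma> \<and> c0 \<notin> snd ` \<sigma>" if S: "S \<in> ?F" "stage (cost_mat Z w) S" for S
      proof -
        have "closed_cols Z J S" "c0 \<notin> S" "csize Z S = k" using S by (auto simp: flats_def)
        then show ?thesis using stage_opt[OF nn zz _ S(2)] by metis
      qed
      have 2: "\<exists>!S. S \<in> ?F \<and> stage (cost_mat Z w) S" if \<sigma>: "is_opt k I J (cost_mat Z w) \<sigma>" "c0 \<notin> snd ` \<sigma>" for \<sigma>
      proof -
        have "\<exists>S\<in>flats k. stage (cost_mat Z w) S" using elim \<nu> by (intro ex_stage) auto
        then obtain S where S: "S \<in> flats k" "stage (cost_mat Z w) S" by auto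
        have "S \<subseteq> snd ` \<sigma>"
        proof (rule stage_cols_used[OF nn zz _ S(2)])
          show "closed_cols Z J S" "is_opt (csize Z S) I J (cost_mat Z w) \<sigma>"
            using S(1) \<sigma>(1) by (auto simp: flats_def)
        qed (use elim in auto)
        then have "S \<in> ?F" using S(1) \<sigma>(2) by auto
        moreover have "T = S" if "T \<in> ?F" "stage (cost_mat Z w) T" for T
          using stage_flat_unique[of w T k S] elim S that by auto
        ultimately show ?thesis using S(2) by blast
      qed
      show ?case using 1 2 by blast
    qed
    have "{w \<in> space (exp_space N). \<exists>\<sigma>. is_opt k I J (cost_mat Z w) \<sigma> \<and> c0 \<notin> snd ` \<sigma>} =
      {w \<in> space (exp_space N). \<exists>\<sigma>\<in>asgs k I J. is_opt k I J (cost_mat Z w) \<sigma> \<and> c0 \<notin> snd ` \<sigma>}"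
      by (auto simp: is_opt_def)
    also have "\<dots> \<in> sets (exp_space N)"
    proof -
      have "Measurable.pred (exp_space N)
          (\<lambda>w. \<exists>\<sigma>\<in>asgs k I J. is_opt k I J (cost_mat Z w) \<sigma> \<and> c0 \<notin> snd ` \<sigma>)"
        using finite_asgs[OF finI finJ] measurable_is_opt
        by (intro pred_intros_finite pred_intros_logic) auto
      then show ?thesis by (simp add: pred_def)
    qed
    finally show "{w \<in> space (exp_space N). \<exists>\<sigma>. is_opt k I J (cost_mat Z w) \<sigma> \<and> c0 \<notin> snd ` \<sigma>}
      \<in> sets (exp_space N)" .
  qed (use finite_flats measurable_stage in \<open>simp_all add: pred_def\<close>)
  also have "\<dots> = (\<Sum>S\<in>flats k. prob_stage S * v S)"
    using finite_flats[of k] by (simp add: sum.inter_filter) (intro sum.cong, auto simp: vk)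
  also have "\<dots> = 1 - urn ?U ?D {}" using chain[of k] start \<nu> by simp
  finally show ?thesis .
qed

text \<open>Each difference is the probability that (i, c0) lies in every optimum. These events are
  disjoint, and together they say that every optimum uses column \<open>c0\<close>.\<close>

lemma expectation_zero_column:
  assumes c0: "c0 \<in> J" "c0 \<notin> snd ` Z"
  shows "(\<Sum>i\<in>I. Om.expectation (\<lambda>w. mincost k I J (cost_mat Z w)) -
      Om.expectation (\<lambda>w. mincost k I J (cost_mat (insert (i, c0) Z) w))) =
    1 - Om.prob {w \<in> space (exp_space N). \<exists>\<sigma>. is_opt k I J (cost_mat Z w) \<sigma> \<and> c0 \<notin> snd ` \<sigma>}"
proof -
  let ?A = "{w \<in> space (exp_space N). \<exists>\<sigma>. is_opt k I J (cost_mat Z w) \<sigma> \<and> c0 \<notin> snd ` \<sigma>}"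
  have all_eq: "(\<forall>\<sigma>. is_opt k I J (cost_mat Z w) \<sigma> \<longrightarrow> P \<sigma>) \<longleftrightarrow>
      (\<forall>\<sigma>\<in>asgs k I J. is_opt k I J (cost_mat Z w) \<sigma> \<longrightarrow> P \<sigma>)" for w P
    by (auto simp: is_opt_def)
  have meas: "{w \<in> space (exp_space N). \<forall>\<sigma>. is_opt k I J (cost_mat Z w) \<sigma> \<longrightarrow> P \<sigma>} \<in> sets (exp_space N)" for P
  proof -
    have "Measurable.pred (exp_space N) (\<lambda>w. \<forall>\<sigma>\<in>asgs k I J. is_opt k I J (cost_mat Z w) \<sigma> \<longrightarrow> P \<sigma>)"
      using finite_asgs[OF finI finJ] measurable_is_opt
      by (intro pred_intros_finite pred_intros_logic) auto
    then show ?thesis unfolding all_eq by (simp add: pred_def)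
  qed
  let ?B = "{w \<in> space (exp_space N). \<forall>\<sigma>. is_opt k I J (cost_mat Z w) \<sigma> \<longrightarrow> c0 \<in> snd ` \<sigma>}"
  have "(\<Sum>i\<in>I. Om.expectation (\<lambda>w. mincost k I J (cost_mat Z w)) -
      Om.expectation (\<lambda>w. mincost k I J (cost_mat (insert (i, c0) Z) w))) =
    (\<Sum>i\<in>I. Om.prob {w \<in> space (exp_space N). \<forall>\<sigma>. is_opt k I J (cost_mat Z w) \<sigma> \<longrightarrow> (i, c0) \<in> \<sigma>})"
    using c0 by (intro sum.cong expectation_zero_entry) (auto simp: rev_image_eqI)
  also have "\<dots> = Om.prob ?B"
  proof (rule Om.prob_sum[symmetric])
    show "AE w in exp_space N.
      (\<forall>i\<in>I. (\<forall>\<sigma>. is_opt k I J (cost_mat Z w) \<sigma> \<longrightarrow> (i, c0) \<in> \<sigma>) \<longrightarrow>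
         (\<forall>\<sigma>. is_opt k I J (cost_mat Z w) \<sigma> \<longrightarrow> c0 \<in> snd ` \<sigma>)) \<and>
      ((\<forall>\<sigma>. is_opt k I J (cost_mat Z w) \<sigma> \<longrightarrow> c0 \<in> snd ` \<sigma>) \<longrightarrow>
         (\<exists>!i. i \<in> I \<and> (\<forall>\<sigma>. is_opt k I J (cost_mat Z w) \<sigma> \<longrightarrow> (i, c0) \<in> \<sigma>)))"
      using AE_cost_mat
    proof eventually_elim
      case (elim w)
      have 1: "c0 \<in> snd ` \<sigma>" if "(i, c0) \<in> \<sigma>" for i \<sigma> using that by (rule rev_image_eqI) simp
      have 2: "\<exists>!i. i \<in> I \<and> (\<forall>\<sigma>. is_opt k I J (cost_mat Z w) \<sigma> \<longrightarrow> (i, c0) \<in> \<sigma>)"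
        if all: "\<forall>\<sigma>. is_opt k I J (cost_mat Z w) \<sigma> \<longrightarrow> c0 \<in> snd ` \<sigma>"
      proof -
        obtain \<sigma> where \<sigma>: "is_opt k I J (cost_mat Z w) \<sigma>" using finI finJ k by (rule ex_is_opt)
        then obtain i where i: "(i, c0) \<in> \<sigma>" using all by force
        have \<sigma>': "\<sigma> \<subseteq> I \<times> J" "matching \<sigma>" using \<sigma> by (auto simp: is_opt_def asgs_def)
        have "(i, c0) \<in> \<tau>" if "is_opt k I J (cost_mat Z w) \<tau>" for \<tau>
        proof -
          \<comment> \<open>Column \<open>c0\<close> has no zeros, so its entry belongs to the part
            that all optima share.\<close>
          have "(i, c0) \<in> \<sigma> - Z" using i c0(2) by (auto simp: rev_image_eqI)
          then show ?thesis using generic_is_opt[OF _ \<sigma> that] elim by auto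
        qed
        moreover have "j = i" if "\<forall>\<tau>. is_opt k I J (cost_mat Z w) \<tau> \<longrightarrow> (j, c0) \<in> \<tau>" for j
          using matching_col_unique[OF \<sigma>'(2) _ i, of j] that \<sigma> by simp
        ultimately show ?thesis using i \<sigma>'(1) by (intro ex1I[of _ i]) auto
      qed
      show ?case
      proof (intro conjI ballI impI)
        fix i assume *: "\<forall>\<sigma>. is_opt k I J (cost_mat Z w) \<sigma> \<longrightarrow> (i, c0) \<in> \<sigma>"
        show "\<forall>\<sigma>. is_opt k I J (cost_mat Z w) \<sigma> \<longrightarrow> c0 \<in> snd ` \<sigma>"
        proof (intro allI impI)
          fix \<sigma> assume "is_opt k I J (cost_mat Z w) \<sigma>"
          then have "(i, c0) \<in> \<sigma>" using * by simp
          then show "c0 \<in> snd ` \<sigma>" by (rule 1)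
        qed
      qed (rule 2)
    qed
  qed (use finI meas in auto)
  also have "?B = space (exp_space N) - ?A" by auto
  also have "Om.prob (space (exp_space N) - ?A) = 1 - Om.prob ?A"
  proof (rule Om.prob_compl)
    have "?A = space (exp_space N) - ?B" by auto
    then show "?A \<in> sets (exp_space N)" using meas by simp
  qed
  finally show ?thesis .
qed

end

section \<open>The expected minimal cost\<close>

lemma mincost_row:
  fixes a :: "'r \<times> 'c \<Rightarrow> real"
  assumes fin: "finite I" "finite J" and i: "i \<in> I" and s: "Suc s \<le> card I" "Suc s \<le> card J"
    and full: "s < card {c. (i, c) \<in> Z}" and Z: "Z \<subseteq> I \<times> J"
    and nn: "\<And>p. p \<in> I \<times> J \<Longrightarrow> 0 \<le> a p" and zero: "\<And>p. p \<in> Z \<Longrightarrow> a p = 0"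
  shows "mincost (Suc s) I J a = mincost s (I - {i}) J a"
proof (rule antisym)
  have fin': "finite (I - {i})" "s \<le> card (I - {i})" "s \<le> card J" using fin s i by auto
  obtain \<sigma> where \<sigma>: "is_opt s (I - {i}) J a \<sigma>" using fin'(1) fin(2) fin'(2,3) by (rule ex_is_opt)
  then have \<sigma>': "\<sigma> \<subseteq> (I - {i}) \<times> J" "card \<sigma> = s" "matching \<sigma>" by (auto simp: is_opt_def asgs_def)
  have f\<sigma>: "finite \<sigma>" using \<sigma>'(1) fin by (meson finite_Diff finite_SigmaI finite_subset)
  have "card (snd ` \<sigma>) < card {c. (i, c) \<in> Z}" using \<sigma>'(2,3) full by (simp add: matching_card)
  then have "\<not> {c. (i, c) \<in> Z} \<subseteq> snd ` \<sigma>" using f\<sigma> card_mono[of "snd ` \<sigma>" "{c. (i, c) \<in> Z}"] by auto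
  then obtain c where c: "(i, c) \<in> Z" "c \<notin> snd ` \<sigma>" by auto
  have ni: "i \<notin> fst ` \<sigma>" using \<sigma>'(1) by auto
  have "(i, c) \<notin> \<sigma>" using not_in_fst[OF ni] .
  then have "insert (i, c) \<sigma> \<in> asgs (Suc s) I J" "sum a (insert (i, c) \<sigma>) = sum a \<sigma>"
    using \<sigma>' f\<sigma> c Z zero[OF c(1)] matching_insert[OF \<sigma>'(3) ni c(2)] by (auto simp: asgs_def)
  then have "mincost (Suc s) I J a \<le> sum a \<sigma>"
    unfolding mincost_def using finite_asgs[OF fin] by (metis Min_le finite_imageI imageI)
  then show "mincost (Suc s) I J a \<le> mincost s (I - {i}) J a"
    using mincost_eqI[OF fin'(1) fin(2) \<sigma>] by simp
  obtain \<tau> where \<tau>: "is_opt (Suc s) I J a \<tau>" using fin s by (rule ex_is_opt)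
  then have \<tau>': "\<tau> \<subseteq> I \<times> J" "card \<tau> = Suc s" "matching \<tau>" by (auto simp: is_opt_def asgs_def)
  have f\<tau>: "finite \<tau>" using \<tau>'(2) by (metis card.infinite nat.distinct(1))
  obtain p where p: "p \<in> \<tau>" "i \<notin> fst ` (\<tau> - {p})"
  proof (cases "i \<in> fst ` \<tau>")
    case True
    then obtain d where "(i, d) \<in> \<tau>" by auto
    then show ?thesis using that matching_Diff(2)[OF \<tau>'(3)] by blast
  next
    case False
    have "\<tau> \<noteq> {}" using \<tau>'(2) by auto
    then obtain p where "p \<in> \<tau>" by auto
    then show ?thesis using that[of p] False by auto
  qed
  have "\<tau> - {p} \<subseteq> (I - {i}) \<times> J"
  proof
    fix q assume q: "q \<in> \<tau> - {p}"
    then have "fst q \<noteq> i" using p(2) by blast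
    then show "q \<in> (I - {i}) \<times> J" using q \<tau>'(1) by (auto simp: mem_Times_iff)
  qed
  then have "\<tau> - {p} \<in> asgs s (I - {i}) J"
    using p(1) \<tau>' f\<tau> matching_subset[OF \<tau>'(3), of "\<tau> - {p}"] by (auto simp: asgs_def)
  then have "mincost s (I - {i}) J a \<le> sum a (\<tau> - {p})"
    unfolding mincost_def using finite_asgs[OF fin'(1) fin(2)] by (intro Min_le) auto
  also have "\<dots> \<le> sum a \<tau>" using f\<tau> \<tau>'(1) nn by (intro sum_mono2) auto
  finally show "mincost s (I - {i}) J a \<le> mincost (Suc s) I J a" using mincost_eqI[OF fin \<tau>] by simp
qed

text \<open>Koenig's theorem: the closure of the empty set gives a smallest cover, whose rows and
  columns are matched by zeros through \<open>hall_rows\<close> and \<open>hall_cols\<close> with no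
  row or column in common.\<close>

lemma ex_zero_matching:
  fixes Z :: "(nat \<times> nat) set"
  assumes fin: "finite I" "finite J" and Z: "Z \<subseteq> I \<times> J" and s: "s \<le> card I"
    and no: "\<not> pcover I J Z s {} {}"
  shows "\<exists>\<sigma>\<in>asgs (Suc s) I J. \<sigma> \<subseteq> Z"
proof -
  interpret zero_pattern I J Z using fin Z by unfold_locales
  let ?S = "clos Z J {}"
  have cl: "is_clos Z J {} ?S" using fin by (intro is_clos_clos) auto
  have "\<not> csize Z ?S \<le> s" using no pcover_iff_csize[OF s empty_subsetI] closD(3)[OF cl] by blast
  then have big: "Suc s \<le> csize Z ?S" by simp
  \<comment> \<open>\<open>hall_rows\<close> asks for a column to be avoided; an infinite column
    type always has one outside the finite closure.\<close>
  obtain c where c: "c \<notin> ?S" using closD(4)[OF cl] ex_new_if_finite[OF infinite_UNIV_nat] by auto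
  obtain \<zeta> where \<zeta>: "\<zeta> \<subseteq> Z" "matching \<zeta>" "fst ` \<zeta> = rows_out Z ?S" "snd ` \<zeta> \<inter> insert c ?S = {}"
    by (rule hall_rows[OF fin Z closD(1)[OF cl] c])
  obtain \<xi> where \<xi>: "\<xi> \<subseteq> Z" "matching \<xi>" "snd ` \<xi> = ?S - {}" "fst ` \<xi> \<subseteq> rows_out Z {} - rows_out Z ?S"
    by (rule hall_cols[OF fin Z cl])
  have m: "matching (\<zeta> \<union> \<xi>)" using \<zeta> \<xi> by (intro matching_Un) auto
  have "\<zeta> \<inter> \<xi> = {}" using \<zeta>(3) \<xi>(4) by fastforce
  moreover have "finite \<zeta>" "finite \<xi>" using \<zeta>(1) \<xi>(1) finite_subset[OF _ finZ] by auto
  ultimately have "card (\<zeta> \<union> \<xi>) = csize Z ?S"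
    using matching_card(1)[OF \<zeta>(2)] matching_card(2)[OF \<xi>(2)] \<zeta>(3) \<xi>(3)
    by (simp add: card_Un_disjoint csize_def)
  then obtain \<sigma> where \<sigma>: "\<sigma> \<subseteq> \<zeta> \<union> \<xi>" "card \<sigma> = Suc s" using big by (metis obtain_subset_with_card_n)
  then have "\<sigma> \<subseteq> Z" using \<zeta>(1) \<xi>(1) by auto
  moreover have "\<sigma> \<in> asgs (Suc s) I J"
    using \<sigma> \<open>\<sigma> \<subseteq> Z\<close> Z matching_subset[OF m \<sigma>(1)] by (auto simp: asgs_def)
  ultimately show ?thesis by blast
qed

lemma cformula_no_cover:
  assumes "\<not> pcover I J Z s {} {}"
  shows "cformula I J Z s = 0"
proof -
  have "\<not> pcover I J Z s R C" for R C using assms pcover_mono[of I J Z s R C "{}" "{}"] by auto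
  then show ?thesis by (simp add: cformula_def)
qed

text \<open>This is where the number of columns matters.\<close>

lemma ex_zero_free_column:
  assumes fin: "finite I" "finite J" and Z: "Z \<subseteq> I \<times> J" and pc: "pcover I J Z s {} {}"
    and rows: "\<And>i. i \<in> I \<Longrightarrow> card {c. (i, c) \<in> Z} \<le> s" and J: "s\<^sup>2 < card J"
  obtains c where "c \<in> J" "c \<notin> snd ` Z"
proof -
  obtain R C where RC: "cover I J Z s R C" using pc by (auto simp: pcover_def)
  have f: "finite R" "finite C" using RC fin by (auto simp: cover_def intro: finite_subset)
  have finc: "finite {c. (i, c) \<in> Z}" for i using Z fin by (intro finite_subset[OF _ fin(2)]) auto
  have sub: "snd ` Z \<subseteq> C \<union> (\<Union>i\<in>R. {c. (i, c) \<in> Z})" using RC by (auto simp: cover_def)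
  have finite: "finite (C \<union> (\<Union>i\<in>R. {c. (i, c) \<in> Z}))" using f finc by auto
  have "card (\<Union>i\<in>R. {c. (i, c) \<in> Z}) \<le> (\<Sum>i\<in>R. card {c. (i, c) \<in> Z})" using f by (intro card_UN_le)
  also have "\<dots> \<le> (\<Sum>i\<in>R. s)" using RC rows by (intro sum_mono) (auto simp: cover_def)
  finally have U: "card (\<Union>i\<in>R. {c. (i, c) \<in> Z}) \<le> card R * s" by simp
  have "card (snd ` Z) \<le> card C + card R * s"
    using card_mono[OF finite sub] card_Un_le[of C "\<Union>i\<in>R. {c. (i, c) \<in> Z}"] U by linarith
  \<comment> \<open>For \<open>s = 0\<close> the cover is empty, so \<open>C\<close> contributes
    nothing; otherwise the factor \<open>s\<close> is at least 1.\<close>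
  also have "\<dots> \<le> card C * s + card R * s"
    using RC by (cases s) (auto simp: cover_def)
  also have "\<dots> = s\<^sup>2" using RC by (simp add: cover_def power2_eq_square flip: add_mult_distrib)
  finally have "card (snd ` Z) < card J" using J by simp
  then have "\<not> J \<subseteq> snd ` Z" using finite_subset[OF sub finite] by (meson card_mono leD)
  then show ?thesis using that by auto
qed

text \<open>Two nested inductions: the outer one on \<open>s\<close> removes a row with too many
  zeros, the inner one on the number of nonzero positions inserts zeros. \<open>J\<close> and
  \<open>N\<close> stay fixed throughout.\<close>

theorem expectation_mincost:
  fixes I J :: "nat set"
  assumes fin: "finite I" "finite J" "finite N" and Z: "Z \<subseteq> I \<times> J" and N: "I \<times> J - Z \<subseteq> N"
    and k: "Suc s \<le> card I" "Suc s \<le> card J" and J: "s\<^sup>2 < card J"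
  shows "(\<integral>w. mincost (Suc s) I J (cost_mat Z w) \<partial>exp_space N) = cformula I J Z s"
proof -
  \<comment> \<open>The inner induction for fixed \<open>s\<close> and \<open>I\<close>, with the
    case of a row with more than \<open>s\<close> zeros left as the hypothesis
    \<open>row\<close>.\<close>
  have gen: "(\<integral>w. mincost (Suc s) I J (cost_mat Z w) \<partial>exp_space N) = cformula I J Z s"
    if row: "\<And>Z i. finite I \<Longrightarrow> Z \<subseteq> I \<times> J \<Longrightarrow> I \<times> J - Z \<subseteq> N \<Longrightarrow> pcover I J Z s {} {} \<Longrightarrow>
        i \<in> I \<Longrightarrow> s < card {c. (i, c) \<in> Z} \<Longrightarrow>
        (\<integral>w. mincost (Suc s) I J (cost_mat Z w) \<partial>exp_space N) = cformula I J Z s"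
      and prems: "finite I" "Z \<subseteq> I \<times> J" "I \<times> J - Z \<subseteq> N" "Suc s \<le> card I" "Suc s \<le> card J"
        "s\<^sup>2 < card J"
    for s Z and I :: "nat set"
    using prems(2,3)
  proof (induction "card (I \<times> J - Z)" arbitrary: Z rule: less_induct)
    case less
    interpret random_pattern I J Z N "Suc s"
      using prems(1,4,5) less.prems fin(2,3) by unfold_locales auto
    have finIJ: "finite (I \<times> J)" using prems(1) fin(2) by simp
    show ?case
    proof (cases "pcover I J Z s {} {}")
      case False
      obtain \<sigma> where \<sigma>: "\<sigma> \<in> asgs (Suc s) I J" "\<sigma> \<subseteq> Z"
        using ex_zero_matching[OF prems(1) fin(2) less.prems(1) _ False] prems(4) by auto
      have "AE w in exp_space N. mincost (Suc s) I J (cost_mat Z w) = 0"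
        using AE_cost_mat
      proof eventually_elim
        case (elim w)
        have 0: "sum (cost_mat Z w) \<sigma> = 0" using \<sigma>(2) by (intro sum.neutral) (auto simp: cost_mat_def)
        have "0 \<le> sum (cost_mat Z w) \<tau>" if "\<tau> \<in> asgs (Suc s) I J" for \<tau>
          using that elim by (intro sum_nonneg) (auto simp: asgs_def)
        then have "is_opt (Suc s) I J (cost_mat Z w) \<sigma>" using \<sigma>(1) 0 by (simp add: is_opt_def)
        then show ?case using mincost_eqI[OF prems(1) fin(2)] 0 by simp
      qed
      then have "(\<integral>w. mincost (Suc s) I J (cost_mat Z w) \<partial>exp_space N) = (\<integral>w. 0 \<partial>exp_space N)"
        using measurable_mincost by (intro integral_cong_AE) auto
      then show ?thesis using cformula_no_cover[OF False] by simp
    next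
      case True
      show ?thesis
      proof (cases "\<exists>i\<in>I. s < card {c. (i, c) \<in> Z}")
        case True
        then show ?thesis using row[OF prems(1) less.prems \<open>pcover I J Z s {} {}\<close>] by blast
      next
        case False
        then have rows: "\<And>i. i \<in> I \<Longrightarrow> card {c. (i, c) \<in> Z} \<le> s" by (simp add: not_less)
        obtain c where c: "c \<in> J" "c \<notin> snd ` Z"
          by (rule ex_zero_free_column[OF prems(1) fin(2) less.prems(1) True rows prems(6)])
        let ?E = "\<lambda>Z. \<integral>w. mincost (Suc s) I J (cost_mat Z w) \<partial>exp_space N"
        have IH: "?E (insert (i, c) Z) = cformula I J (insert (i, c) Z) s" if i: "i \<in> I" for i
        proof (rule less.hyps)
          have "(i, c) \<in> I \<times> J - Z" using i c by (auto simp: rev_image_eqI)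
          then have "I \<times> J - insert (i, c) Z \<subset> I \<times> J - Z" by auto
          then show "card (I \<times> J - insert (i, c) Z) < card (I \<times> J - Z)"
            using finIJ by (intro psubset_card_mono) auto
        qed (use less.prems i c in auto)
        \<comment> \<open>The urn probability is the sum of the drops both for the expectations and
          for the cover formula.\<close>
        have "(\<Sum>i\<in>I. ?E Z - ?E (insert (i, c) Z)) = urn (J - {c}) (pcover I J Z s {}) {}"
          using expectation_zero_column[OF c] prob_unused[OF c] True by simp
        also have "\<dots> = (\<Sum>i\<in>I. cformula I J Z s - cformula I J (insert (i, c) Z) s)"
          using prems(1,4) fin(2) c by (intro cformula_column[symmetric]) auto
        \<comment> \<open>By induction the terms with the extra zero cancel, leaving
          \<open>card I\<close> copies of the same difference.\<close>
        finally have "(\<Sum>i\<in>I. ?E Z - cformula I J Z s) = 0"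
          using IH by (simp add: sum_subtractf)
        moreover have "card I > 0" using prems(4) by simp
        ultimately show ?thesis by simp
      qed
    qed
  qed
  show ?thesis using assms
  proof (induction s arbitrary: I Z)
    case 0
    show ?case
    proof (rule gen)
      fix Z and i :: nat
      assume "pcover I J Z 0 {} {}" "i \<in> I" and pos: "0 < card {c. (i, c) \<in> Z}"
      then obtain R C where "cover I J Z 0 R C" by (auto simp: pcover_def)
      \<comment> \<open>A 0-cover exists only if there are no zeros, which contradicts the zeros in
        row \<open>i\<close>; the row case is vacuous.\<close>
      then have "Z = {}" using finite_subset[of R I] finite_subset[of C J] "0.prems" by (auto simp: cover_def)
      then show "(\<integral>w. mincost (Suc 0) I J (cost_mat Z w) \<partial>exp_space N) = cformula I J Z 0" using pos by simp
    qed (use "0.prems" in auto)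
  next
    case (Suc s)
    show ?case
    proof (rule gen)
      fix Z i
      assume ZN: "Z \<subseteq> I \<times> J" "I \<times> J - Z \<subseteq> N" and i: "i \<in> I" "Suc s < card {c. (i, c) \<in> Z}"
      interpret random_pattern I J Z N "Suc (Suc s)" using Suc.prems ZN by unfold_locales auto
      let ?Z = "{p \<in> Z. fst p \<noteq> i}"
      have cI: "card (I - {i}) = card I - 1" using i(1) by simp
      have "?Z \<subseteq> (I - {i}) \<times> J" using ZN(1) by auto
      moreover have "(I - {i}) \<times> J - ?Z \<subseteq> N" using ZN(2) by auto
      ultimately interpret Y: random_pattern "I - {i}" J ?Z N "Suc s"
        using Suc.prems(1-3,6,7) cI by unfold_locales auto
      have "AE w in exp_space N. mincost (Suc (Suc s)) I J (cost_mat Z w) = mincost (Suc s) (I - {i}) J (cost_mat ?Z w)"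
        using AE_cost_mat
      proof eventually_elim
        case (elim w)
        have "mincost (Suc (Suc s)) I J (cost_mat Z w) = mincost (Suc s) (I - {i}) J (cost_mat Z w)"
        proof (rule mincost_row)
          show "0 \<le> cost_mat Z w p" if "p \<in> I \<times> J" for p using elim that by blast
          show "cost_mat Z w p = 0" if "p \<in> Z" for p using that by (rule cost_mat_Z)
        qed (use Suc.prems ZN i in auto)
        also have "\<dots> = mincost (Suc s) (I - {i}) J (cost_mat ?Z w)"
          unfolding mincost_def
          by (intro arg_cong[where f = Min] image_cong sum.cong) (auto simp: asgs_def cost_mat_def)
        finally show ?case .
      qed
      then have "(\<integral>w. mincost (Suc (Suc s)) I J (cost_mat Z w) \<partial>exp_space N) =
        (\<integral>w. mincost (Suc s) (I - {i}) J (cost_mat ?Z w) \<partial>exp_space N)"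
        using measurable_mincost Y.measurable_mincost by (intro integral_cong_AE) auto
      also have "\<dots> = cformula (I - {i}) J ?Z s"
      proof (rule Suc.IH)
        have "s\<^sup>2 \<le> (Suc s)\<^sup>2" by (intro power_mono) auto
        then show "s\<^sup>2 < card J" using Suc.prems by linarith
      qed (use Suc.prems Y.Z Y.N cI in auto)
      also have "\<dots> = cformula I J Z (Suc s)"
        using Suc.prems i by (intro cformula_row[symmetric]) auto
      finally show "(\<integral>w. mincost (Suc (Suc s)) I J (cost_mat Z w) \<partial>exp_space N) = cformula I J Z (Suc s)" .
    qed (use Suc.prems in auto)
  qed
qed

section \<open>Transposition of the matrix\<close>

lemma asgs_swap: "S \<in> asgs k I J \<Longrightarrow> prod.swap ` S \<in> asgs k J I"
proof -
  assume S: "S \<in> asgs k I J"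
  have "inj_on prod.swap S" by simp
  moreover have "matching (prod.swap ` S)"
  proof -
    have "inj_on (fst \<circ> prod.swap) S" "inj_on (snd \<circ> prod.swap) S"
      using S by (auto simp: asgs_def matching_def comp_def)
    then show ?thesis unfolding matching_def by (auto intro: inj_on_imageI)
  qed
  ultimately show ?thesis using S by (auto simp: asgs_def card_image)
qed

lemma mem_swap_image_iff: "p \<in> prod.swap ` X \<longleftrightarrow> prod.swap p \<in> X"
  by (cases p) force

lemma mincost_swap: "mincost k J I (\<lambda>p. a (prod.swap p)) = mincost k I J a"
proof -
  have sum: "sum a (prod.swap ` S) = (\<Sum>p\<in>S. a (prod.swap p))" for S
    by (subst sum.reindex) (auto simp: inj_on_def)
  have "(\<lambda>S. \<Sum>p\<in>S. a (prod.swap p)) ` asgs k J I = sum a ` asgs k I J"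
  proof (intro equalityI subsetI)
    fix x assume "x \<in> (\<lambda>S. \<Sum>p\<in>S. a (prod.swap p)) ` asgs k J I"
    then obtain S where S: "S \<in> asgs k J I" "x = sum a (prod.swap ` S)" by (auto simp: sum)
    then show "x \<in> sum a ` asgs k I J" using asgs_swap[OF S(1)] by blast
  next
    fix x assume "x \<in> sum a ` asgs k I J"
    then obtain S where S: "S \<in> asgs k I J" "x = sum a S" by auto
    have "prod.swap ` prod.swap ` S = S" by (simp add: image_image)
    then have "x = (\<Sum>p\<in>prod.swap ` S. a (prod.swap p))" using S(2) sum[of "prod.swap ` S"] by simp
    then show "x \<in> (\<lambda>S. \<Sum>p\<in>S. a (prod.swap p)) ` asgs k J I" using asgs_swap[OF S(1)] by blast
  qed
  then show ?thesis by (simp add: mincost_def)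
qed

lemma pcover_rowD: "pcover I J Z s R C \<Longrightarrow> r \<in> R \<Longrightarrow> r \<in> I"
  and pcover_colD: "pcover I J Z s R C \<Longrightarrow> c \<in> C \<Longrightarrow> c \<in> J"
  unfolding pcover_def cover_def by blast+

lemma cformula_pairs:
  assumes fin: "finite I" "finite J"
  shows "cformula I J Z s = (\<Sum>(R, C) | pcover I J Z s R C. wt (card I) (card R) * wt (card J) (card C))"
proof -
  have "cformula I J Z s = (\<Sum>(C, R)\<in>Sigma (Pow J) (\<lambda>C. {R. R \<subseteq> I \<and> pcover I J Z s R C}).
      wt (card I) (card R) * wt (card J) (card C))"
    unfolding cformula_def using fin by (subst sum.Sigma) auto
  also have "\<dots> = (\<Sum>(R, C) | pcover I J Z s R C. wt (card I) (card R) * wt (card J) (card C))"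
    by (rule sum.reindex_bij_witness[of _ prod.swap prod.swap]) (auto dest: pcover_rowD pcover_colD)
  finally show ?thesis .
qed

lemma cformula_swap:
  assumes fin: "finite I" "finite J"
  shows "cformula J I (prod.swap ` Z) s = cformula I J Z s"
proof -
  have "cover J I (prod.swap ` Z) s C R \<longleftrightarrow> cover I J Z s R C" for R C
    by (auto simp: cover_def)
  then have "pcover J I (prod.swap ` Z) s C R \<longleftrightarrow> pcover I J Z s R C" for R C
    unfolding pcover_def by blast
  then show ?thesis
    unfolding cformula_pairs[OF fin] cformula_pairs[OF fin(2,1)]
    by (intro sum.reindex_bij_witness[of _ prod.swap prod.swap]) (auto simp: mult.commute)
qed

text \<open>The recursion needs many columns; this serves the case in which only the number of rows
  is known to be large. Reindexing the product measure transports the law.\<close>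

lemma expectation_mincost_swap:
  fixes Z :: "('r \<times> 'c) set"
  assumes fin: "finite I" "finite J" and N: "N = I \<times> J - Z" and Z: "Z \<subseteq> I \<times> J"
    and k: "k \<le> card I" "k \<le> card J"
  shows "(\<integral>w. mincost k I J (cost_mat Z w) \<partial>exp_space N) =
    (\<integral>w. mincost k J I (cost_mat (prod.swap ` Z) w) \<partial>exp_space (prod.swap ` N))"
proof -
  let ?N = "prod.swap ` N" and ?T = "\<lambda>w. \<lambda>p\<in>prod.swap ` N. w (prod.swap p)"
  interpret Y: random_pattern J I "prod.swap ` Z" ?N k
    using fin N Z k by unfold_locales auto
  have distr: "distr (exp_space N) (exp_space ?N) ?T = exp_space ?N"
    using distr_PiM_reindex[of N "\<lambda>_. expm" prod.swap ?N] prob_space_expm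
    by (simp add: exp_space_def inj_on_def Pi_def)
  have meas: "?T \<in> measurable (exp_space N) (exp_space ?N)"
    unfolding exp_space_def by (intro measurable_restrict measurable_component_singleton) auto
  have eq: "mincost k J I (cost_mat (prod.swap ` Z) (?T w)) = mincost k I J (cost_mat Z w)" for w
  proof -
    have "mincost k J I (cost_mat (prod.swap ` Z) (?T w)) = mincost k J I (\<lambda>p. cost_mat Z w (prod.swap p))"
      unfolding mincost_def
      by (intro arg_cong[where f = Min] image_cong sum.cong)
        (auto simp: asgs_def cost_mat_def N mem_swap_image_iff)
    then show ?thesis by (simp only: mincost_swap)
  qed
  have "(\<integral>w. mincost k J I (cost_mat (prod.swap ` Z) w) \<partial>exp_space ?N) =
    (\<integral>w. mincost k J I (cost_mat (prod.swap ` Z) (?T w)) \<partial>exp_space N)"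
    by (subst distr[symmetric], rule integral_distr[OF meas Y.measurable_mincost])
  then show ?thesis by (simp only: eq)
qed

text \<open>The minimal cost depends only on the joint law of the nonzero entries, which
  independence identifies with the product measure.\<close>

lemma expected_min_cost_exp_space:
  assumes rap: "standard_rap M k m n Z A"
  shows "expected_min_cost M k m n A =
    (\<integral>w. mincost k {..<m} {..<n} (cost_mat Z w) \<partial>exp_space (positions m n - Z))"
proof -
  let ?N = "positions m n - Z"
  interpret prob_space M using rap by (simp add: standard_rap_def)
  interpret random_pattern "{..<m}" "{..<n}" Z ?N k
    using rap by unfold_locales (auto simp: standard_rap_def positions_def)
  define X where "X \<omega> = (\<lambda>p\<in>?N. A p \<omega>)" for \<omega>
  have eq: "min_cost k m n (\<lambda>p. A p \<omega>) = mincost k {..<m} {..<n} (cost_mat Z (X \<omega>))" if "\<omega> \<in> space M" for \<omega>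
  proof -
    have "A p \<omega> = cost_mat Z (X \<omega>) p" if "p \<in> positions m n" for p
      using rap that \<open>\<omega> \<in> space M\<close> by (auto simp: standard_rap_def cost_mat_def X_def)
    moreover have "assignments k m n = asgs k {..<m} {..<n}"
      by (auto simp: assignments_def asgs_def positions_def matching_def)
    ultimately show ?thesis
      unfolding min_cost_def mincost_def
      by (intro arg_cong[where f = Min] image_cong sum.cong) (auto simp: asgs_def positions_def)
  qed
  have "expected_min_cost M k m n A = (\<integral>\<omega>. mincost k {..<m} {..<n} (cost_mat Z (X \<omega>)) \<partial>M)"
    unfolding expected_min_cost_def using eq by (intro Bochner_Integration.integral_cong) auto
  also have "\<dots> = (\<integral>w. mincost k {..<m} {..<n} (cost_mat Z w) \<partial>exp_space ?N)"
  \<comment> \<open>The description of independence by a product law is stated for nonempty index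
    sets; with no random entry the cost is constant.\<close>
  proof (cases "?N = {}")
    case True
    have "mincost k {..<m} {..<n} (cost_mat Z w) = mincost k {..<m} {..<n} (\<lambda>_. 0)" for w
      unfolding mincost_def using True
      by (intro arg_cong[where f = Min] image_cong sum.cong) (auto simp: asgs_def cost_mat_def positions_def)
    then show ?thesis using prob_space Om.prob_space by simp
  next
    case False
    have d: "distributed M lborel (A p) (exponential_density 1)" if "p \<in> ?N" for p
      using rap that by (auto simp: standard_rap_def)
    have rv: "A p \<in> borel_measurable M" if "p \<in> ?N" for p
      using distributed_measurable[OF d[OF that]] by simp
    have "distr M borel (A p) = expm" if "p \<in> ?N" for p
    proof -
      have "distr M borel (A p) = distr M lborel (A p)" by (rule distr_cong) auto
      then show ?thesis using distributed_distr_eq_density[OF d[OF that]] by (simp add: expm_def)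
    qed
    then have "(\<Pi>\<^sub>M p\<in>?N. distr M borel (A p)) = exp_space ?N"
      unfolding exp_space_def by (intro PiM_cong) auto
    moreover have "indep_vars (\<lambda>_. borel) A ?N" using rap by (simp add: standard_rap_def)
    ultimately have distr: "distr M (\<Pi>\<^sub>M p\<in>?N. borel) X = exp_space ?N"
      using indep_vars_iff_distr_eq_PiM'[where M' = "\<lambda>_. borel" and X = A, OF False] rv by (simp add: X_def[abs_def])
    have X: "X \<in> measurable M (\<Pi>\<^sub>M p\<in>?N. borel)"
      unfolding X_def[abs_def] using rv by (intro measurable_restrict) auto
    have "sets (exp_space ?N) = sets (\<Pi>\<^sub>M p\<in>?N. (borel :: real measure))"
      unfolding exp_space_def by (intro sets_PiM_cong) auto
    then have "(\<lambda>w. mincost k {..<m} {..<n} (cost_mat Z w)) \<in> borel_measurable (\<Pi>\<^sub>M p\<in>?N. borel)"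
      using measurable_mincost by (simp cong: measurable_cong_sets)
    then show ?thesis unfolding distr[symmetric] by (rule integral_distr[OF X, symmetric])
  qed
  finally show ?thesis .
qed

text \<open>Group the partial covers by their numbers of rows and columns;
  \<open>pcover_card\<close> puts all of them below \<open>k\<close> in total.\<close>

lemma cformula_partial_cover_count:
  assumes "0 < k"
  shows "cformula {..<m} {..<n} Z (k - 1) = 1 / (real m * real n) *
      (\<Sum>(i, j)\<in>{(i, j). i + j < k}.
         real (partial_cover_count k m n Z i j) /
           (real ((m - 1) choose i) * real ((n - 1) choose j)))"
proof -
  let ?P = "{(R, C). pcover {..<m} {..<n} Z (k - 1) R C}" and ?T = "{(i, j). i + j < k}"
  let ?h = "\<lambda>(i, j). wt m i * wt n j" and ?g = "\<lambda>(R, C). (card R, card C)"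
  have P: "partial_covers m n Z (k - 1) = ?P"
    by (auto simp: partial_covers_def covers_def pcover_def cover_def)
  have finP: "finite ?P"
    by (rule finite_subset[of _ "Pow {..<m} \<times> Pow {..<n}"]) (auto simp: pcover_def cover_def)
  have finT: "finite ?T"
    by (rule finite_subset[of _ "{..<k} \<times> {..<k}"]) auto
  have gT: "?g ` ?P \<subseteq> ?T"
    using pcover_card[of "{..<m}" "{..<n}" Z "k - 1"] assms by fastforce
  have "cformula {..<m} {..<n} Z (k - 1) = (\<Sum>x\<in>?P. ?h (?g x))"
    unfolding cformula_pairs[OF finite_lessThan finite_lessThan] by (intro sum.cong) auto
  also have "\<dots> = (\<Sum>y\<in>?T. \<Sum>x | x \<in> ?P \<and> ?g x = y. ?h (?g x))"
    using sum.group[OF finP finT gT, of "\<lambda>x. ?h (?g x)"] by simp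
  also have "\<dots> = (\<Sum>y\<in>?T. real (card {x. x \<in> ?P \<and> ?g x = y}) * ?h y)"
    by (intro sum.cong) auto
  also have "\<dots> = (\<Sum>(i, j)\<in>?T. 1 / (real m * real n) *
     (real (partial_cover_count k m n Z i j) / (real ((m - 1) choose i) * real ((n - 1) choose j))))"
  proof (rule sum.cong)
    fix y assume "y \<in> ?T"
    obtain i j where y: "y = (i, j)" by (cases y)
    have "{x. x \<in> ?P \<and> ?g x = y} =
      {(R, C). (R, C) \<in> partial_covers m n Z (k - 1) \<and> card R = i \<and> card C = j}"
      unfolding P y by auto
    then show "real (card {x. x \<in> ?P \<and> ?g x = y}) * ?h y = (case y of (i, j) \<Rightarrow> 1 / (real m * real n) *
     (real (partial_cover_count k m n Z i j) / (real ((m - 1) choose i) * real ((n - 1) choose j))))"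
      by (simp add: y partial_cover_count_def wt_def)
  qed simp
  finally show ?thesis by (simp add: sum_distrib_left case_prod_beta')
qed

theorem theorem5p3:
  fixes M :: "'w measure" and k m n :: nat and Z :: "(nat \<times> nat) set"
    and A :: "nat \<times> nat \<Rightarrow> 'w \<Rightarrow> real"
  assumes "standard_rap M k m n Z A"
    and "max m n > (k - 1)\<^sup>2"
  shows "expected_min_cost M k m n A =
    1 / (real m * real n) *
      (\<Sum>(i, j)\<in>{(i, j). i + j < k}.
         real (partial_cover_count k m n Z i j) /
           (real ((m - 1) choose i) * real ((n - 1) choose j)))"
proof -
  let ?I = "{..<m}" and ?J = "{..<n}" and ?N = "positions m n - Z"
  have k: "0 < k" "Suc (k - 1) \<le> card ?I" "Suc (k - 1) \<le> card ?J" and Z: "Z \<subseteq> ?I \<times> ?J"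
    using assms(1) by (auto simp: standard_rap_def positions_def)
  have N: "?N = ?I \<times> ?J - Z" by (simp add: positions_def)
  have "(\<integral>w. mincost (Suc (k - 1)) ?I ?J (cost_mat Z w) \<partial>exp_space ?N) = cformula ?I ?J Z (k - 1)"
  proof (cases "(k - 1)\<^sup>2 < n")
    case True
    then show ?thesis using k Z N by (intro expectation_mincost) auto
  next
    \<comment> \<open>Then the rows satisfy the bound, and the transposed matrix is used.\<close>
    case False
    then have m: "(k - 1)\<^sup>2 < card ?I" using assms(2) by auto
    have fN: "finite ?N" by (simp add: positions_def)
    have "(\<integral>w. mincost (Suc (k - 1)) ?I ?J (cost_mat Z w) \<partial>exp_space ?N) =
      (\<integral>w. mincost (Suc (k - 1)) ?J ?I (cost_mat (prod.swap ` Z) w) \<partial>exp_space (prod.swap ` ?N))"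
      by (rule expectation_mincost_swap[OF _ _ N Z k(2,3)]) auto
    also have "\<dots> = cformula ?J ?I (prod.swap ` Z) (k - 1)"
    proof (rule expectation_mincost)
      show "?J \<times> ?I - prod.swap ` Z \<subseteq> prod.swap ` ?N" by (auto simp: positions_def)
    qed (use fN Z k m in auto)
    also have "\<dots> = cformula ?I ?J Z (k - 1)" by (rule cformula_swap) auto
    finally show ?thesis .
  qed
  then show ?thesis
    using expected_min_cost_exp_space[OF assms(1)] cformula_partial_cover_count[OF k(1)] k(1) by simp
qed

end
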